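(* Let $((M,\nabla),h)$ be a Hessian manifold. If the fundamental group of $M$ is finite, then there exists $f\in C^\infty(M)$ such that $h=\nabla(df)$.
   Context: All smooth manifolds are connected and without boundary. An affine manifold $(M,\nabla)$ is a smooth manifold $M$ with a flat and torsion-free connection $\nabla$ on its tangent bundle. A Hessian metric on $(M,\nabla)$ is a Riemannian metric $h$ on $M$ such that every point has an open neighbourhood $U$ and a function $f\in C^\infty(U)$ with $h|_U=\nabla(df)$; then $((M,\nabla),h)$ is called a Hessian manifold. *)

theory Defs
  imports "HOL-Analysis.Analysis" "HOL-Algebra.Group"
begin

section \<open>Smooth manifolds\<close>

text \<open>\<open>C\<^sup>k\<close> maps, for open sets in finite-dimensional spaces: there, continuity of all iterated
  directional derivatives of total order \<open>k\<close> is continuity of the \<open>k\<close>-th derivative.\<close>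

primrec k_smooth_on ::
  "nat \<Rightarrow> 'a::real_normed_vector set \<Rightarrow> ('a \<Rightarrow> 'b::real_normed_vector) \<Rightarrow> bool" where
  "k_smooth_on 0 S f \<longleftrightarrow> continuous_on S f"
| "k_smooth_on (Suc k) S f \<longleftrightarrow>
     (\<forall>x\<in>S. f differentiable (at x)) \<and>
     (\<forall>v. k_smooth_on k S (\<lambda>x. frechet_derivative f (at x) v))"

definition smooth_on ::
  "'a::real_normed_vector set \<Rightarrow> ('a \<Rightarrow> 'b::real_normed_vector) \<Rightarrow> bool" where
  "smooth_on S f \<longleftrightarrow> (\<forall>k. k_smooth_on k S f)"

text \<open>A chart is a pair of its domain and its coordinate map. The manifold is the whole type
  \<open>'m\<close>; its topology is the one of the type.\<close>

type_synonym ('m, 'e) chart = "'m set \<times> ('m \<Rightarrow> 'e)"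

definition is_chart :: "('m::topological_space, 'e::topological_space) chart \<Rightarrow> bool" where
  "is_chart c \<longleftrightarrow> (case c of (U, \<phi>) \<Rightarrow>
     open U \<and> open (\<phi> ` U) \<and> homeomorphism U (\<phi> ` U) \<phi> (inv_into U \<phi>))"

text \<open>The model space is an arbitrary finite-dimensional inner product space. Class
  \<open>euclidean_space\<close> is not used because it would exclude manifolds of dimension \<open>0\<close>.\<close>

locale smooth_manifold =
  fixes A :: "('m::{t2_space, second_countable_topology}, 'e::real_inner) chart set"
  assumes finite_dimensional: "\<exists>B::'e set. finite B \<and> span B = UNIV"
    and connected_manifold: "connected (UNIV :: 'm set)"
    and charts: "c \<in> A \<Longrightarrow> is_chart c"
    and covering: "(\<Union>(U, \<phi>)\<in>A. U) = UNIV"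
    and compatible: "(U, \<phi>) \<in> A \<Longrightarrow> (V, \<psi>) \<in> A \<Longrightarrow> smooth_on (\<phi> ` (U \<inter> V)) (\<psi> \<circ> inv_into U \<phi>)"

text \<open>\<open>C_infinity A U\<close> is meant for open \<open>U\<close>; values outside \<open>U\<close> are irrelevant.\<close>

definition C_infinity ::
  "('m::topological_space, 'e::real_inner) chart set \<Rightarrow> 'm set \<Rightarrow> ('m \<Rightarrow> real) set" where
  "C_infinity A U = {f. \<forall>(V, \<phi>)\<in>A. smooth_on (\<phi> ` (U \<inter> V)) (f \<circ> inv_into V \<phi>)}"

definition smooth_near ::
  "('m::topological_space, 'e::real_inner) chart set \<Rightarrow> 'm \<Rightarrow> ('m \<Rightarrow> real) \<Rightarrow> bool" where
  "smooth_near A p f \<longleftrightarrow> (\<exists>U. open U \<and> p \<in> U \<and> f \<in> C_infinity A U)"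


section \<open>Tangent vectors and vector fields\<close>

type_synonym 'm tangent_vector = "('m \<Rightarrow> real) \<Rightarrow> real"
type_synonym 'm vector_field = "'m \<Rightarrow> 'm tangent_vector"

text \<open>Derivations at \<open>p\<close> of the algebra of germs of smooth functions. The value \<open>0\<close> on functions
  that are not smooth near \<open>p\<close> is a convention that makes equality of tangent vectors
  equality of HOL functions.\<close>

definition tangent_space ::
  "('m::topological_space, 'e::real_inner) chart set \<Rightarrow> 'm \<Rightarrow> 'm tangent_vector set" where
  "tangent_space A p = {v.
     (\<forall>f g. smooth_near A p f \<longrightarrow> smooth_near A p g \<longrightarrow> v (\<lambda>q. f q + g q) = v f + v g) \<and>
     (\<forall>a f. smooth_near A p f \<longrightarrow> v (\<lambda>q. a * f q) = a * v f) \<and>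
     (\<forall>f g. smooth_near A p f \<longrightarrow> smooth_near A p g \<longrightarrow>
        v (\<lambda>q. f q * g q) = f p * v g + v f * g p) \<and>
     (\<forall>f g. smooth_near A p f \<longrightarrow> (\<forall>\<^sub>F q in nhds p. f q = g q) \<longrightarrow> v f = v g) \<and>
     (\<forall>f. \<not> smooth_near A p f \<longrightarrow> v f = 0)}"

definition tv_add :: "'m tangent_vector \<Rightarrow> 'm tangent_vector \<Rightarrow> 'm tangent_vector" where
  "tv_add v w = (\<lambda>f. v f + w f)"

definition tv_scale :: "real \<Rightarrow> 'm tangent_vector \<Rightarrow> 'm tangent_vector" where
  "tv_scale a v = (\<lambda>f. a * v f)"

definition smooth_vector_fields ::
  "('m::topological_space, 'e::real_inner) chart set \<Rightarrow> 'm vector_field set" where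
  "smooth_vector_fields A = {X.
     (\<forall>p. X p \<in> tangent_space A p) \<and>
     (\<forall>U f. open U \<longrightarrow> f \<in> C_infinity A U \<longrightarrow> (\<lambda>p. X p f) \<in> C_infinity A U)}"

definition vf_add :: "'m vector_field \<Rightarrow> 'm vector_field \<Rightarrow> 'm vector_field" where
  "vf_add X Y = (\<lambda>p. tv_add (X p) (Y p))"

definition vf_diff :: "'m vector_field \<Rightarrow> 'm vector_field \<Rightarrow> 'm vector_field" where
  "vf_diff X Y = (\<lambda>p. tv_add (X p) (tv_scale (- 1) (Y p)))"

definition vf_scale :: "('m \<Rightarrow> real) \<Rightarrow> 'm vector_field \<Rightarrow> 'm vector_field" where
  "vf_scale u X = (\<lambda>p. tv_scale (u p) (X p))"

definition lie_bracket ::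
  "('m::topological_space, 'e::real_inner) chart set
    \<Rightarrow> 'm vector_field \<Rightarrow> 'm vector_field \<Rightarrow> 'm vector_field" where
  "lie_bracket A X Y = (\<lambda>p f.
     if smooth_near A p f then X p (\<lambda>q. Y q f) - Y p (\<lambda>q. X q f) else 0)"


section \<open>Connections and Hessian metrics\<close>

text \<open>Koszul connections on the tangent bundle; \<open>D X Y\<close> stands for \<open>\<nabla>\<^sub>X Y\<close>.
  Only the values of \<open>D\<close> on smooth vector fields matter.\<close>

type_synonym 'm connection = "'m vector_field \<Rightarrow> 'm vector_field \<Rightarrow> 'm vector_field"

definition is_connection ::
  "('m::topological_space, 'e::real_inner) chart set \<Rightarrow> 'm connection \<Rightarrow> bool" where
  "is_connection A D \<longleftrightarrow>
     (\<forall>X\<in>smooth_vector_fields A. \<forall>Y\<in>smooth_vector_fields A. D X Y \<in> smooth_vector_fields A) \<and>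
     (\<forall>X\<in>smooth_vector_fields A. \<forall>Y\<in>smooth_vector_fields A. \<forall>Z\<in>smooth_vector_fields A.
        D (vf_add X Y) Z = vf_add (D X Z) (D Y Z) \<and>
        D X (vf_add Y Z) = vf_add (D X Y) (D X Z)) \<and>
     (\<forall>u\<in>C_infinity A UNIV. \<forall>X\<in>smooth_vector_fields A. \<forall>Y\<in>smooth_vector_fields A.
        D (vf_scale u X) Y = vf_scale u (D X Y) \<and>
        D X (vf_scale u Y) = vf_add (vf_scale u (D X Y)) (vf_scale (\<lambda>p. X p u) Y))"

definition torsion_free ::
  "('m::topological_space, 'e::real_inner) chart set \<Rightarrow> 'm connection \<Rightarrow> bool" where
  "torsion_free A D \<longleftrightarrow>
     (\<forall>X\<in>smooth_vector_fields A. \<forall>Y\<in>smooth_vector_fields A.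
        vf_diff (D X Y) (D Y X) = lie_bracket A X Y)"

definition flat ::
  "('m::topological_space, 'e::real_inner) chart set \<Rightarrow> 'm connection \<Rightarrow> bool" where
  "flat A D \<longleftrightarrow>
     (\<forall>X\<in>smooth_vector_fields A. \<forall>Y\<in>smooth_vector_fields A. \<forall>Z\<in>smooth_vector_fields A.
        vf_diff (D X (D Y Z)) (D Y (D X Z)) = D (lie_bracket A X Y) Z)"

type_synonym 'm one_form = "'m \<Rightarrow> 'm tangent_vector \<Rightarrow> real"
type_synonym 'm two_tensor = "'m \<Rightarrow> 'm tangent_vector \<Rightarrow> 'm tangent_vector \<Rightarrow> real"

definition differential :: "('m \<Rightarrow> real) \<Rightarrow> 'm one_form" where
  "differential f = (\<lambda>p v. v f)"

text \<open>The covariant derivative \<open>(\<nabla>\<alpha>)(X, Y) = X(\<alpha>(Y)) - \<alpha>(\<nabla>\<^sub>X Y)\<close> of a one-form. Its value at \<open>p\<close>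
  depends on \<open>\<alpha>\<close> near \<open>p\<close> only, so \<open>\<alpha>\<close> may be a form on an open set containing \<open>p\<close>.\<close>

definition covariant_derivative ::
  "'m connection \<Rightarrow> 'm one_form \<Rightarrow> 'm vector_field \<Rightarrow> 'm vector_field \<Rightarrow> 'm \<Rightarrow> real" where
  "covariant_derivative D \<alpha> X Y = (\<lambda>p. X p (\<lambda>q. \<alpha> q (Y q)) - \<alpha> p (D X Y p))"

definition riemannian_metric ::
  "('m::topological_space, 'e::real_inner) chart set \<Rightarrow> 'm two_tensor \<Rightarrow> bool" where
  "riemannian_metric A h \<longleftrightarrow>
     (\<forall>p. \<forall>u\<in>tangent_space A p. \<forall>v\<in>tangent_space A p.
        h p u v = h p v u \<and>
        (\<forall>w\<in>tangent_space A p. h p (tv_add u v) w = h p u w + h p v w) \<and>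
        (\<forall>a. h p (tv_scale a u) v = a * h p u v)) \<and>
     (\<forall>p. \<forall>v\<in>tangent_space A p. v \<noteq> (\<lambda>f. 0) \<longrightarrow> 0 < h p v v) \<and>
     (\<forall>X\<in>smooth_vector_fields A. \<forall>Y\<in>smooth_vector_fields A.
        (\<lambda>p. h p (X p) (Y p)) \<in> C_infinity A UNIV)"

text \<open>The equation \<open>h|\<^sub>U = \<nabla>(df)\<close>. Both sides are tensors on \<open>U\<close>, and every tangent vector is a
  value of a global smooth vector field, so testing on global fields suffices.\<close>

definition equals_hessian_on ::
  "('m::topological_space, 'e::real_inner) chart set \<Rightarrow> 'm connection \<Rightarrow> 'm two_tensor
    \<Rightarrow> 'm set \<Rightarrow> ('m \<Rightarrow> real) \<Rightarrow> bool" where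
  "equals_hessian_on A D h U f \<longleftrightarrow>
     (\<forall>X\<in>smooth_vector_fields A. \<forall>Y\<in>smooth_vector_fields A. \<forall>p\<in>U.
        h p (X p) (Y p) = covariant_derivative D (differential f) X Y p)"

locale affine_manifold = smooth_manifold A
  for A :: "('m::{t2_space, second_countable_topology}, 'e::real_inner) chart set" +
  fixes D :: "'m connection"
  assumes connection: "is_connection A D"
    and flat: "flat A D"
    and torsion_free: "torsion_free A D"

locale hessian_manifold = affine_manifold A D
  for A :: "('m::{t2_space, second_countable_topology}, 'e::real_inner) chart set"
    and D :: "'m connection" +
  fixes h :: "'m two_tensor"
  assumes riemannian: "riemannian_metric A h"
    and local_potential: "\<exists>U f. open U \<and> p \<in> U \<and> f \<in> C_infinity A U \<and> equals_hessian_on A D h U f"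


section \<open>The fundamental group\<close>

definition loops :: "'m::topological_space \<Rightarrow> (real \<Rightarrow> 'm) set" where
  "loops x = {\<gamma>. path \<gamma> \<and> pathstart \<gamma> = x \<and> pathfinish \<gamma> = x}"

definition fundamental_group :: "'m::topological_space \<Rightarrow> (real \<Rightarrow> 'm) set monoid" where
  "fundamental_group x = \<lparr>
     carrier = loops x // {(\<gamma>, \<delta>). \<gamma> \<in> loops x \<and> \<delta> \<in> loops x \<and> homotopic_paths UNIV \<gamma> \<delta>},
     mult = (\<lambda>C D. {\<epsilon> \<in> loops x. \<exists>\<gamma>\<in>C. \<exists>\<delta>\<in>D. homotopic_paths UNIV (\<gamma> +++ \<delta>) \<epsilon>}),
     one = {\<epsilon> \<in> loops x. homotopic_paths UNIV (\<lambda>t. x) \<epsilon>}\<rparr>"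

end

theory Submission
  imports Defs
begin

text \<open>The difference of two local potentials is an affine function, that is, a function \<open>u\<close> with
  \<open>\<nabla>(du) = 0\<close>. Since \<open>\<nabla>\<close> is flat and torsion-free, the linear system for the 1-jet of \<open>u\<close> is
  completely integrable: near every point, an affine function with arbitrary prescribed 1-jet exists
  and is unique. Hence germs of potentials can be continued along paths, the continuation
  depends on the homotopy class only, and the fundamental group acts by affine maps on the
  germs of potentials at \<open>x\<^sub>0\<close>. The orbit of a germ under a finite group is finite, and its
  barycentre is a fixed point of the action, which continues to a global potential.\<close>

section \<open>Smooth maps between vector spaces\<close>

text \<open>Two obstacles shape the proof. The first is complete integrability in several variables:
  integrating the coefficient form of an approximate solution along rays from a base point gives a
  function whose differential differs from that form by an integral of its curl. Besides the
  distance of successive iterates, the iteration therefore controls the defect by which each one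
  fails the system; integrability bounds the curl by the defect, so that both decay geometrically on
  a small ball. The second is that \<open>D\<close> acts on global vector fields only: Christoffel
  symbols become available after the coordinate fields have been cut off by a bump function. In
  these terms torsion-freeness is the compatibility of the equations for the value of
  \<open>u\<close>, and flatness that of the equations for its first derivatives. No universal cover
  is built. Germs are carried by sections over paths and squares, and a homotopy enters as a map of
  the square. The barycentre has to be an affine combination, since \<open>\<nabla>(df) = h\<close>
  is inhomogeneous: coefficients of sum 1 reproduce \<open>h\<close>.\<close>

abbreviation dir_deriv ::
  "'a::real_normed_vector \<Rightarrow> ('a \<Rightarrow> 'b::real_normed_vector) \<Rightarrow> 'a \<Rightarrow> 'b" where
  "dir_deriv v f x \<equiv> frechet_derivative f (at x) v"

lemma dir_derivI: "(f has_derivative f') (at x) \<Longrightarrow> dir_deriv v f x = f' v"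
  by (metis frechet_derivative_at)

lemma k_smooth_on_SucD:
  assumes "k_smooth_on (Suc k) S f" "x \<in> S"
  shows "(f has_derivative (\<lambda>v. dir_deriv v f x)) (at x)"
  using assms by (simp add: frechet_derivative_works)

lemma k_smooth_on_Suc_imp: "k_smooth_on (Suc k) S f \<Longrightarrow> k_smooth_on k S f"
proof (induction k arbitrary: f)
  case 0
  then show ?case
    by (auto intro!: continuous_at_imp_continuous_on differentiable_imp_continuous_within)
next
  case (Suc k)
  then show ?case by (metis k_smooth_on.simps(2))
qed

lemma k_smooth_on_0: "k_smooth_on k S f \<Longrightarrow> continuous_on S f"
  by (induction k) (use k_smooth_on_Suc_imp in auto)

lemma k_smooth_on_subset: "k_smooth_on k S f \<Longrightarrow> T \<subseteq> S \<Longrightarrow> k_smooth_on k T f"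
  by (induction k arbitrary: f) (auto intro: continuous_on_subset)

text \<open>Derivatives are taken with \<open>at x\<close>, from all directions; openness of
  \<open>S\<close> is what lets agreement on \<open>S\<close> pass to them.\<close>

lemma k_smooth_on_cong:
  assumes "open S" "\<And>x. x \<in> S \<Longrightarrow> f x = g x" "k_smooth_on k S f"
  shows "k_smooth_on k S g"
  using assms(2,3)
proof (induction k arbitrary: f g)
  case 0
  then show ?case by (auto cong: continuous_on_cong)
next
  case (Suc k)
  have der: "(g has_derivative (\<lambda>v. dir_deriv v f x)) (at x)" if "x \<in> S" for x
    using k_smooth_on_SucD[OF Suc.prems(2) that]
    by (rule has_derivative_transform_within_open[OF _ \<open>open S\<close> that]) (use Suc.prems in auto)
  show ?case
    unfolding k_smooth_on.simps
  proof (intro conjI ballI allI)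
    fix x assume "x \<in> S"
    then show "g differentiable at x" using der unfolding differentiable_def by blast
  next
    fix v
    show "k_smooth_on k S (dir_deriv v g)"
    proof (rule Suc.IH)
      show "k_smooth_on k S (dir_deriv v f)" using Suc.prems by simp
      show "dir_deriv v f x = dir_deriv v g x" if "x \<in> S" for x
        using dir_derivI[OF der[OF that]] by simp
    qed
  qed
qed

text \<open>\<open>frechet_derivative\<close> is a choice operator. By uniqueness of derivatives any
  explicit formula \<open>f'\<close> may replace it, so smoothness can be proved by exhibiting
  formulas.\<close>

lemma k_smooth_on_SucI:
  assumes "open S" "\<And>x. x \<in> S \<Longrightarrow> (f has_derivative f' x) (at x)"
    "\<And>v. k_smooth_on k S (\<lambda>x. f' x v)"
  shows "k_smooth_on (Suc k) S f"
  unfolding k_smooth_on.simps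
proof (intro conjI ballI allI)
  fix x assume "x \<in> S"
  then show "f differentiable at x" using assms(2) unfolding differentiable_def by blast
next
  fix v
  show "k_smooth_on k S (dir_deriv v f)"
    by (rule k_smooth_on_cong[OF assms(1) _ assms(3)[of v]]) (simp add: dir_derivI[OF assms(2)])
qed

lemma k_smooth_on_local:
  assumes "\<And>x. x \<in> S \<Longrightarrow> \<exists>T. open T \<and> x \<in> T \<and> k_smooth_on k T f"
  shows "k_smooth_on k S f"
  using assms
proof (induction k arbitrary: f)
  case 0
  then show ?case
    by (force intro!: continuous_at_imp_continuous_on simp: continuous_on_eq_continuous_at)
next
  case (Suc k)
  show ?case
    unfolding k_smooth_on.simps
  proof (intro conjI ballI allI)
    fix x assume "x \<in> S"
    with Suc.prems[OF this] show "f differentiable at x" by auto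
  next
    fix v show "k_smooth_on k S (dir_deriv v f)"
      by (rule Suc.IH) (use Suc.prems in force)
  qed
qed

lemma k_smooth_on_const: "open S \<Longrightarrow> k_smooth_on k S (\<lambda>x. c)"
proof (induction k arbitrary: c)
  case (Suc k)
  show ?case by (rule k_smooth_on_SucI[where f' = "\<lambda>x v. 0"]) (use Suc in auto)
qed simp

lemma k_smooth_on_linear:
  assumes "open S" "bounded_linear f"
  shows "k_smooth_on k S f"
proof (cases k)
  case 0
  then show ?thesis using assms by (simp add: linear_continuous_on)
next
  case (Suc l)
  show ?thesis unfolding Suc
    by (rule k_smooth_on_SucI[where f' = "\<lambda>x. f"])
      (use assms in \<open>auto intro: k_smooth_on_const bounded_linear_imp_has_derivative\<close>)
qed

lemma k_smooth_on_bounded_linear: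
  assumes "open S" "bounded_linear L" "k_smooth_on k S f"
  shows "k_smooth_on k S (\<lambda>x. L (f x))"
  using assms(3)
proof (induction k arbitrary: f)
  case 0
  then show ?case using assms(2)
    by (auto intro: continuous_on_compose2[OF linear_continuous_on[OF assms(2), of UNIV]])
next
  case (Suc k)
  show ?case
    by (rule k_smooth_on_SucI[where f' = "\<lambda>x v. L (dir_deriv v f x)"])
      (use assms Suc k_smooth_on_SucD[OF Suc.prems] in
        \<open>auto intro: bounded_linear.has_derivative\<close>)
qed

lemma k_smooth_on_add:
  assumes "open S" "k_smooth_on k S f" "k_smooth_on k S g"
  shows "k_smooth_on k S (\<lambda>x. f x + g x)"
  using assms(2,3)
proof (induction k arbitrary: f g)
  case 0
  then show ?case by (auto intro: continuous_intros)
next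
  case (Suc k)
  show ?case
    by (rule k_smooth_on_SucI[where f' = "\<lambda>x v. dir_deriv v f x + dir_deriv v g x"])
      (use assms Suc k_smooth_on_SucD in \<open>auto intro!: has_derivative_add simp del: k_smooth_on.simps, auto\<close>)
qed

lemma k_smooth_on_mult:
  fixes f g :: "'a::real_normed_vector \<Rightarrow> real"
  assumes "open S" "k_smooth_on k S f" "k_smooth_on k S g"
  shows "k_smooth_on k S (\<lambda>x. f x * g x)"
  using assms(2,3)
proof (induction k arbitrary: f g)
  case 0
  then show ?case by (auto intro: continuous_intros)
next
  case (Suc k)
  show ?case
  proof (rule k_smooth_on_SucI[where f' = "\<lambda>x v. f x * dir_deriv v g x + dir_deriv v f x * g x"])
    show "((\<lambda>x. f x * g x) has_derivative (\<lambda>v. f x * dir_deriv v g x + dir_deriv v f x * g x)) (at x)"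
      if "x \<in> S" for x
      using Suc.prems that by (intro has_derivative_mult k_smooth_on_SucD)
    fix v
    show "k_smooth_on k S (\<lambda>x. f x * dir_deriv v g x + dir_deriv v f x * g x)"
      using Suc.prems k_smooth_on_Suc_imp
      by (intro k_smooth_on_add[OF \<open>open S\<close>] Suc.IH) auto
  qed fact
qed

lemma k_smooth_on_sum:
  assumes "open S" "\<And>i. i \<in> I \<Longrightarrow> k_smooth_on k S (f i)"
  shows "k_smooth_on k S (\<lambda>x. \<Sum>i\<in>I. f i x)"
  using assms(2)
  by (induction I rule: infinite_finite_induct)
    (auto intro: k_smooth_on_add k_smooth_on_const assms(1))

text \<open>The induction keeps \<open>f\<close> fixed: the derivative of \<open>1 / f\<close> is,
  up to sign, a derivative of \<open>f\<close> times \<open>1 / f\<close> twice, so order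
  \<open>k\<close> of \<open>1 / f\<close> gives order \<open>k + 1\<close>.\<close>

lemma k_smooth_on_inverse:
  fixes f :: "'a::real_normed_vector \<Rightarrow> real"
  assumes "open S" "\<And>x. x \<in> S \<Longrightarrow> f x \<noteq> 0" "k_smooth_on k S f"
  shows "k_smooth_on k S (\<lambda>x. inverse (f x))"
  using assms(3)
proof (induction k)
  case 0
  then show ?case using assms(2) by (auto intro: continuous_intros)
next
  case (Suc k)
  show ?case
  proof (rule k_smooth_on_SucI[where f' = "\<lambda>x v. (- 1) * (inverse (f x) * dir_deriv v f x * inverse (f x))"])
    show "((\<lambda>x. inverse (f x)) has_derivative
        (\<lambda>v. (- 1) * (inverse (f x) * dir_deriv v f x * inverse (f x)))) (at x)"
      if "x \<in> S" for x
      using Deriv.has_derivative_inverse[OF assms(2)[OF that] k_smooth_on_SucD[OF Suc.prems that]] by simp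
    fix v
    show "k_smooth_on k S (\<lambda>x. (- 1) * (inverse (f x) * dir_deriv v f x * inverse (f x)))"
      using Suc.prems k_smooth_on_Suc_imp[OF Suc.prems] Suc.IH assms(1)
      by (intro k_smooth_on_mult[OF \<open>open S\<close>] k_smooth_on_const) auto
  qed fact
qed

text \<open>Spanning is encoded by the expansion formula, the form in which it is used. The set may
  be empty, which covers dimension 0.\<close>

definition orthonormal_basis :: "'a::real_inner set \<Rightarrow> bool" where
  "orthonormal_basis B \<longleftrightarrow> finite B \<and> (\<forall>b\<in>B. \<forall>c\<in>B. b \<bullet> c = (if b = c then 1 else 0)) \<and>
     (\<forall>x. x = (\<Sum>b\<in>B. (x \<bullet> b) *\<^sub>R b))"

text \<open>Orthogonalise a finite spanning set, drop the zero vector and rescale the rest, which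
  keeps the span.\<close>

lemma orthonormal_basis_exists:
  fixes B :: "'a::real_inner set"
  assumes "finite B" "span B = UNIV"
  shows "\<exists>C :: 'a set. orthonormal_basis C"
proof -
  obtain C :: "'a set" where C: "finite C" "span C = UNIV" "pairwise orthogonal C"
    using basis_orthogonal[OF assms(1)] assms(2) by metis
  define N where "N = (\<lambda>c. c /\<^sub>R norm c) ` (C - {0})"
  have fin: "finite N" using C by (simp add: N_def)
  have orth: "b \<bullet> c = (if b = c then 1 else 0)" if "b \<in> N" "c \<in> N" for b c
    using that C(3) by (auto simp: N_def pairwise_def orthogonal_def power2_norm_eq_inner[symmetric] power2_eq_square, metis)
  have "span N = UNIV"
  proof -
    have "c \<in> span N" if "c \<in> C" for c
    proof (cases "c = 0")
      case False
      then have "c /\<^sub>R norm c \<in> span N" using that by (auto simp: N_def intro: span_base)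
      then have "norm c *\<^sub>R (c /\<^sub>R norm c) \<in> span N" by (rule span_scale)
      then show ?thesis using False by simp
    qed (simp add: span_zero)
    then have "span C \<subseteq> span N" by (simp add: span_minimal subsetI)
    then show ?thesis using C(2) by auto
  qed
  have "x = (\<Sum>b\<in>N. (x \<bullet> b) *\<^sub>R b)" for x
  proof -
    have "x \<in> span N" using \<open>span N = UNIV\<close> by simp
    then show ?thesis
    proof (induction rule: span_induct_alt)
      case (step c b y)
      have "(\<Sum>d\<in>N. ((c *\<^sub>R b + y) \<bullet> d) *\<^sub>R d) =
        c *\<^sub>R (\<Sum>d\<in>N. (if d = b then b else 0)) + (\<Sum>d\<in>N. (y \<bullet> d) *\<^sub>R d)"
        unfolding scaleR_sum_right sum.distrib[symmetric]
        by (rule sum.cong) (use orth step in \<open>auto simp: inner_add_left algebra_simps\<close>)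
      then show ?case using step fin by simp
    qed simp
  qed
  then show ?thesis using fin orth unfolding orthonormal_basis_def by blast
qed

section \<open>Coordinates with respect to an orthonormal basis\<close>

locale finite_basis =
  fixes B :: "'e::real_inner set"
  assumes onb: "orthonormal_basis B"
begin

lemma finite_B [simp]: "finite B"
  and inner_B: "b \<in> B \<Longrightarrow> c \<in> B \<Longrightarrow> b \<bullet> c = (if b = c then 1 else 0)"
  and expand_B: "x = (\<Sum>b\<in>B. (x \<bullet> b) *\<^sub>R b)"
  using onb unfolding orthonormal_basis_def by blast+

lemma norm_B [simp]: "b \<in> B \<Longrightarrow> norm b = 1"
  by (simp add: norm_eq_sqrt_inner inner_B)

lemma inner_B_le: "b \<in> B \<Longrightarrow> \<bar>x \<bullet> b\<bar> \<le> norm x"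
  using Cauchy_Schwarz_ineq2[of x b] by simp

lemma has_derivative_expand:
  assumes "(f has_derivative f') F"
  shows "f' v = (\<Sum>b\<in>B. (v \<bullet> b) *\<^sub>R f' b)"
proof -
  interpret bounded_linear f' using assms by (rule has_derivative_bounded_linear)
  show ?thesis by (subst expand_B[of v]) (simp add: sum scaleR)
qed

text \<open>In the chain rule the direction \<open>dir_deriv v f x\<close> moves with
  \<open>x\<close>, while \<open>k_smooth_on\<close> speaks of fixed directions. Expanding it in the
  finite basis leaves derivatives of \<open>g\<close> in the fixed directions
  \<open>b\<close>.\<close>

lemma k_smooth_on_compose:
  fixes f :: "'a::real_normed_vector \<Rightarrow> 'e" and g :: "'e \<Rightarrow> real"
  assumes "open S" "open T" "f ` S \<subseteq> T" "k_smooth_on k S f" "k_smooth_on k T g"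
  shows "k_smooth_on k S (\<lambda>x. g (f x))"
  using assms(4,5)
proof (induction k arbitrary: g)
  case 0
  then show ?case using assms(3) by (auto intro: continuous_on_compose2)
next
  case (Suc k)
  have der: "((\<lambda>x. g (f x)) has_derivative
      (\<lambda>v. \<Sum>b\<in>B. (dir_deriv v f x \<bullet> b) * dir_deriv b g (f x))) (at x)" if "x \<in> S" for x
  proof -
    have g: "(g has_derivative (\<lambda>v. dir_deriv v g (f x))) (at (f x))"
      using Suc.prems assms(3) that by (intro k_smooth_on_SucD) auto
    from has_derivative_compose[OF k_smooth_on_SucD[OF Suc.prems(1) that] g]
    show ?thesis by (subst (asm) has_derivative_expand[OF g]) simp
  qed
  show ?case
  proof (rule k_smooth_on_SucI[OF \<open>open S\<close> der])
    fix v
    have "k_smooth_on k S (\<lambda>x. dir_deriv b g (f x))" for b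
      using Suc.prems k_smooth_on_Suc_imp by (intro Suc.IH) auto
    moreover have "k_smooth_on k S (\<lambda>x. dir_deriv v f x \<bullet> b)" for b
      using Suc.prems by (intro k_smooth_on_bounded_linear[OF \<open>open S\<close> bounded_linear_inner_left]) auto
    ultimately show "k_smooth_on k S (\<lambda>x. \<Sum>b\<in>B. (dir_deriv v f x \<bullet> b) * dir_deriv b g (f x))"
      by (intro k_smooth_on_sum k_smooth_on_mult \<open>open S\<close>)
  qed
qed

end

lemma smooth_on_imp_continuous_on: "smooth_on S f \<Longrightarrow> continuous_on S f"
  by (meson smooth_on_def k_smooth_on_0)

lemma smooth_on_has_derivative:
  "smooth_on S f \<Longrightarrow> x \<in> S \<Longrightarrow> (f has_derivative (\<lambda>v. dir_deriv v f x)) (at x)"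
  by (meson smooth_on_def k_smooth_on_SucD)

lemma smooth_on_dir_deriv: "smooth_on S f \<Longrightarrow> smooth_on S (dir_deriv v f)"
  unfolding smooth_on_def by (metis k_smooth_on.simps(2))

lemma smooth_on_subset: "smooth_on S f \<Longrightarrow> T \<subseteq> S \<Longrightarrow> smooth_on T f"
  by (meson smooth_on_def k_smooth_on_subset)

lemma smooth_on_cong:
  "open S \<Longrightarrow> smooth_on S f \<Longrightarrow> (\<And>x. x \<in> S \<Longrightarrow> f x = g x) \<Longrightarrow> smooth_on S g"
  by (meson smooth_on_def k_smooth_on_cong)

lemma smooth_on_local:
  assumes "\<And>x. x \<in> S \<Longrightarrow> \<exists>T. open T \<and> x \<in> T \<and> smooth_on T f"
  shows "smooth_on S f"
  using assms k_smooth_on_local unfolding smooth_on_def by metis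

lemma smooth_on_const: "open S \<Longrightarrow> smooth_on S (\<lambda>x. c)"
  by (simp add: smooth_on_def k_smooth_on_const)

lemma smooth_on_linear: "open S \<Longrightarrow> bounded_linear f \<Longrightarrow> smooth_on S f"
  by (simp add: smooth_on_def k_smooth_on_linear)

lemma smooth_on_add:
  "open S \<Longrightarrow> smooth_on S f \<Longrightarrow> smooth_on S g \<Longrightarrow> smooth_on S (\<lambda>x. f x + g x)"
  by (simp add: smooth_on_def k_smooth_on_add)

lemma smooth_on_mult:
  fixes f g :: "'a::real_normed_vector \<Rightarrow> real"
  shows "open S \<Longrightarrow> smooth_on S f \<Longrightarrow> smooth_on S g \<Longrightarrow> smooth_on S (\<lambda>x. f x * g x)"
  by (simp add: smooth_on_def k_smooth_on_mult)

lemma smooth_on_sum: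
  "open S \<Longrightarrow> (\<And>i. i \<in> I \<Longrightarrow> smooth_on S (f i)) \<Longrightarrow> smooth_on S (\<lambda>x. \<Sum>i\<in>I. f i x)"
  by (simp add: smooth_on_def k_smooth_on_sum)

lemma smooth_on_inverse:
  fixes f :: "'a::real_normed_vector \<Rightarrow> real"
  shows "open S \<Longrightarrow> (\<And>x. x \<in> S \<Longrightarrow> f x \<noteq> 0) \<Longrightarrow> smooth_on S f \<Longrightarrow> smooth_on S (\<lambda>x. inverse (f x))"
  by (simp add: smooth_on_def k_smooth_on_inverse)

lemma (in finite_basis) smooth_on_compose:
  fixes f :: "'a::real_normed_vector \<Rightarrow> 'e" and g :: "'e \<Rightarrow> real"
  shows "open S \<Longrightarrow> open T \<Longrightarrow> f ` S \<subseteq> T \<Longrightarrow> smooth_on S f \<Longrightarrow> smooth_on T g \<Longrightarrow>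
    smooth_on S (\<lambda>x. g (f x))"
  by (simp add: smooth_on_def k_smooth_on_compose)

section \<open>Bump functions\<close>

text \<open>The classical flat function is the case \<open>n = 0\<close>. The negative powers make
  the family closed under differentiation, up to linear combinations, so that one induction shows
  all members smooth.\<close>

definition flat_exp :: "nat \<Rightarrow> real \<Rightarrow> real" where
  "flat_exp n x = (if x > 0 then exp (- inverse x) * inverse x ^ n else 0)"

text \<open>With \<open>y = 1 / x\<close> the limit from the right is that of
  \<open>y ^ n / exp y\<close> at infinity.\<close>

lemma flat_exp_tendsto_0: "(flat_exp n \<longlongrightarrow> 0) (at 0)"
proof -
  have "((\<lambda>y. inverse y ^ n / exp (inverse y)) \<longlongrightarrow> 0) (at_right (0::real))"
    by (rule filterlim_compose[OF tendsto_power_div_exp_0 filterlim_inverse_at_top_right])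
  then have "(flat_exp n \<longlongrightarrow> 0) (at_right 0)"
    by (rule Lim_transform_eventually)
      (auto simp: eventually_at_right_less flat_exp_def exp_minus divide_simps
        intro!: eventually_mono[OF eventually_at_right_less])
  moreover have "(flat_exp n \<longlongrightarrow> 0) (at_left 0)"
    by (rule Lim_transform_eventually[of "\<lambda>x. 0"])
      (auto simp: flat_exp_def intro!: eventually_mono[OF eventually_at_left_real[of "-1" 0]])
  ultimately show ?thesis by (simp add: filterlim_at_split)
qed

lemma flat_exp_derivative:
  "(flat_exp n has_real_derivative flat_exp (n + 2) x - real n * flat_exp (n + 1) x) (at x)"
proof -
  consider "x > 0" | "x < 0" | "x = 0" by linarith
  then show ?thesis
  proof cases
    case 1
    have "((\<lambda>x. exp (- inverse x) * inverse x ^ n) has_real_derivative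
        flat_exp (n + 2) x - real n * flat_exp (n + 1) x) (at x)"
      using 1 by (auto intro!: derivative_eq_intros simp: flat_exp_def field_simps power2_eq_square)
        (cases n; simp add: field_simps)
    then show ?thesis
      by (rule has_field_derivative_transform_within_open[of _ _ _ "{0<..}"])
        (use 1 in \<open>auto simp: flat_exp_def\<close>)
  next
    case 2
    have "((\<lambda>x. 0) has_real_derivative flat_exp (n + 2) x - real n * flat_exp (n + 1) x) (at x)"
      using 2 by (simp add: flat_exp_def)
    then show ?thesis
      by (rule has_field_derivative_transform_within_open[of _ _ _ "{..<0}"])
        (use 2 in \<open>auto simp: flat_exp_def\<close>)
  next
    case 3
    \<comment> \<open>Division by \<open>y\<close> turns \<open>flat_exp n\<close> into
      \<open>flat_exp (Suc n)\<close>, so the difference quotient at 0 is again a member of the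
      family.\<close>
    have "((\<lambda>y. (flat_exp n y - flat_exp n 0) / (y - 0)) \<longlongrightarrow> 0) (at 0)"
      by (rule Lim_transform_eventually[OF flat_exp_tendsto_0[of "Suc n"]])
        (auto simp: flat_exp_def eventually_at_filter divide_simps)
    then show ?thesis using 3 by (simp add: has_field_derivative_iff flat_exp_def)
  qed
qed

text \<open>For compositions with \<open>flat_exp\<close>, the middle space of the chain rule is the
  real line.\<close>

interpretation real_basis: finite_basis "{1::real}"
  by unfold_locales (simp add: orthonormal_basis_def)

lemma smooth_on_flat_exp: "smooth_on UNIV (flat_exp n)"
proof -
  have "k_smooth_on k UNIV (flat_exp n)" for k
  proof (induction k arbitrary: n)
    case 0
    show ?case
      by (auto intro!: continuous_at_imp_continuous_on DERIV_isCont[OF flat_exp_derivative])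
  next
    case (Suc k)
    show ?case
    proof (rule k_smooth_on_SucI)
      show "(flat_exp n has_derivative
          (\<lambda>v. (flat_exp (n + 2) x + (- real n) * flat_exp (n + 1) x) * v)) (at x)" for x
        using flat_exp_derivative[of n x] by (simp add: has_field_derivative_def)
    qed (intro k_smooth_on_mult k_smooth_on_add k_smooth_on_const Suc open_UNIV)+
  qed
  then show ?thesis by (simp add: smooth_on_def)
qed

lemma smooth_on_dist_squared: "smooth_on UNIV (\<lambda>x::'a::real_inner. (x - a) \<bullet> (x - a))"
proof -
  have lin: "k_smooth_on k UNIV (\<lambda>x::'a. 2 * ((x - a) \<bullet> v))" for k v
  proof -
    have "k_smooth_on k UNIV (\<lambda>x::'a. 2 * (x \<bullet> v) + - 2 * (a \<bullet> v))"
      by (intro k_smooth_on_add k_smooth_on_const k_smooth_on_linear bounded_linear_const_mult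
          bounded_linear_inner_left open_UNIV)
    then show ?thesis by (simp add: inner_diff_left algebra_simps)
  qed
  have "k_smooth_on (Suc k) UNIV (\<lambda>x::'a. (x - a) \<bullet> (x - a))" for k
  proof (rule k_smooth_on_SucI[OF open_UNIV _ lin])
    show "((\<lambda>x. (x - a) \<bullet> (x - a)) has_derivative (\<lambda>v. 2 * ((x - a) \<bullet> v))) (at x)" for x
      by (auto intro!: derivative_eq_intros simp: inner_commute)
  qed
  then show ?thesis using k_smooth_on_Suc_imp unfolding smooth_on_def by blast
qed

text \<open>The quotient \<open>u / (u + v)\<close>, where \<open>u\<close> vanishes for
  \<open>dist x a \<ge> R\<close> and \<open>v\<close> for \<open>dist x a \<le> r\<close>. Since
  \<open>r < R\<close> these regions are disjoint, so the denominator is positive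
  everywhere.\<close>

lemma smooth_bump_exists:
  fixes a :: "'a::real_inner"
  assumes "0 \<le> r" "r < R"
  obtains \<rho> :: "'a \<Rightarrow> real" where "smooth_on UNIV \<rho>"
    "\<And>x. dist x a \<le> r \<Longrightarrow> \<rho> x = 1" "\<And>x. dist x a \<ge> R \<Longrightarrow> \<rho> x = 0"
proof
  define s where "s = (\<lambda>x::'a. (x - a) \<bullet> (x - a))"
  define u v where "u = (\<lambda>x. flat_exp 0 (R\<^sup>2 + (- 1) * s x))" and "v = (\<lambda>x. flat_exp 0 (s x + (- (r\<^sup>2))))"
  have s: "s x = (dist x a)\<^sup>2" for x by (simp add: s_def dist_norm power2_norm_eq_inner)
  have smooth_s: "smooth_on UNIV s" unfolding s_def by (rule smooth_on_dist_squared)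
  have uv: "smooth_on UNIV u" "smooth_on UNIV v"
    unfolding u_def v_def
    by (intro real_basis.smooth_on_compose[OF _ _ _ _ smooth_on_flat_exp] smooth_on_add
        smooth_on_mult smooth_s smooth_on_const open_UNIV subset_UNIV)+
  have le: "r\<^sup>2 < R\<^sup>2" using assms by (simp add: power_strict_mono)
  have pos: "u x + v x > 0" for x
    using le unfolding u_def v_def flat_exp_def
    by (auto simp: add_pos_pos add_pos_nonneg add_nonneg_pos)
  show "smooth_on UNIV (\<lambda>x. u x * inverse (u x + v x))"
    by (intro smooth_on_mult smooth_on_inverse smooth_on_add uv open_UNIV) (use pos in \<open>auto simp: less_le\<close>)
  show "u x * inverse (u x + v x) = 1" if "dist x a \<le> r" for x
  proof -
    have "(dist x a)\<^sup>2 \<le> r\<^sup>2" using that by (simp add: power_mono)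
    then have "v x = 0" by (simp add: v_def flat_exp_def s)
    then show ?thesis using pos[of x] by simp
  qed
  show "u x * inverse (u x + v x) = 0" if "dist x a \<ge> R" for x
  proof -
    have "R\<^sup>2 \<le> (dist x a)\<^sup>2" using that assms by (simp add: power_mono)
    then show ?thesis by (simp add: u_def flat_exp_def s)
  qed
qed

section \<open>Integrals along rays\<close>

text \<open>For \<open>m = 0\<close> this is the homotopy operator of the Poincare lemma applied to
  one coefficient of a 1-form. Each differentiation in \<open>x\<close> brings out a factor
  \<open>t\<close>, which the exponent \<open>m\<close> records.\<close>

definition ray_integral :: "nat \<Rightarrow> 'a::real_normed_vector \<Rightarrow> ('a \<Rightarrow> real) \<Rightarrow> 'a \<Rightarrow> real" where
  "ray_integral m q \<phi> x = integral {0..1} (\<lambda>t. t ^ m * \<phi> (q + t *\<^sub>R (x - q)))"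

lemma ray_in_convex:
  assumes "convex S" "q \<in> S" "x \<in> S" "0 \<le> t" "t \<le> 1"
  shows "q + t *\<^sub>R (x - q) \<in> S"
proof -
  have "(1 - t) *\<^sub>R q + t *\<^sub>R x \<in> S" using assms by (intro convexD_alt) auto
  then show ?thesis by (simp add: algebra_simps)
qed

lemma continuous_on_ray:
  fixes S :: "'a::real_normed_vector set"
  assumes "convex S" "q \<in> S" "x \<in> S" "continuous_on S \<phi>"
  shows "continuous_on {0..1} (\<lambda>t. \<phi> (q + t *\<^sub>R (x - q)))"
proof (rule continuous_on_compose2[OF assms(4)])
  show "continuous_on {0..1} (\<lambda>t. q + t *\<^sub>R (x - q))" by (intro continuous_intros)
  show "(\<lambda>t. q + t *\<^sub>R (x - q)) ` {0..1} \<subseteq> S" using ray_in_convex[OF assms(1-3)] by auto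
qed

lemma ray_integrable:
  fixes S :: "'a::real_normed_vector set"
  assumes "convex S" "q \<in> S" "x \<in> S" "continuous_on S \<phi>"
  shows "(\<lambda>t. t ^ m * \<phi> (q + t *\<^sub>R (x - q))) integrable_on {0..1}"
  by (intro integrable_continuous_real continuous_intros continuous_on_ray[OF assms])

lemma ray_integral_diff:
  fixes S :: "'a::real_normed_vector set"
  assumes "convex S" "q \<in> S" "x \<in> S" "continuous_on S \<phi>" "continuous_on S \<psi>"
  shows "ray_integral m q \<phi> x - ray_integral m q \<psi> x = ray_integral m q (\<lambda>y. \<phi> y - \<psi> y) x"
  unfolding ray_integral_def
  by (subst integral_diff[symmetric, OF ray_integrable ray_integrable])
    (use assms in \<open>auto simp: algebra_simps\<close>)

lemma ray_integral_bound:
  fixes S :: "'a::real_normed_vector set"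
  assumes "convex S" "q \<in> S" "x \<in> S" "continuous_on S \<phi>" "\<And>y. y \<in> S \<Longrightarrow> \<bar>\<phi> y\<bar> \<le> K"
  shows "\<bar>ray_integral m q \<phi> x\<bar> \<le> K"
proof -
  have "\<bar>t ^ m * \<phi> (q + t *\<^sub>R (x - q))\<bar> \<le> K" if "t \<in> {0..1}" for t
  proof -
    have "\<bar>\<phi> (q + t *\<^sub>R (x - q))\<bar> \<le> K" using assms that by (auto intro!: ray_in_convex)
    moreover have "\<bar>t ^ m\<bar> \<le> 1" using that by (auto simp: power_le_one)
    ultimately show ?thesis by (metis abs_ge_zero abs_mult mult_1 mult_mono zero_le_one)
  qed
  moreover have "continuous_on {0..1} (\<lambda>t. t ^ m * \<phi> (q + t *\<^sub>R (x - q)))"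
    by (intro continuous_intros continuous_on_ray[OF assms(1-4)])
  ultimately have "norm (integral {0..1} (\<lambda>t. t ^ m * \<phi> (q + t *\<^sub>R (x - q)))) \<le> K * (1 - 0)"
    by (intro integral_bound) auto
  then show ?thesis by (simp add: ray_integral_def)
qed

lemma ray_integral_cong:
  fixes S :: "'a::real_normed_vector set"
  assumes "convex S" "q \<in> S" "x \<in> S" "\<And>y. y \<in> S \<Longrightarrow> \<phi> y = \<psi> y"
  shows "ray_integral m q \<phi> x = ray_integral m q \<psi> x"
  unfolding ray_integral_def
  by (rule integral_cong) (use assms ray_in_convex[OF assms(1-3)] in auto)

section \<open>Differentiation under the ray integral\<close>

context finite_basis
begin

text \<open>A closed ball is a closed subset of a translated box, and the box is compact by
  induction on the basis, one segment being added at a time.\<close>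

lemma compact_cball [simp]: "compact (cball (a::'e) r)"
proof -
  have "compact ((\<lambda>c. \<Sum>b\<in>F. c b *\<^sub>R b) ` {c. \<forall>b\<in>F. \<bar>c b\<bar> \<le> r})" if "finite F" for F :: "'e set"
    using that
  proof (induction F rule: finite_induct)
    case (insert b F)
    have eq: "(\<lambda>c. \<Sum>b\<in>insert b F. c b *\<^sub>R b) ` {c. \<forall>b\<in>insert b F. \<bar>c b\<bar> \<le> r} =
      {x + y |x y. x \<in> (\<lambda>t. t *\<^sub>R b) ` {-r..r} \<and> y \<in> (\<lambda>c. \<Sum>b\<in>F. c b *\<^sub>R b) ` {c. \<forall>b\<in>F. \<bar>c b\<bar> \<le> r}}"
      (is "?L = ?R")
    proof
      show "?L \<subseteq> ?R" using insert by (force simp: abs_le_iff)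
      show "?R \<subseteq> ?L"
      proof clarify
        fix t c assume "t \<in> {-r..r}" and c: "\<forall>b\<in>F. \<bar>c b\<bar> \<le> r"
        then show "t *\<^sub>R b + (\<Sum>b\<in>F. c b *\<^sub>R b) \<in> ?L"
          using insert by (intro image_eqI[of _ _ "c(b := t)"]) (auto intro!: sum.cong)
      qed
    qed
    have c: "compact ((\<lambda>t. t *\<^sub>R b) ` {-r..r})"
      by (intro compact_continuous_image continuous_intros compact_Icc)
    show ?case unfolding eq by (rule compact_sums[OF c insert.IH])
  qed simp
  from compact_translation[OF this[OF finite_B], of a]
  have *: "compact ((+) a ` ((\<lambda>c. \<Sum>b\<in>B. c b *\<^sub>R b) ` {c. \<forall>b\<in>B. \<bar>c b\<bar> \<le> r}))" .
  have "cball a r \<subseteq> (+) a ` ((\<lambda>c. \<Sum>b\<in>B. c b *\<^sub>R b) ` {c. \<forall>b\<in>B. \<bar>c b\<bar> \<le> r})"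
  proof
    fix x assume "x \<in> cball a r"
    then have "\<bar>(x - a) \<bullet> b\<bar> \<le> r" if "b \<in> B" for b
      using inner_B_le[OF that, of "x - a"] by (simp add: dist_norm norm_minus_commute)
    moreover have "x = a + (\<Sum>b\<in>B. ((x - a) \<bullet> b) *\<^sub>R b)" using expand_B[of "x - a"] by simp
    ultimately show "x \<in> (+) a ` ((\<lambda>c. \<Sum>b\<in>B. c b *\<^sub>R b) ` {c. \<forall>b\<in>B. \<bar>c b\<bar> \<le> r})"
      by (auto intro!: image_eqI[of _ _ "\<Sum>b\<in>B. ((x - a) \<bullet> b) *\<^sub>R b"] image_eqI[of _ _ "\<lambda>b. (x - a) \<bullet> b"])
  qed
  then show ?thesis using compact_Int_closed[OF * closed_cball[of a r]] by (simp add: Int_absorb1)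
qed

text \<open>Continuity along the rays is uniform in \<open>t\<close> because \<open>{0..1}\<close>
  is compact; one radius serves all \<open>b\<close> because \<open>B\<close> is finite.\<close>

lemma ray_uniform:
  fixes S :: "'e set"
  assumes S: "open S" "convex S" "q \<in> S" "x \<in> S" and P: "\<And>b. b \<in> B \<Longrightarrow> continuous_on S (P b)"
    and "e > 0"
  obtains d where "d > 0" "ball x d \<subseteq> S"
    "\<And>y t b. y \<in> ball x d \<Longrightarrow> 0 \<le> t \<Longrightarrow> t \<le> 1 \<Longrightarrow> b \<in> B \<Longrightarrow>
      \<bar>P b (q + t *\<^sub>R (y - q)) - P b (q + t *\<^sub>R (x - q))\<bar> \<le> (e::real)"
proof -
  have "\<exists>X. open X \<and> x \<in> X \<and> (\<forall>y\<in>X \<inter> S. \<forall>t\<in>{0..1}.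
      \<bar>P b (q + t *\<^sub>R (y - q)) - P b (q + t *\<^sub>R (x - q))\<bar> \<le> e)" if "b \<in> B" for b
  proof -
    have "continuous_on (S \<times> {0..1}) (\<lambda>(y, t). P b (q + t *\<^sub>R (y - q)))"
      unfolding split_beta
    proof (rule continuous_on_compose2[OF P[OF that]])
      show "continuous_on (S \<times> {0..1}) (\<lambda>z. q + snd z *\<^sub>R (fst z - q))" by (intro continuous_intros)
      show "(\<lambda>z. q + snd z *\<^sub>R (fst z - q)) ` (S \<times> {0..1}) \<subseteq> S"
        using ray_in_convex[OF S(2,3)] by auto
    qed
    from continuous_on_prod_compactE[OF this compact_Icc S(4) \<open>e > 0\<close>]
    obtain X where "x \<in> X" "open X" "\<forall>y\<in>X \<inter> S. \<forall>t\<in>{0..1}.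
        dist (case (y, t) of (y, t) \<Rightarrow> P b (q + t *\<^sub>R (y - q)))
          (case (x, t) of (y, t) \<Rightarrow> P b (q + t *\<^sub>R (y - q))) \<le> e"
      by metis
    then show ?thesis by (intro exI[of _ X]) (simp add: dist_real_def)
  qed
  then obtain X where X: "\<And>b. b \<in> B \<Longrightarrow> open (X b) \<and> x \<in> X b \<and> (\<forall>y\<in>X b \<inter> S. \<forall>t\<in>{0..1}.
      \<bar>P b (q + t *\<^sub>R (y - q)) - P b (q + t *\<^sub>R (x - q))\<bar> \<le> e)"
    by metis
  have "open (S \<inter> (\<Inter>b\<in>B. X b))" using X S by (intro open_Int open_INT) auto
  moreover have "x \<in> S \<inter> (\<Inter>b\<in>B. X b)" using X S by auto
  ultimately obtain d where d: "d > 0" "ball x d \<subseteq> S \<inter> (\<Inter>b\<in>B. X b)"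
    by (meson openE)
  show ?thesis
  proof
    show "d > 0" "ball x d \<subseteq> S" using d by auto
    show "\<bar>P b (q + t *\<^sub>R (y - q)) - P b (q + t *\<^sub>R (x - q))\<bar> \<le> e"
      if "y \<in> ball x d" "0 \<le> t" "t \<le> 1" "b \<in> B" for y t b
      using X[OF that(4)] d that by (auto simp: subset_iff)
  qed
qed

text \<open>For each fixed \<open>t\<close> the mean value theorem compares \<open>\<phi>\<close> on
  the rays to \<open>x\<close> and to \<open>y\<close>; by \<open>ray_uniform\<close> the error is
  uniform in \<open>t\<close> and can be integrated.\<close>

lemma has_derivative_ray_integral:
  fixes S :: "'e set"
  assumes S: "open S" "convex S" "q \<in> S"
    and der: "\<And>x. x \<in> S \<Longrightarrow> (\<phi> has_derivative (\<lambda>v. \<Sum>b\<in>B. (v \<bullet> b) * P b x)) (at x)"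
    and P: "\<And>b. b \<in> B \<Longrightarrow> continuous_on S (P b)"
    and x: "x \<in> S"
  shows "(ray_integral m q \<phi> has_derivative
    (\<lambda>v. \<Sum>b\<in>B. (v \<bullet> b) * ray_integral (Suc m) q (P b) x)) (at x)"
proof -
  let ?p = "\<lambda>t y. q + t *\<^sub>R (y - q)"
  have cont: "continuous_on S \<phi>"
    using der by (meson continuous_at_imp_continuous_on has_derivative_continuous)
  have "\<exists>d>0. \<forall>y. norm (y - x) < d \<longrightarrow>
      norm (ray_integral m q \<phi> y - ray_integral m q \<phi> x -
        (\<Sum>b\<in>B. ((y - x) \<bullet> b) * ray_integral (Suc m) q (P b) x)) \<le> e * norm (y - x)"
    if "e > 0" for e
  proof -
    \<comment> \<open>The error is a sum over \<open>B\<close> of terms at most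
      \<open>e' * norm (y - x)\<close>; adding 1 to the cardinality avoids division by 0 for an
      empty basis.\<close>
    define e' where "e' = e / (card B + 1)"
    have e': "e' > 0" "card B * e' \<le> e" using \<open>e > 0\<close> by (auto simp: e'_def field_simps)
    obtain d where d: "d > 0" "ball x d \<subseteq> S"
      "\<And>y t b. y \<in> ball x d \<Longrightarrow> 0 \<le> t \<Longrightarrow> t \<le> 1 \<Longrightarrow> b \<in> B \<Longrightarrow> \<bar>P b (?p t y) - P b (?p t x)\<bar> \<le> e'"
      by (rule ray_uniform[where P = P, OF S x _ e'(1)], erule P, rule that)
    have main: "norm (ray_integral m q \<phi> y - ray_integral m q \<phi> x -
        (\<Sum>b\<in>B. ((y - x) \<bullet> b) * ray_integral (Suc m) q (P b) x)) \<le> e * norm (y - x)"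
      if "norm (y - x) < d" for y
    proof -
      have y: "y \<in> ball x d" using that by (simp add: dist_norm norm_minus_commute)
      then have yS: "y \<in> S" using d by auto
      let ?r = "\<lambda>t. \<phi> (?p t y) - \<phi> (?p t x) - (\<Sum>b\<in>B. ((y - x) \<bullet> b) * (t * P b (?p t x)))"
      have bound: "\<bar>?r t\<bar> \<le> e * norm (y - x)" if t: "0 \<le> t" "t \<le> 1" for t
      proof -
        have seg: "x + s *\<^sub>R (y - x) \<in> ball x d" if "s \<in> {0..1}" for s
          using y that d by (intro ray_in_convex) auto
        \<comment> \<open>Mean value theorem on the segment from \<open>x\<close> to
          \<open>y\<close> with \<open>t\<close> fixed. The map \<open>?p t\<close> scales this
          segment by \<open>t\<close>, whence the extra factor \<open>t\<close>.\<close>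
        have "\<exists>s\<in>{0<..<1}. \<phi> (?p t (x + 1 *\<^sub>R (y - x))) - \<phi> (?p t (x + 0 *\<^sub>R (y - x))) =
            (\<lambda>h. \<Sum>b\<in>B. ((t *\<^sub>R (h *\<^sub>R (y - x))) \<bullet> b) * P b (?p t (x + s *\<^sub>R (y - x)))) (1 - 0)"
        proof (rule mvt_simple)
          fix s :: real assume s: "0 \<le> s" "s \<le> 1"
          have "?p t (x + s *\<^sub>R (y - x)) \<in> S"
            using seg[of s] s d(2) by (intro ray_in_convex[OF S(2,3) _ t]) (meson atLeastAtMost_iff subsetD)
          moreover have "((\<lambda>s. ?p t (x + s *\<^sub>R (y - x))) has_derivative
              (\<lambda>h. t *\<^sub>R (h *\<^sub>R (y - x)))) (at s within {0..1})"
            by (auto intro!: derivative_eq_intros)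
          ultimately show "((\<lambda>s. \<phi> (?p t (x + s *\<^sub>R (y - x)))) has_derivative
            (\<lambda>h. \<Sum>b\<in>B. ((t *\<^sub>R (h *\<^sub>R (y - x))) \<bullet> b) * P b (?p t (x + s *\<^sub>R (y - x)))))
            (at s within {0..1})"
            using has_derivative_compose[OF _ der] by blast
        qed simp
        then obtain s where s: "s \<in> {0<..<1}" "\<phi> (?p t y) - \<phi> (?p t x) =
            (\<Sum>b\<in>B. (t * ((y - x) \<bullet> b)) * P b (?p t (x + s *\<^sub>R (y - x))))"
          by auto
        have "?r t = (\<Sum>b\<in>B. (t * ((y - x) \<bullet> b)) * (P b (?p t (x + s *\<^sub>R (y - x))) - P b (?p t x)))"
          unfolding s(2) sum_subtractf[symmetric] by (rule sum.cong) (auto simp: algebra_simps)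
        also have "\<bar>\<dots>\<bar> \<le> (\<Sum>b\<in>B. norm (y - x) * e')"
        proof (rule order_trans[OF sum_abs sum_mono])
          fix b assume b: "b \<in> B"
          have "\<bar>t * ((y - x) \<bullet> b)\<bar> \<le> norm (y - x)"
            using inner_B_le[OF b, of "y - x"] t mult_right_mono[of t 1 "\<bar>(y - x) \<bullet> b\<bar>"]
            by (simp add: abs_mult)
          moreover have "\<bar>P b (?p t (x + s *\<^sub>R (y - x))) - P b (?p t x)\<bar> \<le> e'"
            using s t b by (intro d(3) seg) auto
          ultimately show "\<bar>(t * ((y - x) \<bullet> b)) * (P b (?p t (x + s *\<^sub>R (y - x))) - P b (?p t x))\<bar>
              \<le> norm (y - x) * e'"
            unfolding abs_mult[of "t * ((y - x) \<bullet> b)"] by (intro mult_mono) auto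
        qed
        also have "\<dots> = card B * e' * norm (y - x)" by simp
        also have "\<dots> \<le> e * norm (y - x)" using e' by (intro mult_right_mono) auto
        finally show ?thesis .
      qed
      have int: "(\<lambda>t. t ^ m * (t * P b (?p t x))) integrable_on {0..1}" if "b \<in> B" for b
        using ray_integrable[OF S(2,3) x P[OF that], of "Suc m"] by (simp add: mult_ac)
      have "ray_integral m q \<phi> y - ray_integral m q \<phi> x -
        (\<Sum>b\<in>B. ((y - x) \<bullet> b) * ray_integral (Suc m) q (P b) x) = integral {0..1} (\<lambda>t. t ^ m * ?r t)"
      proof -
        have "(\<Sum>b\<in>B. ((y - x) \<bullet> b) * ray_integral (Suc m) q (P b) x) =
            integral {0..1} (\<lambda>t. \<Sum>b\<in>B. ((y - x) \<bullet> b) * (t ^ m * (t * P b (?p t x))))"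
          unfolding ray_integral_def
          by (subst integral_sum[OF finite_B integrable_on_mult_right[OF int]])
            (simp_all only: integral_mult_right power_Suc2 mult.assoc)
        moreover have i3: "(\<lambda>t. \<Sum>b\<in>B. ((y - x) \<bullet> b) * (t ^ m * (t * P b (?p t x)))) integrable_on {0..1}"
          by (intro integrable_sum finite_B integrable_on_mult_right int)
        note i1 = ray_integrable[OF S(2,3) yS cont, of m] and i2 = ray_integrable[OF S(2,3) x cont, of m]
        moreover have "(\<lambda>t. t ^ m * ?r t) = (\<lambda>t. t ^ m * \<phi> (?p t y) - t ^ m * \<phi> (?p t x) -
            (\<Sum>b\<in>B. ((y - x) \<bullet> b) * (t ^ m * (t * P b (?p t x)))))"
          by (simp add: right_diff_distrib sum_distrib_left mult.left_commute)
        ultimately show ?thesis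
          using integral_diff[OF integrable_diff[OF i1 i2] i3] integral_diff[OF i1 i2]
          unfolding ray_integral_def by (simp only:)
      qed
      also have "norm \<dots> \<le> e * norm (y - x) * (1 - 0)"
      proof (rule integral_bound)
        show "continuous_on {0..1} (\<lambda>t. t ^ m * ?r t)"
          by (intro continuous_intros continuous_on_ray[OF S(2,3) yS cont]
              continuous_on_ray[OF S(2,3) x cont] continuous_on_ray[OF S(2,3) x P])
        fix t :: real assume t: "t \<in> {0..1}"
        have "\<bar>t ^ m\<bar> \<le> 1" using t by (auto simp: power_le_one)
        then have "\<bar>t ^ m\<bar> * \<bar>?r t\<bar> \<le> 1 * (e * norm (y - x))"
          using bound[of t] t by (intro mult_mono) auto
        then show "norm (t ^ m * ?r t) \<le> e * norm (y - x)" by (simp add: abs_mult)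
      qed simp
      finally show ?thesis by simp
    qed
    then show ?thesis using d(1) by blast
  qed
  moreover have "bounded_linear (\<lambda>v. \<Sum>b\<in>B. (v \<bullet> b) * ray_integral (Suc m) q (P b) x)"
    by (intro bounded_linear_sum bounded_linear_mult_const bounded_linear_inner_left)
  ultimately show ?thesis unfolding has_derivative_at_alt by blast
qed

lemma has_derivative_partials:
  fixes \<phi> :: "'e \<Rightarrow> real"
  assumes "k_smooth_on (Suc k) S \<phi>" "x \<in> S"
  shows "(\<phi> has_derivative (\<lambda>v. \<Sum>b\<in>B. (v \<bullet> b) * dir_deriv b \<phi> x)) (at x)"
proof -
  note d = k_smooth_on_SucD[OF assms]
  have "(\<lambda>v. dir_deriv v \<phi> x) = (\<lambda>v. \<Sum>b\<in>B. (v \<bullet> b) * dir_deriv b \<phi> x)"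
    by (rule ext, subst has_derivative_expand[OF d]) simp
  with d show ?thesis by metis
qed

text \<open>One order is given up, because continuity of the integral is read off from its
  differentiability. In the smooth case this costs nothing.\<close>

lemma k_smooth_on_ray_integral:
  fixes \<phi> :: "'e \<Rightarrow> real"
  assumes S: "open S" "convex S" "q \<in> S" and "k_smooth_on (Suc k) S \<phi>"
  shows "k_smooth_on k S (ray_integral m q \<phi>)"
  using assms(4)
proof (induction k arbitrary: \<phi> m)
  case (0 \<phi> m)
  have "(ray_integral m q \<phi> has_derivative
    (\<lambda>v. \<Sum>b\<in>B. (v \<bullet> b) * ray_integral (Suc m) q (dir_deriv b \<phi>) x)) (at x)" if "x \<in> S" for x
    using 0 that by (intro has_derivative_ray_integral[OF S] has_derivative_partials[of 0]) auto
  then show ?case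
    by (auto intro!: continuous_at_imp_continuous_on has_derivative_continuous)
next
  case (Suc k \<phi> m)
  have c: "continuous_on S (dir_deriv b \<phi>)" for b
    by (rule k_smooth_on_0[of "Suc k"]) (use Suc.prems in simp)
  show ?case
  proof (rule k_smooth_on_SucI[OF S(1)])
    show "(ray_integral m q \<phi> has_derivative
      (\<lambda>v. \<Sum>b\<in>B. (v \<bullet> b) * ray_integral (Suc m) q (dir_deriv b \<phi>) x)) (at x)" if "x \<in> S" for x
      by (intro has_derivative_ray_integral[OF S] has_derivative_partials[OF Suc.prems] c that)
    show "k_smooth_on k S (\<lambda>x. \<Sum>b\<in>B. (v \<bullet> b) * ray_integral (Suc m) q (dir_deriv b \<phi>) x)" for v
      using Suc.prems by (intro k_smooth_on_sum k_smooth_on_mult k_smooth_on_const S Suc.IH) auto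
  qed
qed

lemma smooth_on_ray_integral:
  fixes \<phi> :: "'e \<Rightarrow> real"
  shows "open S \<Longrightarrow> convex S \<Longrightarrow> q \<in> S \<Longrightarrow> smooth_on S \<phi> \<Longrightarrow> smooth_on S (ray_integral m q \<phi>)"
  using k_smooth_on_ray_integral unfolding smooth_on_def by blast

lemma smooth_on_partials:
  fixes \<phi> :: "'e \<Rightarrow> real"
  assumes "smooth_on S \<phi>" "x \<in> S"
  shows "(\<phi> has_derivative (\<lambda>v. \<Sum>b\<in>B. (v \<bullet> b) * dir_deriv b \<phi> x)) (at x)"
  using assms has_derivative_partials unfolding smooth_on_def by blast

lemma dir_deriv_ray_integral:
  fixes \<phi> :: "'e \<Rightarrow> real"
  assumes S: "open S" "convex S" "q \<in> S" and \<phi>: "smooth_on S \<phi>" and x: "x \<in> S" and a: "a \<in> B"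
  shows "dir_deriv a (ray_integral m q \<phi>) x = ray_integral (Suc m) q (dir_deriv a \<phi>) x"
proof -
  have "(ray_integral m q \<phi> has_derivative
      (\<lambda>v. \<Sum>b\<in>B. (v \<bullet> b) * ray_integral (Suc m) q (dir_deriv b \<phi>) x)) (at x)"
    using \<phi> x smooth_on_imp_continuous_on[OF smooth_on_dir_deriv[OF \<phi>]]
    by (intro has_derivative_ray_integral[OF S] smooth_on_partials) auto
  from dir_derivI[OF this, of a] show ?thesis
    using a by (simp add: inner_B if_distrib[of "\<lambda>x. x * _"] cong: if_cong)
qed

lemma has_derivative_along_ray:
  fixes \<phi> :: "'e \<Rightarrow> real"
  assumes S: "open S" "convex S" "q \<in> S" and \<phi>: "smooth_on S \<phi>" and x: "x \<in> S" and t: "t \<in> {0..1}"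
  shows "((\<lambda>t. \<phi> (q + t *\<^sub>R (x - q))) has_real_derivative
    (\<Sum>b\<in>B. ((x - q) \<bullet> b) * dir_deriv b \<phi> (q + t *\<^sub>R (x - q)))) (at t within {0..1})"
proof -
  have "q + t *\<^sub>R (x - q) \<in> S" using S x t by (intro ray_in_convex) auto
  note d = smooth_on_partials[OF \<phi> this]
  have "((\<lambda>t. q + t *\<^sub>R (x - q)) has_derivative (\<lambda>h. h *\<^sub>R (x - q))) (at t within {0..1})"
    by (auto intro!: derivative_eq_intros)
  from has_derivative_compose[OF this d] show ?thesis
    unfolding has_field_derivative_def
    by (rule has_derivative_eq_rhs) (auto simp: sum_distrib_left mult_ac)
qed

text \<open>Fundamental theorem of calculus on the ray from \<open>q\<close> to \<open>x\<close>.
  The factors \<open>(x - q) \<bullet> b\<close> isolate the first-order vanishing at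
  \<open>q\<close>, which is all that a derivation at that point sees.\<close>

lemma hadamard:
  fixes \<phi> :: "'e \<Rightarrow> real"
  assumes S: "open S" "convex S" "q \<in> S" and \<phi>: "smooth_on S \<phi>" and x: "x \<in> S"
  shows "\<phi> x = \<phi> q + (\<Sum>b\<in>B. ((x - q) \<bullet> b) * ray_integral 0 q (dir_deriv b \<phi>) x)"
proof -
  have c: "continuous_on S (dir_deriv b \<phi>)" for b
    by (rule smooth_on_imp_continuous_on[OF smooth_on_dir_deriv[OF \<phi>]] smooth_on_imp_continuous_on[OF \<phi>])+
  have "((\<lambda>t. \<Sum>b\<in>B. ((x - q) \<bullet> b) * dir_deriv b \<phi> (q + t *\<^sub>R (x - q))) has_integral
      (\<phi> (q + 1 *\<^sub>R (x - q)) - \<phi> (q + 0 *\<^sub>R (x - q)))) {0..1}"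
    using has_derivative_along_ray[OF assms]
    by (intro fundamental_theorem_of_calculus) (auto simp: has_real_derivative_iff_has_vector_derivative)
  moreover have "((\<lambda>t. \<Sum>b\<in>B. ((x - q) \<bullet> b) * dir_deriv b \<phi> (q + t *\<^sub>R (x - q))) has_integral
      (\<Sum>b\<in>B. ((x - q) \<bullet> b) * ray_integral 0 q (dir_deriv b \<phi>) x)) {0..1}"
    unfolding ray_integral_def
    using ray_integrable[OF S(2,3) x c, of 0]
    by (intro has_integral_sum finite_B has_integral_mult_right) (simp add: integrable_integral)
  ultimately have "\<phi> (q + 1 *\<^sub>R (x - q)) - \<phi> (q + 0 *\<^sub>R (x - q)) =
      (\<Sum>b\<in>B. ((x - q) \<bullet> b) * ray_integral 0 q (dir_deriv b \<phi>) x)"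
    by (rule has_integral_unique)
  then show ?thesis by simp
qed

text \<open>Fundamental theorem of calculus for \<open>t * \<phi> (q + t *\<^sub>R (x - q))\<close>.
  The identity cancels the undifferentiated term that arises when a primitive along rays is
  differentiated.\<close>

lemma ray_integral_euler:
  fixes \<phi> :: "'e \<Rightarrow> real"
  assumes S: "open S" "convex S" "q \<in> S" and \<phi>: "smooth_on S \<phi>" and x: "x \<in> S"
  shows "\<phi> x = ray_integral 0 q \<phi> x + (\<Sum>b\<in>B. ((x - q) \<bullet> b) * ray_integral 1 q (dir_deriv b \<phi>) x)"
proof -
  have c: "continuous_on S (dir_deriv b \<phi>)" "continuous_on S \<phi>" for b
    by (rule smooth_on_imp_continuous_on[OF smooth_on_dir_deriv[OF \<phi>]] smooth_on_imp_continuous_on[OF \<phi>])+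
  let ?p = "\<lambda>t. q + t *\<^sub>R (x - q)"
  have "((\<lambda>t. t ^ 0 * \<phi> (?p t) + (\<Sum>b\<in>B. ((x - q) \<bullet> b) * (t ^ 1 * dir_deriv b \<phi> (?p t)))) has_integral
      (1 * \<phi> (?p 1) - 0 * \<phi> (?p 0))) {0..1}"
  proof (rule fundamental_theorem_of_calculus)
    fix t :: real assume t: "t \<in> {0..1}"
    have "((\<lambda>t. t * \<phi> (?p t)) has_real_derivative
        1 * \<phi> (?p t) + (\<Sum>b\<in>B. ((x - q) \<bullet> b) * dir_deriv b \<phi> (?p t)) * t) (at t within {0..1})"
      by (rule DERIV_mult[OF DERIV_ident has_derivative_along_ray[OF assms t]])
    then show "((\<lambda>t. t * \<phi> (?p t)) has_vector_derivative
        t ^ 0 * \<phi> (?p t) + (\<Sum>b\<in>B. ((x - q) \<bullet> b) * (t ^ 1 * dir_deriv b \<phi> (?p t)))) (at t within {0..1})"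
      by (simp add: has_real_derivative_iff_has_vector_derivative sum_distrib_left sum_distrib_right mult_ac)
  qed simp
  moreover have "((\<lambda>t. t ^ 0 * \<phi> (?p t) + (\<Sum>b\<in>B. ((x - q) \<bullet> b) * (t ^ 1 * dir_deriv b \<phi> (?p t)))) has_integral
      (ray_integral 0 q \<phi> x + (\<Sum>b\<in>B. ((x - q) \<bullet> b) * ray_integral 1 q (dir_deriv b \<phi>) x))) {0..1}"
    unfolding ray_integral_def
    by (intro has_integral_add has_integral_sum finite_B has_integral_mult_right
        integrable_integral ray_integrable[OF S(2,3) x] c)
  ultimately have "1 * \<phi> (?p 1) - 0 * \<phi> (?p 0) =
      ray_integral 0 q \<phi> x + (\<Sum>b\<in>B. ((x - q) \<bullet> b) * ray_integral 1 q (dir_deriv b \<phi>) x)"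
    by (rule has_integral_unique)
  then show ?thesis by simp
qed

end

section \<open>Linear total differential systems\<close>

lemma geometric_limit:
  fixes f :: "nat \<Rightarrow> real"
  assumes "\<And>n. \<bar>f (Suc n) - f n\<bar> \<le> K / 2 ^ n"
  obtains l where "f \<longlonglongrightarrow> l" "\<And>n. \<bar>l - f n\<bar> \<le> 2 * K / 2 ^ n"
proof -
  have K: "0 \<le> K" using assms[of 0] abs_ge_zero[of "f (Suc 0) - f 0"] by simp
  \<comment> \<open>The subtracted tail makes the bound telescope, which the induction on
    \<open>k\<close> requires.\<close>
  have step: "\<bar>f (n + k) - f n\<bar> \<le> 2 * K / 2 ^ n - 2 * K / 2 ^ (n + k)" for n k
  proof (induction k)
    case (Suc k)
    have "2 * K / 2 ^ (n + k) - K / 2 ^ (n + k) = 2 * K / 2 ^ (n + Suc k)" by simp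
    then show ?case using Suc assms[of "n + k"] by auto
  qed simp
  have bound: "\<bar>f (n + k) - f n\<bar> \<le> 2 * K / 2 ^ n" for n k
  proof -
    have "0 \<le> 2 * K / 2 ^ (n + k)" using K by simp
    with step[where n = n and k = k] show ?thesis by linarith
  qed
  have "(\<lambda>n. 2 * K * (1 / 2) ^ n) \<longlonglongrightarrow> 2 * K * 0"
    by (intro tendsto_mult tendsto_const LIMSEQ_realpow_zero) auto
  then have lim: "(\<lambda>n. 2 * K / 2 ^ n) \<longlonglongrightarrow> 0" by (simp add: power_divide)
  have "Cauchy f"
  proof (rule CauchyI')
    fix e :: real assume "e > 0"
    then obtain N where N: "\<And>n. n \<ge> N \<Longrightarrow> 2 * K / 2 ^ n < e"
      using order_tendstoD(2)[OF lim] unfolding eventually_sequentially by blast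
    have "dist (f m) (f n) < e" if "m \<ge> N" "n > m" for m n
      using bound[of m "n - m"] N[OF that(1)] that by (simp add: dist_real_def abs_minus_commute)
    then show "\<exists>M. \<forall>m\<ge>M. \<forall>n>m. dist (f m) (f n) < e" by blast
  qed
  then obtain l where l: "f \<longlonglongrightarrow> l" by (auto simp: Cauchy_convergent_iff convergent_def)
  have "\<bar>l - f n\<bar> \<le> 2 * K / 2 ^ n" for n
  proof (rule Lim_bounded)
    show "(\<lambda>m. \<bar>f m - f n\<bar>) \<longlonglongrightarrow> \<bar>l - f n\<bar>" by (intro tendsto_intros l)
    show "\<forall>m\<ge>n. \<bar>f m - f n\<bar> \<le> 2 * K / 2 ^ n" using bound[of n] by (metis le_add_diff_inverse)
  qed
  with l show ?thesis by (rule that)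
qed

text \<open>The system \<open>d w\<^sub>i = \<Sum>\<^sub>b (\<Sum>\<^sub>j M b i j w\<^sub>j)
  dx\<^sub>b\<close> on a convex set of diameter at most \<open>d\<close>. By \<open>small\<close>,
  integration along rays contracts by 1/8. This value makes the defect halve at each step: the two
  curl terms together contribute a quarter of the previous bound, the change of the form another
  quarter.\<close>

locale linear_system = finite_basis B
  for B :: "'e::real_inner set" +
  fixes S :: "'e set" and I :: "'i set" and M :: "'e \<Rightarrow> 'i \<Rightarrow> 'i \<Rightarrow> 'e \<Rightarrow> real" and C d :: real
  assumes open_S: "open S" and convex_S: "convex S" and finite_I [simp]: "finite I"
    and smooth_M: "b \<in> B \<Longrightarrow> i \<in> I \<Longrightarrow> j \<in> I \<Longrightarrow> smooth_on S (M b i j)"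
    and bound_M: "b \<in> B \<Longrightarrow> i \<in> I \<Longrightarrow> j \<in> I \<Longrightarrow> x \<in> S \<Longrightarrow> \<bar>M b i j x\<bar> \<le> C"
    and diameter: "x \<in> S \<Longrightarrow> y \<in> S \<Longrightarrow> norm (x - y) \<le> d"
    and C_nonneg: "0 \<le> C"
    and small: "d * card B * (card I * C) \<le> 1 / 8"
begin

definition form :: "('i \<Rightarrow> 'e \<Rightarrow> real) \<Rightarrow> 'e \<Rightarrow> 'i \<Rightarrow> 'e \<Rightarrow> real" where
  "form w b i x = (\<Sum>j\<in>I. M b i j x * w j x)"

definition solution :: "'e set \<Rightarrow> ('i \<Rightarrow> 'e \<Rightarrow> real) \<Rightarrow> bool" where
  "solution T w \<longleftrightarrow>
     (\<forall>i\<in>I. \<forall>x\<in>T. (w i has_derivative (\<lambda>v. \<Sum>b\<in>B. (v \<bullet> b) * form w b i x)) (at x))"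

lemma form_bound:
  assumes "b \<in> B" "i \<in> I" "x \<in> S" "\<And>j. j \<in> I \<Longrightarrow> \<bar>w j x\<bar> \<le> K"
  shows "\<bar>form w b i x\<bar> \<le> card I * C * K"
proof -
  have "\<bar>form w b i x\<bar> \<le> (\<Sum>j\<in>I. C * K)"
    unfolding form_def
  proof (rule order_trans[OF sum_abs sum_mono])
    fix j assume "j \<in> I"
    then show "\<bar>M b i j x * w j x\<bar> \<le> C * K"
      unfolding abs_mult using assms bound_M C_nonneg by (intro mult_mono) auto
  qed
  then show ?thesis by simp
qed

lemma form_diff: "form w b i x - form w' b i x = form (\<lambda>j x. w j x - w' j x) b i x"
  by (simp add: form_def sum_subtractf right_diff_distrib)

lemma directional_bound:
  assumes "q \<in> S" "x \<in> S" "\<And>b. b \<in> B \<Longrightarrow> \<bar>f b\<bar> \<le> K"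
  shows "\<bar>\<Sum>b\<in>B. ((x - q) \<bullet> b) * f b\<bar> \<le> d * card B * K"
proof -
  have "\<bar>\<Sum>b\<in>B. ((x - q) \<bullet> b) * f b\<bar> \<le> (\<Sum>b\<in>B. d * K)"
  proof (rule order_trans[OF sum_abs sum_mono])
    fix b assume b: "b \<in> B"
    have "\<bar>(x - q) \<bullet> b\<bar> \<le> d" using inner_B_le[OF b, of "x - q"] diameter[OF assms(2,1)] by simp
    then show "\<bar>((x - q) \<bullet> b) * f b\<bar> \<le> d * K"
      unfolding abs_mult using assms(3)[OF b] by (intro mult_mono) auto
  qed
  then show ?thesis by (simp add: mult_ac)
qed

lemma contraction: "0 \<le> K \<Longrightarrow> d * card B * (card I * C * K) \<le> K / 8"
  using mult_right_mono[OF small, of K] by (simp add: mult_ac)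

lemma solution_mono: "solution T w \<Longrightarrow> T' \<subseteq> T \<Longrightarrow> solution T' w"
  unfolding solution_def by blast

text \<open>Bootstrapping: the derivatives of a solution are expressed by the smooth coefficients
  and the solution itself, so each order of smoothness yields the next. The components are coupled,
  hence treated together.\<close>

lemma solution_smooth:
  assumes "open T" "T \<subseteq> S" "solution T w" "i \<in> I"
  shows "smooth_on T (w i)"
proof -
  have "\<forall>i\<in>I. k_smooth_on k T (w i)" for k
  proof (induction k)
    case 0
    show ?case
    proof
      fix i assume "i \<in> I"
      then show "k_smooth_on 0 T (w i)" using assms(3) unfolding solution_def
        by (auto intro!: continuous_at_imp_continuous_on has_derivative_continuous)
    qed
  next
    case (Suc k)
    have "k_smooth_on k T (M b i j)" if "b \<in> B" "i \<in> I" "j \<in> I" for b i j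
      using smooth_M[OF that] assms(2) k_smooth_on_subset unfolding smooth_on_def by blast
    with Suc have "k_smooth_on (Suc k) T (w i)" if "i \<in> I" for i
      using assms(3) that unfolding solution_def form_def
      by (intro k_smooth_on_SucI[OF \<open>open T\<close>, of _ "\<lambda>x v. \<Sum>b\<in>B. (v \<bullet> b) * (\<Sum>j\<in>I. M b i j x * w j x)"]
            k_smooth_on_sum k_smooth_on_mult k_smooth_on_const \<open>open T\<close>) auto
    then show ?case by blast
  qed
  then show ?thesis using assms(4) by (simp add: smooth_on_def)
qed

text \<open>Let \<open>K\<close> be the largest absolute value of any component on the segment from
  \<open>q\<close> to \<open>x\<close>. The system bounds the derivative along this segment by
  \<open>K / 8\<close>, and \<open>w\<close> starts at 0, so \<open>K \<le> K / 8\<close>.\<close>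

lemma solution_unique:
  assumes T: "convex T" "T \<subseteq> S" "solution T w" "q \<in> T" and zero: "\<And>i. i \<in> I \<Longrightarrow> w i q = 0"
    and x: "x \<in> T" "i \<in> I"
  shows "w i x = 0"
proof -
  define p where "p = (\<lambda>t. q + t *\<^sub>R (x - q))"
  have pT: "p t \<in> T" if "t \<in> {0..1}" for t
    using that T x unfolding p_def by (intro ray_in_convex) auto
  have "compact ((\<lambda>t. w i (p t)) ` {0..1})" if "i \<in> I" for i
  proof (rule compact_continuous_image[OF _ compact_Icc])
    have "continuous_on T (w i)" using T(3) that unfolding solution_def
      by (auto intro!: continuous_at_imp_continuous_on has_derivative_continuous)
    then show "continuous_on {0..1} (\<lambda>t. w i (p t))"
      unfolding p_def using T x by (intro continuous_on_ray) auto
  qed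
  then have "compact (\<Union>i\<in>I. (\<lambda>t. w i (p t)) ` {0..1})" by (intro compact_UN) auto
  then have "compact (abs ` (\<Union>i\<in>I. (\<lambda>t. w i (p t)) ` {0..1}))" (is "compact ?V")
    by (intro compact_continuous_image continuous_intros)
  moreover have "?V \<noteq> {}" using x(2) by auto
  ultimately obtain K where K: "K \<in> ?V" "\<And>y. y \<in> ?V \<Longrightarrow> y \<le> K"
    using compact_attains_sup by metis
  then obtain j t where j: "j \<in> I" "t \<in> {0..1}" "K = \<bar>w j (p t)\<bar>" by auto
  have le: "\<bar>w i (p s)\<bar> \<le> K" if "i \<in> I" "s \<in> {0..1}" for i s
    using K(2) that by blast
  have "norm (w j (p t) - w j (p 0)) \<le> (K / 8) * norm (t - 0)"
  proof (rule differentiable_bound[of "{0..1}"])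
    fix s :: real assume s: "s \<in> {0..1}"
    have "(p has_derivative (\<lambda>h. h *\<^sub>R (x - q))) (at s within {0..1})"
      unfolding p_def by (auto intro!: derivative_eq_intros)
    moreover have "(w j has_derivative (\<lambda>v. \<Sum>b\<in>B. (v \<bullet> b) * form w b j (p s))) (at (p s))"
      using T(3) j pT[OF s] unfolding solution_def by blast
    ultimately show "((\<lambda>s. w j (p s)) has_derivative
        (\<lambda>h. \<Sum>b\<in>B. ((h *\<^sub>R (x - q)) \<bullet> b) * form w b j (p s))) (at s within {0..1})"
      by (rule has_derivative_compose)
    have "\<bar>\<Sum>b\<in>B. ((x - q) \<bullet> b) * form w b j (p s)\<bar> \<le> d * card B * (card I * C * K)"
      using T x pT[OF s] j le s by (intro directional_bound form_bound) auto
    also have "\<dots> \<le> K / 8" using contraction[of K] j by simp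
    finally have *: "\<bar>\<Sum>b\<in>B. ((x - q) \<bullet> b) * form w b j (p s)\<bar> \<le> K / 8" .
    show "onorm (\<lambda>h. \<Sum>b\<in>B. ((h *\<^sub>R (x - q)) \<bullet> b) * form w b j (p s)) \<le> K / 8"
    proof (rule onorm_le)
      fix h :: real
      have "(\<Sum>b\<in>B. ((h *\<^sub>R (x - q)) \<bullet> b) * form w b j (p s)) =
          h * (\<Sum>b\<in>B. ((x - q) \<bullet> b) * form w b j (p s))"
        by (simp add: sum_distrib_left mult_ac)
      then show "norm (\<Sum>b\<in>B. ((h *\<^sub>R (x - q)) \<bullet> b) * form w b j (p s)) \<le> K / 8 * norm h"
        using mult_left_mono[OF *, of "\<bar>h\<bar>"] by (simp add: abs_mult mult_ac)
    qed
  qed (use j in auto)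
  then have "K \<le> K / 8 * \<bar>t\<bar>" using zero j(1,3) by (simp add: p_def)
  also have "\<dots> \<le> K / 8" using j by (simp add: mult_left_le)
  finally have "K \<le> 0" by simp
  with le[OF x(2), of 1] show ?thesis by (simp add: p_def)
qed

end

text \<open>\<open>integrability\<close> is the Frobenius condition: differentiate
  \<open>M b i j * w j\<close> in direction \<open>a\<close>, substitute the system for the
  derivative of \<open>w\<close>, and require that the coefficients of \<open>w j\<close> be
  symmetric in \<open>a\<close> and \<open>b\<close>.\<close>

locale integrable_system = linear_system B S I M C d
  for B :: "'e::real_inner set" and S :: "'e set" and I :: "'i set"
    and M :: "'e \<Rightarrow> 'i \<Rightarrow> 'i \<Rightarrow> 'e \<Rightarrow> real" and C d :: real +
  fixes q :: 'e and w0 :: "'i \<Rightarrow> real"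
  assumes q: "q \<in> S"
    and integrability: "a \<in> B \<Longrightarrow> b \<in> B \<Longrightarrow> i \<in> I \<Longrightarrow> j \<in> I \<Longrightarrow> x \<in> S \<Longrightarrow>
      dir_deriv a (M b i j) x + (\<Sum>k\<in>I. M b i k x * M a k j x) =
      dir_deriv b (M a i j) x + (\<Sum>k\<in>I. M a i k x * M b k j x)"
begin

text \<open>Picard iteration, with the homotopy operator of the Poincare lemma in place of an
  antiderivative. All iterates take the values \<open>w0\<close> at \<open>q\<close>.\<close>

primrec iter :: "nat \<Rightarrow> 'i \<Rightarrow> 'e \<Rightarrow> real" where
  "iter 0 = (\<lambda>i x. w0 i)"
| "iter (Suc n) = (\<lambda>i x. w0 i + (\<Sum>b\<in>B. ((x - q) \<bullet> b) * ray_integral 0 q (form (iter n) b i) x))"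

lemma smooth_form:
  assumes "\<And>i. i \<in> I \<Longrightarrow> smooth_on S (w i)" "b \<in> B" "i \<in> I"
  shows "smooth_on S (form w b i)"
  unfolding form_def[abs_def] using assms
  by (intro smooth_on_sum smooth_on_mult smooth_M open_S) auto

lemma smooth_coordinate: "smooth_on S (\<lambda>x. (x - q) \<bullet> b)"
proof -
  have "smooth_on S (\<lambda>x. x \<bullet> b + - (q \<bullet> b))"
    by (intro smooth_on_add smooth_on_const smooth_on_linear bounded_linear_inner_left open_S)
  then show ?thesis by (simp add: inner_diff_left)
qed

lemma smooth_iter: "i \<in> I \<Longrightarrow> smooth_on S (iter n i)"
proof (induction n arbitrary: i)
  case (Suc n)
  then show ?case unfolding iter.simps
    by (intro smooth_on_add smooth_on_const smooth_on_sum smooth_on_mult smooth_coordinate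
        smooth_on_ray_integral smooth_form open_S convex_S q)
qed (simp add: smooth_on_const open_S)

lemma smooth_form_iter: "b \<in> B \<Longrightarrow> i \<in> I \<Longrightarrow> smooth_on S (form (iter n) b i)"
  by (intro smooth_form smooth_iter)

text \<open>Convergence of the iterates alone does not give a solution, since a ray primitive of a
  form that is not closed need not have that form as its differential. The defect measures this
  failure.\<close>

definition defect :: "nat \<Rightarrow> 'e \<Rightarrow> 'i \<Rightarrow> 'e \<Rightarrow> real" where
  "defect n a i x = dir_deriv a (iter n i) x - form (iter n) a i x"

lemma smooth_defect: "a \<in> B \<Longrightarrow> i \<in> I \<Longrightarrow> smooth_on S (defect n a i)"
proof -
  assume "a \<in> B" "i \<in> I"
  then have "smooth_on S (\<lambda>x. dir_deriv a (iter n i) x + (- 1) * form (iter n) a i x)"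
    by (intro smooth_on_add smooth_on_mult smooth_on_const smooth_form_iter smooth_iter
        smooth_on_dir_deriv open_S)
  then show ?thesis by (simp add: defect_def[abs_def])
qed

lemma dir_deriv_form:
  assumes "a \<in> B" "b \<in> B" "i \<in> I" "x \<in> S"
  shows "dir_deriv a (form (iter n) b i) x =
    (\<Sum>j\<in>I. dir_deriv a (M b i j) x * iter n j x + M b i j x * dir_deriv a (iter n j) x)"
proof (rule dir_derivI)
  show "(form (iter n) b i has_derivative
      (\<lambda>v. \<Sum>j\<in>I. dir_deriv v (M b i j) x * iter n j x + M b i j x * dir_deriv v (iter n j) x)) (at x)"
    unfolding form_def[abs_def]
  proof (rule has_derivative_sum)
    fix j assume j: "j \<in> I"
    show "((\<lambda>x. M b i j x * iter n j x) has_derivative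
        (\<lambda>v. dir_deriv v (M b i j) x * iter n j x + M b i j x * dir_deriv v (iter n j) x)) (at x)"
      using has_derivative_mult[OF smooth_on_has_derivative[OF smooth_M[OF assms(2,3) j] assms(4)]
          smooth_on_has_derivative[OF smooth_iter[OF j] assms(4)]]
      by (simp add: add.commute)
  qed
qed

text \<open>By integrability, the form of an approximate solution is closed up to its defect.\<close>

lemma curl_form:
  assumes "a \<in> B" "b \<in> B" "i \<in> I" "x \<in> S"
  shows "dir_deriv a (form (iter n) b i) x - dir_deriv b (form (iter n) a i) x =
    form (\<lambda>k. defect n a k) b i x - form (\<lambda>k. defect n b k) a i x"
proof -
  \<comment> \<open>These terms remain when the derivatives of the iterate are replaced by its form;
    they agree by \<open>integrability\<close> after the two summations are exchanged.\<close>
  have "(\<Sum>j\<in>I. dir_deriv a (M b i j) x * iter n j x) + (\<Sum>j\<in>I. M b i j x * form (iter n) a j x) =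
        (\<Sum>j\<in>I. dir_deriv b (M a i j) x * iter n j x) + (\<Sum>j\<in>I. M a i j x * form (iter n) b j x)"
    (is "?L a b = ?L b a")
  proof -
    have L: "?L a b = (\<Sum>j\<in>I. (dir_deriv a (M b i j) x + (\<Sum>k\<in>I. M b i k x * M a k j x)) * iter n j x)"
      for a b
    proof -
      have "(\<Sum>j\<in>I. M b i j x * form (iter n) a j x) =
          (\<Sum>k\<in>I. \<Sum>j\<in>I. M b i k x * (M a k j x * iter n j x))"
        by (simp add: form_def sum_distrib_left)
      also have "\<dots> = (\<Sum>j\<in>I. \<Sum>k\<in>I. M b i k x * (M a k j x * iter n j x))" by (rule sum.swap)
      finally show ?thesis
        by (simp add: sum.distrib distrib_right sum_distrib_right mult.assoc)
    qed
    show ?thesis unfolding L by (rule sum.cong) (simp_all add: integrability assms)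
  qed
  then show ?thesis
    unfolding dir_deriv_form[OF assms] dir_deriv_form[OF assms(2,1,3,4)]
    by (simp add: form_def[of "\<lambda>k. defect n _ k"] defect_def sum.distrib sum_subtractf right_diff_distrib)
qed

text \<open>The homotopy formula \<open>d K \<omega> = \<omega> - K d \<omega>\<close> for the
  operator \<open>K\<close> of integration along rays, applied to the form of the previous iterate;
  \<open>curl_form\<close> then expresses \<open>d \<omega>\<close> by the defect.\<close>

lemma dir_deriv_iter:
  assumes "a \<in> B" "i \<in> I" "x \<in> S"
  shows "dir_deriv a (iter (Suc n) i) x - form (iter n) a i x =
    (\<Sum>b\<in>B. ((x - q) \<bullet> b) * ray_integral 1 q
      (\<lambda>y. form (\<lambda>k. defect n a k) b i y - form (\<lambda>k. defect n b k) a i y) x)"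
proof -
  let ?J = "\<lambda>b. ray_integral 0 q (form (iter n) b i)"
  have c: "continuous_on S (dir_deriv a (form (iter n) b i))" if "b \<in> B" for a b
    using smooth_on_imp_continuous_on[OF smooth_on_dir_deriv[OF smooth_form_iter]] that assms(2) .
  have J: "(?J b has_derivative (\<lambda>v. dir_deriv v (?J b) x)) (at x)" if "b \<in> B" for b
    using that assms
    by (intro smooth_on_has_derivative[of S] smooth_on_ray_integral smooth_form_iter open_S convex_S q)
  have "(iter (Suc n) i has_derivative
      (\<lambda>v. 0 + (\<Sum>b\<in>B. ((x - q) \<bullet> b) * dir_deriv v (?J b) x + (v \<bullet> b) * ?J b x))) (at x)"
    unfolding iter.simps
    by (intro has_derivative_add has_derivative_const has_derivative_sum has_derivative_mult J)
      (auto intro!: derivative_eq_intros)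
  from dir_derivI[OF this, of a]
  have "dir_deriv a (iter (Suc n) i) x =
      (\<Sum>b\<in>B. ((x - q) \<bullet> b) * dir_deriv a (?J b) x) + (\<Sum>b\<in>B. (a \<bullet> b) * ?J b x)"
    by (simp add: sum.distrib)
  also have "(\<Sum>b\<in>B. (a \<bullet> b) * ?J b x) = ?J a x"
    using assms(1) by (simp add: inner_B if_distrib[of "\<lambda>x. x * _"] cong: if_cong)
  also have "(\<Sum>b\<in>B. ((x - q) \<bullet> b) * dir_deriv a (?J b) x) =
      (\<Sum>b\<in>B. ((x - q) \<bullet> b) * ray_integral 1 q (dir_deriv a (form (iter n) b i)) x)"
    using assms by (intro sum.cong refl)
      (simp add: dir_deriv_ray_integral[OF open_S convex_S q smooth_form_iter])
  \<comment> \<open>By \<open>ray_integral_euler\<close>, the term \<open>?J a x\<close> and the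
    form of \<open>iter n\<close> combine into derivatives in the directions \<open>b\<close>; this
    completes the curl.\<close>
  finally have "dir_deriv a (iter (Suc n) i) x - form (iter n) a i x =
      (\<Sum>b\<in>B. ((x - q) \<bullet> b) * (ray_integral 1 q (dir_deriv a (form (iter n) b i)) x
        - ray_integral 1 q (dir_deriv b (form (iter n) a i)) x))"
    using ray_integral_euler[OF open_S convex_S q smooth_form_iter[OF assms(1,2)] assms(3), of n]
    by (simp add: right_diff_distrib sum_subtractf)
  also have "\<dots> = (\<Sum>b\<in>B. ((x - q) \<bullet> b) * ray_integral 1 q
      (\<lambda>y. form (\<lambda>k. defect n a k) b i y - form (\<lambda>k. defect n b k) a i y) x)"
  proof (intro sum.cong refl arg_cong2[of _ _ _ _ "(*)"])
    fix b assume b: "b \<in> B"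
    have "ray_integral 1 q (dir_deriv a (form (iter n) b i)) x
        - ray_integral 1 q (dir_deriv b (form (iter n) a i)) x =
      ray_integral 1 q (\<lambda>y. dir_deriv a (form (iter n) b i) y - dir_deriv b (form (iter n) a i) y) x"
      by (rule ray_integral_diff[OF convex_S q assms(3) c[OF b] c[OF assms(1)]])
    also have "\<dots> = ray_integral 1 q
        (\<lambda>y. form (\<lambda>k. defect n a k) b i y - form (\<lambda>k. defect n b k) a i y) x"
      by (rule ray_integral_cong[OF convex_S q assms(3)]) (rule curl_form[OF assms(1) b assms(2)])
    finally show "ray_integral 1 q (dir_deriv a (form (iter n) b i)) x
        - ray_integral 1 q (dir_deriv b (form (iter n) a i)) x =
      ray_integral 1 q (\<lambda>y. form (\<lambda>k. defect n a k) b i y - form (\<lambda>k. defect n b k) a i y) x" .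
  qed
  finally show ?thesis .
qed

definition "init_norm = (\<Sum>i\<in>I. \<bar>w0 i\<bar>)"

lemma init_norm_bounds: "0 \<le> init_norm" "i \<in> I \<Longrightarrow> \<bar>w0 i\<bar> \<le> init_norm"
  unfolding init_norm_def by (auto intro: sum_nonneg member_le_sum)

lemma continuous_form_iter: "b \<in> B \<Longrightarrow> i \<in> I \<Longrightarrow> continuous_on S (form (iter n) b i)"
  by (intro smooth_on_imp_continuous_on smooth_form_iter)

text \<open>Each step gains the contraction factor 1/8; only the rate 1/2 is recorded, the one
  established for the defect as well.\<close>

lemma iter_step: "i \<in> I \<Longrightarrow> x \<in> S \<Longrightarrow> \<bar>iter (Suc n) i x - iter n i x\<bar> \<le> init_norm / 2 ^ n"
proof (induction n arbitrary: i x)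
  case 0
  have "\<bar>iter (Suc 0) i x - iter 0 i x\<bar> \<le> d * card B * (card I * C * init_norm)"
    using 0 init_norm_bounds by (auto intro!: directional_bound q ray_integral_bound[OF convex_S q] form_bound
        continuous_form_iter[of _ _ 0, simplified])
  also have "\<dots> \<le> init_norm / 8" by (rule contraction[OF init_norm_bounds(1)])
  finally show ?case using init_norm_bounds(1) by simp
next
  case (Suc n)
  let ?u = "\<lambda>j y. iter (Suc n) j y - iter n j y"
  have "iter (Suc (Suc n)) i x - iter (Suc n) i x = (\<Sum>b\<in>B. ((x - q) \<bullet> b) *
      (ray_integral 0 q (form (iter (Suc n)) b i) x - ray_integral 0 q (form (iter n) b i) x))"
    by (simp only: iter.simps(2)[of "Suc n"] iter.simps(2)[of n] right_diff_distrib sum_subtractf add_diff_cancel_left)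
  also have "\<dots> = (\<Sum>b\<in>B. ((x - q) \<bullet> b) * ray_integral 0 q (form ?u b i) x)"
  proof (intro sum.cong refl arg_cong2[of _ _ _ _ "(*)"])
    fix b assume "b \<in> B"
    then show "ray_integral 0 q (form (iter (Suc n)) b i) x - ray_integral 0 q (form (iter n) b i) x =
        ray_integral 0 q (form ?u b i) x"
      using ray_integral_diff[OF convex_S q Suc.prems(2)
          continuous_form_iter[of b i "Suc n"] continuous_form_iter[of b i n]] Suc.prems(1)
      unfolding form_diff by blast
  qed
  finally have eq: "iter (Suc (Suc n)) i x - iter (Suc n) i x =
      (\<Sum>b\<in>B. ((x - q) \<bullet> b) * ray_integral 0 q (form ?u b i) x)" .
  have "continuous_on S (form ?u b i)" if "b \<in> B" for b
    unfolding form_diff[symmetric]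
    by (intro continuous_on_diff continuous_form_iter that Suc.prems)
  then have "\<bar>iter (Suc (Suc n)) i x - iter (Suc n) i x\<bar> \<le> d * card B * (card I * C * (init_norm / 2 ^ n))"
    unfolding eq
    by (intro directional_bound q ray_integral_bound[OF convex_S q] form_bound Suc)
  also have "\<dots> \<le> (init_norm / 2 ^ n) / 8" using init_norm_bounds(1) by (intro contraction) simp
  also have "\<dots> \<le> init_norm / 2 ^ Suc n" using init_norm_bounds(1) by (simp add: field_simps)
  finally show ?case .
qed

text \<open>The factor 4 makes the change of the form between consecutive iterates at most
  \<open>defect_const / 4 / 2 ^ n\<close>.\<close>

definition "defect_const = 4 * (card I * C * init_norm)"

lemma defect_const_nonneg: "0 \<le> defect_const" using C_nonneg init_norm_bounds(1) by (simp add: defect_const_def)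

text \<open>Compare the derivative of the new iterate first with the form of the old one: by
  \<open>dir_deriv_iter\<close> this is a curl integral, at most a quarter of the old bound. Passing
  to the form of the new iterate costs another quarter.\<close>

lemma defect_bound: "a \<in> B \<Longrightarrow> i \<in> I \<Longrightarrow> x \<in> S \<Longrightarrow> \<bar>defect n a i x\<bar> \<le> defect_const / 2 ^ n"
proof (induction n arbitrary: a i x)
  case 0
  have "\<bar>form (\<lambda>i x. w0 i) a i x\<bar> \<le> card I * C * init_norm" using 0 init_norm_bounds by (intro form_bound) auto
  moreover have "dir_deriv a (\<lambda>x. w0 i) x = 0" by (rule dir_derivI) simp
  ultimately show ?case using defect_const_nonneg by (simp add: defect_def defect_const_def)
next
  case (Suc n)
  let ?D = "\<lambda>a b i y. form (\<lambda>k. defect n a k) b i y - form (\<lambda>k. defect n b k) a i y"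
  let ?E = "defect_const / 2 ^ n"
  have E: "0 \<le> ?E" using defect_const_nonneg by simp
  have cont: "continuous_on S (?D a b i)" if "b \<in> B" for b
    using that Suc.prems
    by (intro continuous_on_diff smooth_on_imp_continuous_on smooth_form smooth_defect)
  have D: "\<bar>?D a b i y\<bar> \<le> card I * C * (2 * ?E)" if "b \<in> B" "y \<in> S" for b y
  proof -
    have "\<bar>form (\<lambda>k. defect n a k) b i y\<bar> \<le> card I * C * ?E"
      "\<bar>form (\<lambda>k. defect n b k) a i y\<bar> \<le> card I * C * ?E"
      using that Suc by (intro form_bound; blast)+
    from order_trans[OF abs_triangle_ineq4 add_mono[OF this]]
    show ?thesis by (simp only: mult_2 distrib_left)
  qed
  have "\<bar>dir_deriv a (iter (Suc n) i) x - form (iter n) a i x\<bar> \<le> d * card B * (card I * C * (2 * ?E))"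
    unfolding dir_deriv_iter[OF Suc.prems]
    by (intro directional_bound q Suc.prems ray_integral_bound[OF convex_S q] cont D)
  also have "\<dots> \<le> 2 * ?E / 8" using E by (intro contraction) simp
  finally have 1: "\<bar>dir_deriv a (iter (Suc n) i) x - form (iter n) a i x\<bar> \<le> ?E / 4" by simp
  have "\<bar>form (\<lambda>j x. iter (Suc n) j x - iter n j x) a i x\<bar> \<le> card I * C * (init_norm / 2 ^ n)"
    using Suc.prems iter_step by (intro form_bound)
  then have 2: "\<bar>form (iter (Suc n)) a i x - form (iter n) a i x\<bar> \<le> ?E / 4"
    unfolding form_diff by (simp add: defect_const_def)
  have triangle: "\<bar>u - w\<bar> \<le> \<bar>u - v\<bar> + \<bar>w - v\<bar>" for u v w :: real by linarith
  have "\<bar>defect (Suc n) a i x\<bar> \<le> ?E / 4 + ?E / 4"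
    unfolding defect_def by (rule order_trans[OF _ add_mono[OF 1 2]]) (rule triangle)
  then show ?case by simp
qed

text \<open>By the defect bound the derivatives of the iterates converge uniformly to the form of
  the limit, so the limit may be differentiated termwise.\<close>

lemma solution_exists:
  obtains w where "solution S w" "\<And>i. i \<in> I \<Longrightarrow> w i q = w0 i"
proof -
  have "\<exists>l. \<forall>i\<in>I. \<forall>x\<in>S. (\<lambda>n. iter n i x) \<longlonglongrightarrow> l i x \<and> (\<forall>n. \<bar>l i x - iter n i x\<bar> \<le> 2 * init_norm / 2 ^ n)"
  proof -
    have "\<exists>l. (\<lambda>n. iter n i x) \<longlonglongrightarrow> l \<and> (\<forall>n. \<bar>l - iter n i x\<bar> \<le> 2 * init_norm / 2 ^ n)"
      if "i \<in> I" "x \<in> S" for i x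
      using geometric_limit[of "\<lambda>n. iter n i x" init_norm] iter_step[OF that] by metis
    then show ?thesis by metis
  qed
  then obtain w where w: "\<And>i x. i \<in> I \<Longrightarrow> x \<in> S \<Longrightarrow> (\<lambda>n. iter n i x) \<longlonglongrightarrow> w i x"
    "\<And>i x n. i \<in> I \<Longrightarrow> x \<in> S \<Longrightarrow> \<bar>w i x - iter n i x\<bar> \<le> 2 * init_norm / 2 ^ n"
    by metis
  \<comment> \<open>One summand comes from the defect of \<open>iter n\<close>, the other from
    inserting the tail bound \<open>2 * init_norm / 2 ^ n\<close> into the form.\<close>
  define L where "L = defect_const + card I * C * (2 * init_norm)"
  have L: "0 \<le> L" using defect_const_nonneg C_nonneg init_norm_bounds(1) by (simp add: L_def)
  have close: "\<bar>dir_deriv b (iter n i) x - form w b i x\<bar> \<le> L / 2 ^ n"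
    if "b \<in> B" "i \<in> I" "x \<in> S" for b i x n
  proof -
    have "\<bar>form (\<lambda>j x. iter n j x - w j x) b i x\<bar> \<le> card I * C * (2 * init_norm / 2 ^ n)"
      using that w(2) by (intro form_bound) (auto simp: abs_minus_commute)
    then have "\<bar>form (iter n) b i x - form w b i x\<bar> \<le> card I * C * (2 * init_norm) / 2 ^ n"
      unfolding form_diff by simp
    with defect_bound[OF that, of n] show ?thesis
      unfolding defect_def L_def add_divide_distrib by linarith
  qed
  have lim0: "(\<lambda>n. card B * L / 2 ^ n) \<longlonglongrightarrow> 0"
  proof -
    have "(\<lambda>n. card B * L * (1 / 2) ^ n) \<longlonglongrightarrow> card B * L * 0"
      by (intro tendsto_mult tendsto_const LIMSEQ_realpow_zero) auto
    then show ?thesis by (simp add: power_divide)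
  qed
  have "solution S w"
    unfolding solution_def
  proof (intro ballI)
    fix i x assume i: "i \<in> I" and x: "x \<in> S"
    let ?g = "\<lambda>x v. \<Sum>b\<in>B. (v \<bullet> b) * form w b i x"
    have "\<exists>g. \<forall>x\<in>S. (\<lambda>n. iter n i x) \<longlonglongrightarrow> g x \<and> (g has_derivative ?g x) (at x within S)"
    proof (rule has_derivative_sequence[where f = "\<lambda>n. iter n i", OF convex_S _ _ x w(1)[OF i x]])
      show "(iter n i has_derivative (\<lambda>v. \<Sum>b\<in>B. (v \<bullet> b) * dir_deriv b (iter n i) y)) (at y within S)"
        if "y \<in> S" for n y
        using smooth_on_partials[OF smooth_iter[OF i] that] by (rule has_derivative_at_withinI)
      fix e :: real assume "e > 0"
      from order_tendstoD(2)[OF lim0 this]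
      show "\<forall>\<^sub>F n in sequentially. \<forall>y\<in>S. \<forall>v.
          norm ((\<Sum>b\<in>B. (v \<bullet> b) * dir_deriv b (iter n i) y) - ?g y v) \<le> e * norm v"
      proof eventually_elim
        case (elim n)
        show ?case
        proof (intro ballI allI)
          fix y v assume y: "y \<in> S"
          have "\<bar>\<Sum>b\<in>B. (v \<bullet> b) * (dir_deriv b (iter n i) y - form w b i y)\<bar> \<le>
              (\<Sum>b\<in>B. norm v * (L / 2 ^ n))"
          proof (rule order_trans[OF sum_abs sum_mono])
            fix b assume b: "b \<in> B"
            show "\<bar>(v \<bullet> b) * (dir_deriv b (iter n i) y - form w b i y)\<bar> \<le> norm v * (L / 2 ^ n)"
              unfolding abs_mult using inner_B_le[OF b] close[OF b i y] by (intro mult_mono) auto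
          qed
          also have "\<dots> = card B * L / 2 ^ n * norm v" by simp
          also have "\<dots> \<le> e * norm v" using elim by (intro mult_right_mono) auto
          finally show "norm ((\<Sum>b\<in>B. (v \<bullet> b) * dir_deriv b (iter n i) y) - ?g y v) \<le> e * norm v"
            by (simp add: right_diff_distrib sum_subtractf)
        qed
      qed
    qed
    \<comment> \<open>The limit theorem returns some \<open>g\<close> with a derivative within
      \<open>S\<close>. It is \<open>w i\<close> on \<open>S\<close> by uniqueness of limits, and
      openness of \<open>S\<close> removes the restriction.\<close>
    then obtain g where g: "\<And>y. y \<in> S \<Longrightarrow> (\<lambda>n. iter n i y) \<longlonglongrightarrow> g y"
      "\<And>y. y \<in> S \<Longrightarrow> (g has_derivative ?g y) (at y within S)" by blast
    have "g y = w i y" if "y \<in> S" for y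
      using LIMSEQ_unique[OF g(1)[OF that] w(1)[OF i that]] .
    moreover have "(g has_derivative ?g x) (at x)"
      using g(2)[OF x] at_within_open[OF x open_S] by simp
    ultimately show "(w i has_derivative ?g x) (at x)"
      using has_derivative_transform_within_open[OF _ open_S x] by blast
  qed
  moreover have "w i q = w0 i" if "i \<in> I" for i
  proof -
    have "iter n i q = w0 i" for n by (cases n) auto
    then show ?thesis using LIMSEQ_unique[OF w(1)[OF that q]] by (simp add: LIMSEQ_const_iff)
  qed
  ultimately show ?thesis by (rule that)
qed

end

section \<open>Monodromy\<close>

text \<open>Germs at \<open>p\<close> are handled through representatives that are total
  functions.\<close>

definition germ_eq :: "'m::topological_space \<Rightarrow> ('m \<Rightarrow> real) \<Rightarrow> ('m \<Rightarrow> real) \<Rightarrow> bool" where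
  "germ_eq p f g \<longleftrightarrow> (\<forall>\<^sub>F x in nhds p. f x = g x)"

lemma germ_eq_refl [simp]: "germ_eq p f f"
  by (simp add: germ_eq_def)

lemma germ_eq_sym: "germ_eq p f g \<Longrightarrow> germ_eq p g f"
  by (simp add: germ_eq_def eq_commute)

lemma germ_eq_trans: "germ_eq p f g \<Longrightarrow> germ_eq p g k \<Longrightarrow> germ_eq p f k"
  unfolding germ_eq_def by (auto elim: eventually_elim2)

lemma germ_eq_value: "germ_eq p f g \<Longrightarrow> f p = g p"
  unfolding germ_eq_def by (rule eventually_nhds_x_imp_x)

lemma germ_eq_open: "open W \<Longrightarrow> p \<in> W \<Longrightarrow> (\<And>x. x \<in> W \<Longrightarrow> f x = g x) \<Longrightarrow> germ_eq p f g"
  unfolding germ_eq_def eventually_nhds by blast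

lemma germ_eqE:
  assumes "germ_eq p f g"
  obtains W where "open W" "p \<in> W" "\<And>x. x \<in> W \<Longrightarrow> f x = g x"
  using assms unfolding germ_eq_def eventually_nhds by blast

text \<open>An affine sheaf of functions all of whose germs extend uniquely to fixed neighbourhoods: an
  affine local system, presented by its functions.\<close>

locale affine_local_system =
  fixes Pot :: "'m::topological_space set \<Rightarrow> ('m \<Rightarrow> real) set"
  assumes restrict: "F \<in> Pot W \<Longrightarrow> open W' \<Longrightarrow> W' \<subseteq> W \<Longrightarrow> F \<in> Pot W'"
    and glue: "(\<And>p. p \<in> W \<Longrightarrow> \<exists>W' F. open W' \<and> p \<in> W' \<and> F \<in> Pot W' \<and> (\<forall>q\<in>W'. f q = F q)) \<Longrightarrow>
      open W \<Longrightarrow> f \<in> Pot W"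
    and affine: "open W \<Longrightarrow> finite C \<Longrightarrow> sum c C = 1 \<Longrightarrow> (\<And>i. i \<in> C \<Longrightarrow> G i \<in> Pot W) \<Longrightarrow>
      (\<lambda>x. \<Sum>i\<in>(C::('m \<Rightarrow> real) set set). c i * G i x) \<in> Pot W"
    and trivializing: "\<exists>U. open U \<and> p \<in> U \<and> path_connected U \<and> Pot U \<noteq> {} \<and>
      (\<forall>q\<in>U. \<forall>W g. open W \<longrightarrow> q \<in> W \<longrightarrow> g \<in> Pot W \<longrightarrow> (\<exists>F\<in>Pot U. germ_eq q F g)) \<and>
      (\<forall>F\<in>Pot U. \<forall>G\<in>Pot U. \<forall>q\<in>U. germ_eq q F G \<longrightarrow> (\<forall>x\<in>U. F x = G x))"
begin

lemma trivializing_nhd: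
  obtains U where "open U" "p \<in> U" "path_connected U" "Pot U \<noteq> {}"
    "\<And>q W g. q \<in> U \<Longrightarrow> open W \<Longrightarrow> q \<in> W \<Longrightarrow> g \<in> Pot W \<Longrightarrow> \<exists>F\<in>Pot U. germ_eq q F g"
    "\<And>F G q x. F \<in> Pot U \<Longrightarrow> G \<in> Pot U \<Longrightarrow> q \<in> U \<Longrightarrow> germ_eq q F G \<Longrightarrow> x \<in> U \<Longrightarrow> F x = G x"
  using trivializing[of p] by metis

definition pot_germ :: "'m \<Rightarrow> ('m \<Rightarrow> real) \<Rightarrow> bool" where
  "pot_germ p g \<longleftrightarrow> (\<exists>W F. open W \<and> p \<in> W \<and> F \<in> Pot W \<and> germ_eq p g F)"

text \<open>A section of the pullback along \<open>H\<close> of the etale space of germs: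
  \<open>\<sigma> z\<close> represents a germ at \<open>H z\<close>, and near each parameter all
  these germs come from a single potential. Over an interval this is a continuation along a path,
  over a square a continuation along a homotopy.\<close>

definition section_on :: "'q::topological_space set \<Rightarrow> ('q \<Rightarrow> 'm) \<Rightarrow> ('q \<Rightarrow> 'm \<Rightarrow> real) \<Rightarrow> bool" where
  "section_on Q H \<sigma> \<longleftrightarrow> (\<forall>z\<in>Q. \<exists>N W F. open N \<and> z \<in> N \<and> open W \<and> F \<in> Pot W \<and>
     (\<forall>z'\<in>N \<inter> Q. H z' \<in> W \<and> germ_eq (H z') (\<sigma> z') F))"

lemma section_onE:
  assumes "section_on Q H \<sigma>" "z \<in> Q"
  obtains N W F where "open N" "z \<in> N" "open W" "F \<in> Pot W"
    "\<And>z'. z' \<in> N \<Longrightarrow> z' \<in> Q \<Longrightarrow> H z' \<in> W" "\<And>z'. z' \<in> N \<Longrightarrow> z' \<in> Q \<Longrightarrow> germ_eq (H z') (\<sigma> z') F"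
proof -
  obtain N W F where "open N" "z \<in> N" "open W" "F \<in> Pot W"
    "\<forall>z'\<in>N \<inter> Q. H z' \<in> W \<and> germ_eq (H z') (\<sigma> z') F"
    using assms unfolding section_on_def by metis
  then show ?thesis by (intro that[of N W F]) auto
qed

lemma section_on_pot_germ: "section_on Q H \<sigma> \<Longrightarrow> z \<in> Q \<Longrightarrow> pot_germ (H z) (\<sigma> z)"
  unfolding section_on_def pot_germ_def by blast

lemma section_on_const:
  assumes "open W" "F \<in> Pot W" "H ` Q \<subseteq> W"
  shows "section_on Q H (\<lambda>z. F)"
  unfolding section_on_def using assms by (auto intro!: exI[of _ UNIV] exI[of _ W] exI[of _ F])

lemma section_on_pullback:
  assumes "section_on Q H \<sigma>" "continuous_on Q' k" "k ` Q' \<subseteq> Q"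
    "\<And>z. z \<in> Q' \<Longrightarrow> H' z = H (k z)"
  shows "section_on Q' H' (\<lambda>z. \<sigma> (k z))"
  unfolding section_on_def
proof
  fix z assume z: "z \<in> Q'"
  then have "k z \<in> Q" using assms(3) by blast
  from section_onE[OF assms(1) this] obtain N W F where N: "open N" "k z \<in> N" "open W" "F \<in> Pot W"
    "\<And>z'. z' \<in> N \<Longrightarrow> z' \<in> Q \<Longrightarrow> H z' \<in> W" "\<And>z'. z' \<in> N \<Longrightarrow> z' \<in> Q \<Longrightarrow> germ_eq (H z') (\<sigma> z') F"
    by metis
  obtain N' where N': "open N'" "N' \<inter> Q' = k -` N \<inter> Q'"
    using continuous_on_open_invariant assms(2) N(1) by metis
  show "\<exists>N W F. open N \<and> z \<in> N \<and> open W \<and> F \<in> Pot W \<and>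
     (\<forall>z'\<in>N \<inter> Q'. H' z' \<in> W \<and> germ_eq (H' z') (\<sigma> (k z')) F)"
  proof (intro exI conjI ballI)
    show "z \<in> N'" using N' N(2) z by blast
    fix z' assume "z' \<in> N' \<inter> Q'"
    then have "k z' \<in> N" "k z' \<in> Q" "z' \<in> Q'" using N' assms(3) by auto
    then show "H' z' \<in> W" "germ_eq (H' z') (\<sigma> (k z')) F" using N assms(4) by simp_all
  qed fact+
qed

lemma section_on_subset: "section_on Q H \<sigma> \<Longrightarrow> Q' \<subseteq> Q \<Longrightarrow> section_on Q' H \<sigma>"
  using section_on_pullback[of Q H \<sigma> Q' "\<lambda>z. z" H] by auto

text \<open>Uniqueness of lifts to a covering. Near each parameter both sections come from
  potentials that extend to a common trivializing set \<open>U\<close>, where agreement of germs at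
  one point is agreement on all of \<open>U\<close>.\<close>

lemma section_on_unique:
  fixes Q :: "'q::topological_space set"
  assumes Q: "connected Q" "continuous_on Q H"
    and \<sigma>: "section_on Q H \<sigma>" and \<tau>: "section_on Q H \<tau>"
    and z0: "z0 \<in> Q" "germ_eq (H z0) (\<sigma> z0) (\<tau> z0)" and z1: "z1 \<in> Q"
  shows "germ_eq (H z1) (\<sigma> z1) (\<tau> z1)"
proof (rule connected_induction_simple[of Q z0 z1 "\<lambda>z. germ_eq (H z) (\<sigma> z) (\<tau> z)"])
  fix z assume z: "z \<in> Q"
  obtain N W F where N: "open N" "z \<in> N" "open W" "F \<in> Pot W"
    "\<And>z'. z' \<in> N \<Longrightarrow> z' \<in> Q \<Longrightarrow> H z' \<in> W" "\<And>z'. z' \<in> N \<Longrightarrow> z' \<in> Q \<Longrightarrow> germ_eq (H z') (\<sigma> z') F"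
    by (rule section_onE[OF \<sigma> z]) blast
  obtain N' W' F' where N': "open N'" "z \<in> N'" "open W'" "F' \<in> Pot W'"
    "\<And>z'. z' \<in> N' \<Longrightarrow> z' \<in> Q \<Longrightarrow> H z' \<in> W'" "\<And>z'. z' \<in> N' \<Longrightarrow> z' \<in> Q \<Longrightarrow> germ_eq (H z') (\<tau> z') F'"
    by (rule section_onE[OF \<tau> z]) blast
  obtain U where U: "open U" "H z \<in> U"
    "\<And>q W g. q \<in> U \<Longrightarrow> open W \<Longrightarrow> q \<in> W \<Longrightarrow> g \<in> Pot W \<Longrightarrow> \<exists>F\<in>Pot U. germ_eq q F g"
    "\<And>F G q x. F \<in> Pot U \<Longrightarrow> G \<in> Pot U \<Longrightarrow> q \<in> U \<Longrightarrow> germ_eq q F G \<Longrightarrow> x \<in> U \<Longrightarrow> F x = G x"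
    by (rule trivializing_nhd[of "H z"]) blast
  obtain F1 where F1: "F1 \<in> Pot U" "germ_eq (H z) F1 F" using U(3)[OF U(2) N(3) _ N(4)] N z by blast
  obtain F1' where F1': "F1' \<in> Pot U" "germ_eq (H z) F1' F'" using U(3)[OF U(2) N'(3) _ N'(4)] N' z by blast
  obtain V where V: "open V" "H z \<in> V" "\<And>x. x \<in> V \<Longrightarrow> F1 x = F x" using F1(2) by (metis germ_eqE)
  obtain V' where V': "open V'" "H z \<in> V'" "\<And>x. x \<in> V' \<Longrightarrow> F1' x = F' x" using F1'(2) by (metis germ_eqE)
  let ?O = "V \<inter> V' \<inter> U"
  obtain T where T: "open T" "T \<inter> Q = H -` ?O \<inter> Q"
    using continuous_on_open_invariant Q(2) U(1) V(1) V'(1) by (metis open_Int)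
  \<comment> \<open>The right-hand side does not depend on \<open>x\<close>, so agreement is locally
    constant.\<close>
  have iff: "germ_eq (H x) (\<sigma> x) (\<tau> x) \<longleftrightarrow> (\<forall>y\<in>U. F1 y = F1' y)" if x: "x \<in> T \<inter> N \<inter> N' \<inter> Q" for x
  proof -
    have O: "H x \<in> ?O" using x T by blast
    have e: "germ_eq (H x) (\<sigma> x) F" "germ_eq (H x) (\<tau> x) F'" using x N N' by blast+
    have e1: "germ_eq (H x) F1 F" "germ_eq (H x) F1' F'"
      using O V V' by (auto intro: germ_eq_open)
    have "germ_eq (H x) (\<sigma> x) (\<tau> x) \<longleftrightarrow> germ_eq (H x) F1 F1'"
      using e e1 by (meson germ_eq_sym germ_eq_trans)
    also have "\<dots> \<longleftrightarrow> (\<forall>y\<in>U. F1 y = F1' y)"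
      using U(4)[OF F1(1) F1'(1)] O U(1) by (blast intro: germ_eq_open)
    finally show ?thesis .
  qed
  show "\<exists>T. openin (top_of_set Q) T \<and> z \<in> T \<and>
      (\<forall>x\<in>T. \<forall>y\<in>T. germ_eq (H x) (\<sigma> x) (\<tau> x) \<longrightarrow> germ_eq (H y) (\<sigma> y) (\<tau> y))"
  proof (intro exI conjI)
    show "openin (top_of_set Q) (Q \<inter> (T \<inter> N \<inter> N'))"
      using T N N' by (intro openin_open_Int open_Int)
    show "z \<in> Q \<inter> (T \<inter> N \<inter> N')" using z N N' T U V V' by blast
    show "\<forall>x\<in>Q \<inter> (T \<inter> N \<inter> N'). \<forall>y\<in>Q \<inter> (T \<inter> N \<inter> N').
        germ_eq (H x) (\<sigma> x) (\<tau> x) \<longrightarrow> germ_eq (H y) (\<sigma> y) (\<tau> y)"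
      using iff by blast
  qed
qed (use assms in auto)

section \<open>Continuation over rectangles\<close>

definition extends :: "'q::topological_space set \<Rightarrow> ('q \<Rightarrow> 'm) \<Rightarrow> bool" where
  "extends Q H \<longleftrightarrow> (\<forall>z0\<in>Q. \<forall>g. pot_germ (H z0) g \<longrightarrow>
     (\<exists>\<sigma>. section_on Q H \<sigma> \<and> germ_eq (H z0) (\<sigma> z0) g))"

text \<open>Start on \<open>Q1\<close>, then continue over \<open>Q2\<close> the germ reached at one
  common point. On the connected overlap the two sections agree by uniqueness, so they
  combine.\<close>

lemma extends_glue_aux:
  fixes Q1 Q2 :: "'q::topological_space set"
  assumes closed: "closed Q1" "closed Q2" and conn: "connected (Q1 \<inter> Q2)" and ne: "Q1 \<inter> Q2 \<noteq> {}"
    and cont: "continuous_on (Q1 \<union> Q2) H"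
    and ext: "extends Q1 H" "extends Q2 H"
    and z0: "z0 \<in> Q1" and g: "pot_germ (H z0) g"
  shows "\<exists>\<sigma>. section_on (Q1 \<union> Q2) H \<sigma> \<and> germ_eq (H z0) (\<sigma> z0) g"
proof -
  obtain \<sigma>1 where \<sigma>1: "section_on Q1 H \<sigma>1" "germ_eq (H z0) (\<sigma>1 z0) g"
    using ext(1) z0 g unfolding extends_def by blast
  obtain z1 where z1: "z1 \<in> Q1" "z1 \<in> Q2" using ne by blast
  obtain \<sigma>2 where \<sigma>2: "section_on Q2 H \<sigma>2" "germ_eq (H z1) (\<sigma>2 z1) (\<sigma>1 z1)"
    using ext(2) z1 section_on_pot_germ[OF \<sigma>1(1) z1(1)] unfolding extends_def by blast
  have agree: "germ_eq (H z) (\<sigma>1 z) (\<sigma>2 z)" if "z \<in> Q1" "z \<in> Q2" for z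
  proof (rule section_on_unique[OF conn])
    show "continuous_on (Q1 \<inter> Q2) H" using cont by (rule continuous_on_subset) auto
    show "section_on (Q1 \<inter> Q2) H \<sigma>1" "section_on (Q1 \<inter> Q2) H \<sigma>2"
      using \<sigma>1(1) \<sigma>2(1) by (auto intro: section_on_subset)
  qed (use z1 that \<sigma>2(2) germ_eq_sym in auto)
  define \<sigma> where "\<sigma> z = (if z \<in> Q1 then \<sigma>1 z else \<sigma>2 z)" for z
  have eq1: "germ_eq (H z) (\<sigma> z) (\<sigma>1 z)" if "z \<in> Q1" for z using that by (simp add: \<sigma>_def)
  have eq2: "germ_eq (H z) (\<sigma> z) (\<sigma>2 z)" if "z \<in> Q2" for z using that agree by (simp add: \<sigma>_def)
  \<comment> \<open>At a point of one piece \<open>P\<close> off the other closed piece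
    \<open>P'\<close>, removing \<open>P'\<close> from the neighbourhood preserves the local
    description by \<open>\<tau>\<close>. Stated once for both roles of the pieces.\<close>
  have outside: "\<exists>N W F. open N \<and> z \<in> N \<and> open W \<and> F \<in> Pot W \<and>
      (\<forall>z'\<in>N \<inter> (Q1 \<union> Q2). H z' \<in> W \<and> germ_eq (H z') (\<sigma> z') F)"
    if \<tau>: "section_on P H \<tau>" and z: "z \<in> P" "z \<notin> P'" and P': "closed P'" "Q1 \<union> Q2 = P \<union> P'"
      and eq: "\<And>z. z \<in> P \<Longrightarrow> germ_eq (H z) (\<sigma> z) (\<tau> z)" for P P' \<tau> z
  proof -
    obtain N W F where N: "open N" "z \<in> N" "open W" "F \<in> Pot W"
      "\<And>z'. z' \<in> N \<Longrightarrow> z' \<in> P \<Longrightarrow> H z' \<in> W" "\<And>z'. z' \<in> N \<Longrightarrow> z' \<in> P \<Longrightarrow> germ_eq (H z') (\<tau> z') F"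
      by (rule section_onE[OF \<tau> z(1)]) blast
    show ?thesis
    proof (intro exI conjI ballI)
      show "open (N \<inter> - P')" using N(1) P'(1) by auto
      show "z \<in> N \<inter> - P'" using N z by blast
      fix z' assume "z' \<in> (N \<inter> - P') \<inter> (Q1 \<union> Q2)"
      then have z': "z' \<in> N" "z' \<in> P" using P'(2) by auto
      show "H z' \<in> W" by (rule N(5)[OF z'])
      show "germ_eq (H z') (\<sigma> z') F" by (rule germ_eq_trans[OF eq[OF z'(2)] N(6)[OF z']])
    qed fact+
  qed
  have "section_on (Q1 \<union> Q2) H \<sigma>"
    unfolding section_on_def
  proof
    fix z assume z: "z \<in> Q1 \<union> Q2"
    consider "z \<in> Q1" "z \<notin> Q2" | "z \<notin> Q1" "z \<in> Q2" | "z \<in> Q1" "z \<in> Q2" using z by blast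
    then show "\<exists>N W F. open N \<and> z \<in> N \<and> open W \<and> F \<in> Pot W \<and>
      (\<forall>z'\<in>N \<inter> (Q1 \<union> Q2). H z' \<in> W \<and> germ_eq (H z') (\<sigma> z') F)"
    proof cases
      case 1
      show ?thesis by (rule outside[OF \<sigma>1(1) 1 closed(2) refl eq1])
    next
      case 2
      show ?thesis by (rule outside[OF \<sigma>2(1) 2(2,1) closed(1) Un_commute eq2])
    next
      case 3
      obtain N W F where N: "open N" "z \<in> N" "open W" "F \<in> Pot W"
        "\<And>z'. z' \<in> N \<Longrightarrow> z' \<in> Q1 \<Longrightarrow> H z' \<in> W" "\<And>z'. z' \<in> N \<Longrightarrow> z' \<in> Q1 \<Longrightarrow> germ_eq (H z') (\<sigma>1 z') F"
        by (rule section_onE[OF \<sigma>1(1) 3(1)]) blast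
      obtain N' W' F' where N': "open N'" "z \<in> N'" "open W'" "F' \<in> Pot W'"
        "\<And>z'. z' \<in> N' \<Longrightarrow> z' \<in> Q2 \<Longrightarrow> H z' \<in> W'" "\<And>z'. z' \<in> N' \<Longrightarrow> z' \<in> Q2 \<Longrightarrow> germ_eq (H z') (\<sigma>2 z') F'"
        by (rule section_onE[OF \<sigma>2(1) 3(2)]) blast
      \<comment> \<open>At a common point the two local potentials have the same germ; restricting
        to the preimage \<open>T\<close> of a region where they agree lets \<open>F\<close> serve
        both pieces.\<close>
      have "germ_eq (H z) F' F"
        using agree[OF 3] N(2,6) N'(2,6) 3 by (meson germ_eq_sym germ_eq_trans)
      then obtain V where V: "open V" "H z \<in> V" "\<And>x. x \<in> V \<Longrightarrow> F' x = F x" by (metis germ_eqE)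
      obtain T where T: "open T" "T \<inter> (Q1 \<union> Q2) = H -` (V \<inter> W) \<inter> (Q1 \<union> Q2)"
        using continuous_on_open_invariant cont V(1) N(3) by (metis open_Int)
      show ?thesis
      proof (intro exI conjI ballI)
        show "open (N \<inter> N' \<inter> T)" using N N' T by auto
        show "z \<in> N \<inter> N' \<inter> T" using N N' T V 3 by blast
        fix z' assume z': "z' \<in> (N \<inter> N' \<inter> T) \<inter> (Q1 \<union> Q2)"
        then have V': "H z' \<in> V" "H z' \<in> W" using T by blast+
        then show "H z' \<in> W" by simp
        have F: "germ_eq (H z') F' F" using V V' by (blast intro: germ_eq_open)
        show "germ_eq (H z') (\<sigma> z') F"
        proof (cases "z' \<in> Q1")
          case True
          then show ?thesis using z' by (blast intro: germ_eq_trans[OF eq1 N(6)])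
        next
          case False
          then show ?thesis using z' by (blast intro: germ_eq_trans[OF eq2 germ_eq_trans[OF N'(6) F]])
        qed
      qed fact+
    qed
  qed
  moreover have "germ_eq (H z0) (\<sigma> z0) g" using eq1[OF z0] \<sigma>1(2) by (rule germ_eq_trans)
  ultimately show ?thesis by blast
qed

lemma extends_glue:
  assumes "closed Q1" "closed Q2" "connected (Q1 \<inter> Q2)" "Q1 \<inter> Q2 \<noteq> {}"
    "continuous_on (Q1 \<union> Q2) H" "extends Q1 H" "extends Q2 H"
  shows "extends (Q1 \<union> Q2) H"
  unfolding extends_def
proof (intro ballI allI impI)
  fix z0 g assume z0: "z0 \<in> Q1 \<union> Q2" and g: "pot_germ (H z0) g"
  show "\<exists>\<sigma>. section_on (Q1 \<union> Q2) H \<sigma> \<and> germ_eq (H z0) (\<sigma> z0) g"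
  proof (cases "z0 \<in> Q1")
    case True
    then show ?thesis using extends_glue_aux assms g by blast
  next
    case False
    then have "z0 \<in> Q2" using z0 by blast
    then show ?thesis
      using extends_glue_aux[of Q2 Q1 H z0 g] assms g by (simp add: Int_commute Un_commute)
  qed
qed

lemma extends_local:
  obtains U where "open U" "p \<in> U" "\<And>Q H. H ` Q \<subseteq> U \<Longrightarrow> extends (Q::'q::topological_space set) H"
proof -
  obtain U where U: "open U" "p \<in> U"
    "\<And>q W g. q \<in> U \<Longrightarrow> open W \<Longrightarrow> q \<in> W \<Longrightarrow> g \<in> Pot W \<Longrightarrow> \<exists>F\<in>Pot U. germ_eq q F g"
    by (rule trivializing_nhd[of p]) blast
  have "extends Q H" if "H ` Q \<subseteq> U" for Q :: "'q set" and H
    unfolding extends_def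
  proof (intro ballI allI impI)
    fix z0 g assume z0: "z0 \<in> Q" and "pot_germ (H z0) g"
    then obtain W F where "open W" "H z0 \<in> W" "F \<in> Pot W" "germ_eq (H z0) g F"
      unfolding pot_germ_def by blast
    moreover have "H z0 \<in> U" using z0 that by blast
    ultimately obtain F' where "F' \<in> Pot U" "germ_eq (H z0) F' g"
      using U(3) by (meson germ_eq_sym germ_eq_trans)
    then show "\<exists>\<sigma>. section_on Q H \<sigma> \<and> germ_eq (H z0) (\<sigma> z0) g"
      using section_on_const[OF U(1) _ that] by blast
  qed
  with U(1,2) show ?thesis by (rule that)
qed

text \<open>Bisection twice: rectangles are stacked in the second coordinate to strips over short
  intervals, then the strips are joined in the first. \<open>H\<close> is continuous on the whole
  plane because small rectangles around a boundary point may leave the square.\<close>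

lemma extends_square:
  fixes H :: "real \<times> real \<Rightarrow> 'm"
  assumes H: "continuous_on UNIV H"
  shows "extends ({0..1} \<times> {0..1}) H"
proof -
  have cont: "continuous_on Q H" for Q using H continuous_on_subset by blast
  \<comment> \<open>The admissible width \<open>\<delta>\<close> depends on the interval in the
    second coordinate; joining two rectangles keeps the smaller width.\<close>
  have strip: "\<exists>\<delta>>0. \<forall>a b. a \<le> s \<and> s \<le> b \<and> b - a < \<delta> \<longrightarrow> (0 \<le> (1::real) \<longrightarrow> extends ({a..b} \<times> {0..1}) H)"
    for s :: real
  proof (rule Bolzano[of 0 1 "\<lambda>c d. \<exists>\<delta>>0. \<forall>a b. a \<le> s \<and> s \<le> b \<and> b - a < \<delta> \<longrightarrow> (c \<le> d \<longrightarrow> extends ({a..b} \<times> {c..d}) H)"])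
    fix c1 c2 c3 :: real
    assume le: "c1 \<le> c2" "c2 \<le> c3"
    assume "\<exists>\<delta>>0. \<forall>a b. a \<le> s \<and> s \<le> b \<and> b - a < \<delta> \<longrightarrow> (c1 \<le> c2 \<longrightarrow> extends ({a..b} \<times> {c1..c2}) H)"
    then obtain \<delta>1 where 1: "\<delta>1 > 0" "\<And>a b. a \<le> s \<Longrightarrow> s \<le> b \<Longrightarrow> b - a < \<delta>1 \<Longrightarrow> extends ({a..b} \<times> {c1..c2}) H"
      using le by auto
    assume "\<exists>\<delta>>0. \<forall>a b. a \<le> s \<and> s \<le> b \<and> b - a < \<delta> \<longrightarrow> (c2 \<le> c3 \<longrightarrow> extends ({a..b} \<times> {c2..c3}) H)"
    then obtain \<delta>2 where 2: "\<delta>2 > 0" "\<And>a b. a \<le> s \<Longrightarrow> s \<le> b \<Longrightarrow> b - a < \<delta>2 \<Longrightarrow> extends ({a..b} \<times> {c2..c3}) H"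
      using le by auto
    have "extends ({a..b} \<times> {c1..c3}) H" if ab: "a \<le> s" "s \<le> b" "b - a < min \<delta>1 \<delta>2" for a b
    proof -
      have "extends (({a..b} \<times> {c1..c2}) \<union> ({a..b} \<times> {c2..c3})) H"
      proof (rule extends_glue)
        have "({a..b} \<times> {c1..c2}) \<inter> ({a..b} \<times> {c2..c3}) = {a..b} \<times> {c2}" using le by auto
        then show "connected (({a..b} \<times> {c1..c2}) \<inter> ({a..b} \<times> {c2..c3}))"
          by (simp add: connected_Times)
        have "(s, c2) \<in> ({a..b} \<times> {c1..c2}) \<inter> ({a..b} \<times> {c2..c3})" using le ab by auto
        then show "({a..b} \<times> {c1..c2}) \<inter> ({a..b} \<times> {c2..c3}) \<noteq> {}" by blast
      qed (use 1 2 ab in \<open>auto intro: closed_Times cont\<close>)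
      moreover have "({a..b} \<times> {c1..c2}) \<union> ({a..b} \<times> {c2..c3}) = {a..b} \<times> {c1..c3}" using le by auto
      ultimately show ?thesis by simp
    qed
    then show "\<exists>\<delta>>0. \<forall>a b. a \<le> s \<and> s \<le> b \<and> b - a < \<delta> \<longrightarrow> (c1 \<le> c3 \<longrightarrow> extends ({a..b} \<times> {c1..c3}) H)"
      using 1(1) 2(1) by (intro exI[of _ "min \<delta>1 \<delta>2"]) auto
  next
    fix t :: real
    obtain U where U: "open U" "H (s, t) \<in> U" "\<And>Q H. H ` Q \<subseteq> U \<Longrightarrow> extends (Q::(real \<times> real) set) H"
      by (rule extends_local[of "H (s, t)"]) blast
    have "open (H -` U)" using H U(1) by (simp add: open_vimage)
    then obtain X Y where XY: "open X" "open Y" "s \<in> X" "t \<in> Y" "X \<times> Y \<subseteq> H -` U"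
      using U(2) by (elim open_prod_elim[of _ "(s, t)"]) auto
    obtain \<delta>1 where \<delta>1: "\<delta>1 > 0" "\<And>s'. \<bar>s' - s\<bar> < \<delta>1 \<Longrightarrow> s' \<in> X"
      using XY by (metis open_real)
    obtain \<delta>2 where \<delta>2: "\<delta>2 > 0" "\<And>t'. \<bar>t' - t\<bar> < \<delta>2 \<Longrightarrow> t' \<in> Y"
      using XY by (metis open_real)
    have "extends ({a..b} \<times> {c..d}) H"
      if "a \<le> s" "s \<le> b" "b - a < \<delta>1" "c \<le> t" "t \<le> d" "d - c < \<delta>2" for a b c d
    proof (rule U(3))
      have "{a..b} \<subseteq> X" "{c..d} \<subseteq> Y" using that \<delta>1(2) \<delta>2(2) by (auto simp: abs_if)
      then show "H ` ({a..b} \<times> {c..d}) \<subseteq> U" using XY(5) by blast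
    qed
    then show "\<exists>e>0. \<forall>c d. c \<le> t \<and> t \<le> d \<and> d - c < e \<longrightarrow>
        (\<exists>\<delta>>0. \<forall>a b. a \<le> s \<and> s \<le> b \<and> b - a < \<delta> \<longrightarrow> (c \<le> d \<longrightarrow> extends ({a..b} \<times> {c..d}) H))"
      using \<delta>1(1) \<delta>2(1) by blast
  qed simp
  have "0 \<le> (1::real) \<longrightarrow> extends ({0..1} \<times> {0..1}) H"
  proof (rule Bolzano[of 0 1 "\<lambda>a b. a \<le> b \<longrightarrow> extends ({a..b} \<times> {0..1}) H"])
    fix a b c :: real
    assume le: "a \<le> b" "b \<le> c" and "a \<le> b \<longrightarrow> extends ({a..b} \<times> {0..1}) H"
      "b \<le> c \<longrightarrow> extends ({b..c} \<times> {0..1}) H"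
    then have ext: "extends ({a..b} \<times> {0..1}) H" "extends ({b..c} \<times> {0..1}) H" by auto
    have "extends (({a..b} \<times> {0..1}) \<union> ({b..c} \<times> {0..1})) H"
    proof (rule extends_glue[OF _ _ _ _ _ ext])
      have "({a..b} \<times> {0..1}) \<inter> ({b..c} \<times> {0..1}) = {b} \<times> {0..1::real}" using le by auto
      then show "connected (({a..b} \<times> {0..1::real}) \<inter> ({b..c} \<times> {0..1}))"
        by (simp add: connected_Times)
      have "(b, 0) \<in> ({a..b} \<times> {0..1::real}) \<inter> ({b..c} \<times> {0..1})" using le by auto
      then show "({a..b} \<times> {0..1::real}) \<inter> ({b..c} \<times> {0..1}) \<noteq> {}" by blast
    qed (auto intro: closed_Times cont)
    moreover have "({a..b} \<times> {0..1::real}) \<union> ({b..c} \<times> {0..1}) = {a..c} \<times> {0..1}" using le by auto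
    ultimately show "a \<le> c \<longrightarrow> extends ({a..c} \<times> {0..1}) H" by simp
  next
    fix s :: real
    show "\<exists>d>0. \<forall>a b. a \<le> s \<and> s \<le> b \<and> b - a < d \<longrightarrow> (a \<le> b \<longrightarrow> extends ({a..b} \<times> {0..1}) H)"
      using strip[of s] by auto
  qed simp
  then show ?thesis by simp
qed

text \<open>A relation, because the result of a continuation is determined only up to
  \<open>germ_eq\<close>.\<close>

definition transport :: "(real \<Rightarrow> 'm) \<Rightarrow> ('m \<Rightarrow> real) \<Rightarrow> ('m \<Rightarrow> real) \<Rightarrow> bool" where
  "transport \<gamma> g g' \<longleftrightarrow> (\<exists>\<sigma>. section_on {0..1} \<gamma> \<sigma> \<and> germ_eq (\<gamma> 0) (\<sigma> 0) g \<and> germ_eq (\<gamma> 1) (\<sigma> 1) g')"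

lemma transport_pot_germ:
  assumes "transport \<gamma> g g'"
  shows "pot_germ (\<gamma> 0) g" "pot_germ (\<gamma> 1) g'"
proof -
  obtain \<sigma> where \<sigma>: "section_on {0..1} \<gamma> \<sigma>" "germ_eq (\<gamma> 0) (\<sigma> 0) g" "germ_eq (\<gamma> 1) (\<sigma> 1) g'"
    using assms unfolding transport_def by blast
  have "pot_germ (\<gamma> 0) (\<sigma> 0)" "pot_germ (\<gamma> 1) (\<sigma> 1)" using section_on_pot_germ[OF \<sigma>(1)] by auto
  then show "pot_germ (\<gamma> 0) g" "pot_germ (\<gamma> 1) g'"
    unfolding pot_germ_def using \<sigma>(2,3) germ_eq_sym germ_eq_trans by metis+
qed

lemma transport_unique:
  assumes "path \<gamma>" "transport \<gamma> g g1" "transport \<gamma> g' g1'" "germ_eq (\<gamma> 0) g g'"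
  shows "germ_eq (\<gamma> 1) g1 g1'"
proof -
  obtain \<sigma> where \<sigma>: "section_on {0..1} \<gamma> \<sigma>" "germ_eq (\<gamma> 0) (\<sigma> 0) g" "germ_eq (\<gamma> 1) (\<sigma> 1) g1"
    using assms(2) unfolding transport_def by blast
  obtain \<tau> where \<tau>: "section_on {0..1} \<gamma> \<tau>" "germ_eq (\<gamma> 0) (\<tau> 0) g'" "germ_eq (\<gamma> 1) (\<tau> 1) g1'"
    using assms(3) unfolding transport_def by blast
  have "germ_eq (\<gamma> 0) (\<sigma> 0) (\<tau> 0)" using \<sigma>(2) \<tau>(2) assms(4) by (meson germ_eq_sym germ_eq_trans)
  then have "germ_eq (\<gamma> 1) (\<sigma> 1) (\<tau> 1)"
    using assms(1) by (intro section_on_unique[of "{0..1}" \<gamma> \<sigma> \<tau> 0 1] \<sigma>(1) \<tau>(1)) (auto simp: path_def)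
  then show ?thesis using \<sigma>(3) \<tau>(3) by (meson germ_eq_sym germ_eq_trans)
qed

lemma transport_cong:
  "transport \<gamma> g g1 \<Longrightarrow> germ_eq (\<gamma> 0) g g' \<Longrightarrow> germ_eq (\<gamma> 1) g1 g1' \<Longrightarrow> transport \<gamma> g' g1'"
  unfolding transport_def by (meson germ_eq_trans)

lemma square_section:
  assumes "continuous_on ({0..1} \<times> {0..1}) h" "pot_germ (h (0, 0)) g"
  obtains \<sigma> where "section_on ({0..1::real} \<times> {0..1::real}) h \<sigma>" "germ_eq (h (0, 0)) (\<sigma> (0, 0)) g"
proof -
  \<comment> \<open>\<open>k\<close> clamps the plane to the unit square, so that \<open>h\<close>
    composed with \<open>k\<close> is continuous everywhere and unchanged on the square.\<close>
  define k :: "real \<times> real \<Rightarrow> real \<times> real"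
    where "k = (\<lambda>z. (max 0 (min 1 (fst z)), max 0 (min 1 (snd z))))"
  have k: "k z = z" if "z \<in> {0..1} \<times> {0..1}" for z using that by (cases z) (auto simp: k_def)
  have "continuous_on UNIV (\<lambda>z. h (k z))"
    by (rule continuous_on_compose2[OF assms(1)]) (auto simp: k_def intro!: continuous_intros)
  from extends_square[OF this] have "\<forall>z0\<in>{0..1} \<times> {0..1}. \<forall>g. pot_germ (h (k z0)) g \<longrightarrow>
      (\<exists>\<sigma>. section_on ({0..1} \<times> {0..1}) (\<lambda>z. h (k z)) \<sigma> \<and> germ_eq (h (k z0)) (\<sigma> z0) g)"
    unfolding extends_def .
  from bspec[OF this, of "(0, 0)"] obtain \<sigma> where
    "section_on ({0..1} \<times> {0..1}) (\<lambda>z. h (k z)) \<sigma>" "germ_eq (h (0, 0)) (\<sigma> (0, 0)) g"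
    using assms(2) k[of "(0, 0)"] by auto
  moreover from section_on_pullback[OF this(1), of "{0..1} \<times> {0..1}" "\<lambda>z. z" h]
  have "section_on ({0..1} \<times> {0..1}) h \<sigma>" by (simp add: k)
  ultimately show ?thesis using that by blast
qed

text \<open>The path is read as a map of the square that is constant in the first coordinate; the
  section over the square is restricted to one edge.\<close>

lemma transport_exists:
  assumes "path \<gamma>" "pot_germ (\<gamma> 0) g"
  obtains g' where "transport \<gamma> g g'"
proof -
  have "continuous_on ({0..1} \<times> {0..1}) (\<lambda>z::real \<times> real. \<gamma> (snd z))"
    using assms(1) unfolding path_def
    by (rule continuous_on_compose2) (auto intro!: continuous_intros)
  then obtain \<sigma> where \<sigma>: "section_on ({0..1} \<times> {0..1}) (\<lambda>z::real \<times> real. \<gamma> (snd z)) \<sigma>"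
    "germ_eq (\<gamma> 0) (\<sigma> (0, 0)) g"
    using square_section[of "\<lambda>z. \<gamma> (snd z)" g] assms(2) by auto
  have "section_on {0..1} \<gamma> (\<lambda>t. \<sigma> (0, t))"
    by (rule section_on_pullback[where k = "\<lambda>t. (0, t)", OF \<sigma>(1)]) (auto intro!: continuous_intros)
  then have "transport \<gamma> g (\<sigma> (0, 1))" unfolding transport_def using \<sigma>(2) by force
  then show ?thesis by (rule that)
qed

text \<open>Continue the germ over the homotopy square. The edges \<open>s = 0\<close> and
  \<open>s = 1\<close> carry the continuations along \<open>\<gamma>\<close> and
  \<open>\<delta>\<close>; the other two edges are mapped to single points, where the germ cannot
  change.\<close>

lemma transport_homotopic:
  assumes "homotopic_paths UNIV \<gamma> \<delta>" "transport \<gamma> g g1" "transport \<delta> g g2"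
  shows "germ_eq (\<gamma> 1) g1 g2"
proof -
  obtain h :: "real \<times> real \<Rightarrow> 'm" where h: "continuous_on ({0..1} \<times> {0..1}) h"
    "\<And>t. t \<in> {0..1} \<Longrightarrow> h (0, t) = \<gamma> t" "\<And>t. t \<in> {0..1} \<Longrightarrow> h (1, t) = \<delta> t"
    "\<And>s. s \<in> {0..1} \<Longrightarrow> h (s, 0) = \<gamma> 0" "\<And>s. s \<in> {0..1} \<Longrightarrow> h (s, 1) = \<gamma> 1"
    using assms(1) unfolding homotopic_paths pathstart_def pathfinish_def o_def by blast
  have "pot_germ (h (0, 0)) g" using transport_pot_germ[OF assms(2)] h(2)[of 0] by simp
  from square_section[OF h(1) this] obtain \<sigma> where
    \<sigma>: "section_on ({0..1} \<times> {0..1}) h \<sigma>" "germ_eq (\<gamma> 0) (\<sigma> (0, 0)) g"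
    using h(2)[of 0] by auto
  \<comment> \<open>On an edge mapped to \<open>p\<close> the section is compared with the constant
    section given by a potential near \<open>p\<close>.\<close>
  have side: "germ_eq p (\<sigma> (0, t)) (\<sigma> (1, t))"
    if t: "t \<in> {0..1}" and p: "\<And>s. s \<in> {0..1} \<Longrightarrow> h (s, t) = p" for t p
  proof -
    have sec: "section_on {0..1} (\<lambda>s. p) (\<lambda>s. \<sigma> (s, t))"
      by (rule section_on_pullback[where k = "\<lambda>s. (s, t)", OF \<sigma>(1)]) (use t p in \<open>auto intro!: continuous_intros\<close>)
    from section_on_pot_germ[OF sec, of 0]
    obtain W F where F: "open W" "p \<in> W" "F \<in> Pot W" "germ_eq p (\<sigma> (0, t)) F"
      unfolding pot_germ_def by auto
    have "germ_eq p (\<sigma> (1, t)) F"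
      by (rule section_on_unique[OF connected_Icc continuous_on_const sec section_on_const[OF F(1,3)], of 0 1])
        (use F in auto)
    with F(4) show ?thesis by (meson germ_eq_sym germ_eq_trans)
  qed
  have "section_on {0..1} \<gamma> (\<lambda>t. \<sigma> (0, t))"
    by (rule section_on_pullback[where k = "\<lambda>t. (0, t)", OF \<sigma>(1)]) (auto intro!: continuous_intros simp: h)
  then have 1: "transport \<gamma> g (\<sigma> (0, 1))" unfolding transport_def using \<sigma>(2) by force
  have "section_on {0..1} \<delta> (\<lambda>t. \<sigma> (1, t))"
    by (rule section_on_pullback[where k = "\<lambda>t. (1, t)", OF \<sigma>(1)]) (auto intro!: continuous_intros simp: h)
  moreover have ends: "\<delta> 0 = \<gamma> 0" "\<delta> 1 = \<gamma> 1" using h(3)[of 0] h(3)[of 1] h(4)[of 1] h(5)[of 1] by auto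
  moreover have "germ_eq (\<gamma> 0) (\<sigma> (1, 0)) g"
    using side[of 0 "\<gamma> 0"] h(4) \<sigma>(2) by (auto intro: germ_eq_trans[OF germ_eq_sym])
  ultimately have 2: "transport \<delta> g (\<sigma> (1, 1))" unfolding transport_def by force
  have "germ_eq (\<gamma> 1) g1 (\<sigma> (0, 1))" "germ_eq (\<gamma> 1) g2 (\<sigma> (1, 1))"
    using transport_unique[OF _ assms(2) 1] transport_unique[OF _ assms(3) 2] ends
      homotopic_paths_imp_path[OF assms(1)] by auto
  moreover have "germ_eq (\<gamma> 1) (\<sigma> (0, 1)) (\<sigma> (1, 1))" using side[of 1 "\<gamma> 1"] h(5) by auto
  ultimately show ?thesis by (meson germ_eq_sym germ_eq_trans)
qed

text \<open>Instead of gluing two sections, one section over the joined path is restricted to its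
  halves, and uniqueness identifies these with the given transports.\<close>

lemma transport_join:
  assumes "path \<gamma>" "path \<delta>" "\<gamma> 1 = \<delta> 0" "transport \<gamma> g g1" "transport \<delta> g1 g2"
  shows "transport (\<gamma> +++ \<delta>) g g2"
proof -
  let ?\<epsilon> = "\<gamma> +++ \<delta>"
  have path: "path ?\<epsilon>" using assms(1-3) by (simp add: pathfinish_def pathstart_def)
  have e: "?\<epsilon> 0 = \<gamma> 0" "?\<epsilon> 1 = \<delta> 1" "?\<epsilon> (1 / 2) = \<delta> 0" using assms(3) by (auto simp: joinpaths_def)
  obtain \<sigma> where \<sigma>: "section_on {0..1} ?\<epsilon> \<sigma>" "germ_eq (\<gamma> 0) (\<sigma> 0) g"
    using transport_exists[OF path, of g] transport_pot_germ[OF assms(4)] e unfolding transport_def by metis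
  have "section_on {0..1} \<gamma> (\<lambda>t. \<sigma> (t / 2))"
    by (rule section_on_pullback[where k = "\<lambda>t. (t / 2)", OF \<sigma>(1)]) (auto intro!: continuous_intros simp: joinpaths_def)
  then have "transport \<gamma> g (\<sigma> (1 / 2))" unfolding transport_def using \<sigma>(2) by force
  from transport_unique[OF assms(1) this assms(4)] have mid: "germ_eq (\<delta> 0) (\<sigma> (1 / 2)) g1"
    using assms(3) by simp
  have "section_on {0..1} \<delta> (\<lambda>t. \<sigma> ((t + 1) / 2))"
    by (rule section_on_pullback[where k = "\<lambda>t. ((t + 1) / 2)", OF \<sigma>(1)])
      (auto intro!: continuous_intros simp: joinpaths_def assms(3) add_divide_distrib)
  then have "transport \<delta> g1 (\<sigma> 1)" unfolding transport_def using mid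
    by (intro exI[of _ "\<lambda>t. \<sigma> ((t + 1) / 2)"]) simp
  from transport_unique[OF assms(2) this assms(5)] have "germ_eq (\<delta> 1) (\<sigma> 1) g2" by simp
  then show ?thesis unfolding transport_def using \<sigma> e by metis
qed

lemma transport_reverse:
  assumes "transport \<gamma> g g'"
  shows "transport (reversepath \<gamma>) g' g"
proof -
  obtain \<sigma> where \<sigma>: "section_on {0..1} \<gamma> \<sigma>" "germ_eq (\<gamma> 0) (\<sigma> 0) g" "germ_eq (\<gamma> 1) (\<sigma> 1) g'"
    using assms unfolding transport_def by blast
  have "section_on {0..1} (reversepath \<gamma>) (\<lambda>t. \<sigma> (1 - t))"
    by (rule section_on_pullback[where k = "\<lambda>t. (1 - t)", OF \<sigma>(1)]) (auto intro!: continuous_intros simp: reversepath_def)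
  then show ?thesis unfolding transport_def using \<sigma>(2,3)
    by (intro exI[of _ "\<lambda>t. \<sigma> (1 - t)"]) (simp add: reversepath_def)
qed

lemma transport_injective:
  assumes "path \<gamma>" "transport \<gamma> g g1" "transport \<gamma> g' g1'" "germ_eq (\<gamma> 1) g1 g1'"
  shows "germ_eq (\<gamma> 0) g g'"
  using transport_unique[OF iffD2[OF path_reversepath assms(1)] transport_reverse[OF assms(2)] transport_reverse[OF assms(3)]] assms
  by (simp add: reversepath_def)

text \<open>Sections are combined pointwise; near a parameter the finitely many local potentials
  live on the intersection of their domains. The index type is that of germ classes, over which the
  barycentre will be taken.\<close>

lemma transport_affine:
  fixes C :: "('m \<Rightarrow> real) set set"
  assumes "finite C" "sum c C = 1" "\<And>i. i \<in> C \<Longrightarrow> transport \<gamma> (g i) (g' i)"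
  shows "transport \<gamma> (\<lambda>x. \<Sum>i\<in>C. c i * g i x) (\<lambda>x. \<Sum>i\<in>C. c i * g' i x)"
proof -
  have sum_germ: "germ_eq p (\<lambda>x. \<Sum>i\<in>C. c i * u i x) (\<lambda>x. \<Sum>i\<in>C. c i * v i x)"
    if "\<And>i. i \<in> C \<Longrightarrow> germ_eq p (u i) (v i)" for p u v
  proof -
    have "\<forall>\<^sub>F x in nhds p. \<forall>i\<in>C. u i x = v i x"
      using that assms(1) by (simp add: germ_eq_def eventually_ball_finite)
    then show ?thesis unfolding germ_eq_def by eventually_elim simp
  qed
  obtain \<sigma> where \<sigma>: "\<And>i. i \<in> C \<Longrightarrow> section_on {0..1} \<gamma> (\<sigma> i)"
    "\<And>i. i \<in> C \<Longrightarrow> germ_eq (\<gamma> 0) (\<sigma> i 0) (g i)" "\<And>i. i \<in> C \<Longrightarrow> germ_eq (\<gamma> 1) (\<sigma> i 1) (g' i)"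
    using assms(3) unfolding transport_def by metis
  have "section_on {0..1} \<gamma> (\<lambda>t x. \<Sum>i\<in>C. c i * \<sigma> i t x)"
    unfolding section_on_def
  proof
    fix t :: real assume t: "t \<in> {0..1}"
    have "\<forall>i\<in>C. \<exists>N W F. open N \<and> t \<in> N \<and> open W \<and> F \<in> Pot W \<and>
        (\<forall>z'\<in>N \<inter> {0..1}. \<gamma> z' \<in> W \<and> germ_eq (\<gamma> z') (\<sigma> i z') F)"
      using \<sigma>(1) t unfolding section_on_def by blast
    then obtain N W F where N: "\<And>i. i \<in> C \<Longrightarrow> open (N i) \<and> t \<in> N i \<and> open (W i) \<and> F i \<in> Pot (W i) \<and>
        (\<forall>z'\<in>N i \<inter> {0..1}. \<gamma> z' \<in> W i \<and> germ_eq (\<gamma> z') (\<sigma> i z') (F i))"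
      by metis
    show "\<exists>N W F. open N \<and> t \<in> N \<and> open W \<and> F \<in> Pot W \<and>
        (\<forall>z'\<in>N \<inter> {0..1}. \<gamma> z' \<in> W \<and> germ_eq (\<gamma> z') (\<lambda>x. \<Sum>i\<in>C. c i * \<sigma> i z' x) F)"
    proof (intro exI conjI ballI)
      show "open (\<Inter>i\<in>C. N i)" using N assms(1) by (intro open_INT) auto
      show W: "open (\<Inter>i\<in>C. W i)" using N assms(1) by (intro open_INT) auto
      show "t \<in> (\<Inter>i\<in>C. N i)" using N by blast
      show "(\<lambda>x. \<Sum>i\<in>C. c i * F i x) \<in> Pot (\<Inter>i\<in>C. W i)"
      proof (rule affine[OF W assms(1,2)])
        show "F i \<in> Pot (\<Inter>i\<in>C. W i)" if "i \<in> C" for i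
          by (rule restrict[of "F i" "W i"]) (use N W that in auto)
      qed
      fix z' assume z': "z' \<in> (\<Inter>i\<in>C. N i) \<inter> {0..1}"
      show "\<gamma> z' \<in> (\<Inter>i\<in>C. W i)" using z' N by blast
      show "germ_eq (\<gamma> z') (\<lambda>x. \<Sum>i\<in>C. c i * \<sigma> i z' x) (\<lambda>x. \<Sum>i\<in>C. c i * F i x)"
        using z' N by (intro sum_germ) blast
    qed
  qed
  moreover have "germ_eq (\<gamma> 0) (\<lambda>x. \<Sum>i\<in>C. c i * \<sigma> i 0 x) (\<lambda>x. \<Sum>i\<in>C. c i * g i x)"
    "germ_eq (\<gamma> 1) (\<lambda>x. \<Sum>i\<in>C. c i * \<sigma> i 1 x) (\<lambda>x. \<Sum>i\<in>C. c i * g' i x)"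
    by (rule sum_germ, erule \<sigma>)+
  ultimately show ?thesis
    unfolding transport_def by (intro exI[of _ "\<lambda>t x. \<Sum>i\<in>C. c i * \<sigma> i t x"] conjI)
qed

lemma transport_const:
  assumes "open U" "F \<in> Pot U" "path_image \<gamma> \<subseteq> U"
  shows "transport \<gamma> F F"
  using section_on_const[OF assms(1,2)] assms(3) unfolding transport_def path_image_def
  by (intro exI[of _ "\<lambda>t. F"]) auto

text \<open>Trivializing neighbourhoods are path-connected, so path components are open.\<close>

lemma path_between:
  assumes "connected (UNIV :: 'm set)"
  obtains \<gamma> where "path \<gamma>" "\<gamma> 0 = x" "\<gamma> 1 = (y :: 'm)"
proof -
  have "path_component UNIV x y"
  proof (rule connected_induction_simple[OF assms, of x y "path_component UNIV x"])
    fix p :: 'm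
    obtain U where U: "open U" "p \<in> U" "path_connected U" by (rule trivializing_nhd[of p])
    then have "\<forall>a\<in>U. \<forall>b\<in>U. path_component UNIV a b"
      unfolding path_connected_component by (meson path_component_of_subset subset_UNIV)
    then show "\<exists>T. openin (top_of_set UNIV) T \<and> p \<in> T \<and>
        (\<forall>a\<in>T. \<forall>b\<in>T. path_component UNIV x a \<longrightarrow> path_component UNIV x b)"
      using U by (intro exI[of _ U]) (auto intro: path_component_trans)
  qed (auto simp: path_component_refl)
  then show ?thesis
    unfolding path_component_def pathstart_def pathfinish_def using that by blast
qed

text \<open>Transport along a loop maps the orbit \<open>J\<close> into itself, because loops can be
  joined, and injectively, because they can be reversed. On a finite set it is therefore a
  permutation, which leaves the equally weighted mean fixed.\<close>

lemma invariant_germ_exists: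
  assumes "finite (carrier (fundamental_group x0))"
  obtains g where "pot_germ x0 g"
    "\<And>\<delta> g'. \<delta> \<in> loops x0 \<Longrightarrow> transport \<delta> g g' \<Longrightarrow> germ_eq x0 g g'"
proof -
  let ?R = "{(\<gamma>, \<delta>). \<gamma> \<in> loops x0 \<and> \<delta> \<in> loops x0 \<and> homotopic_paths UNIV \<gamma> \<delta>}"
  have fin: "finite (loops x0 // ?R)" using assms by (simp add: fundamental_group_def)
  obtain U g0 where g0: "open U" "x0 \<in> U" "g0 \<in> Pot U"
    by (rule trivializing_nhd[of x0]) blast
  have loop: "path \<gamma>" "\<gamma> 0 = x0" "\<gamma> 1 = x0" if "\<gamma> \<in> loops x0" for \<gamma>
    using that by (auto simp: loops_def pathstart_def pathfinish_def)
  have loop_join: "\<gamma> +++ \<delta> \<in> loops x0" if "\<gamma> \<in> loops x0" "\<delta> \<in> loops x0" for \<gamma> \<delta>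
    using that by (auto simp: loops_def)
  \<comment> \<open>The orbit is counted by germ classes: a single germ has many representing
    functions in \<open>E\<close>.\<close>
  define G where "G e = {f. germ_eq x0 e f}" for e
  have G_eq: "G e = G f \<longleftrightarrow> germ_eq x0 e f" for e f
    unfolding G_def using germ_eq_sym germ_eq_trans germ_eq_refl by blast
  define E where "E = {e. \<exists>\<gamma>\<in>loops x0. transport \<gamma> g0 e}"
  define J where "J = G ` E"
  have "finite J"
  proof -
    obtain e where e: "\<And>\<gamma>. \<gamma> \<in> loops x0 \<Longrightarrow> transport \<gamma> g0 (e \<gamma>)"
    proof -
      have "\<exists>f. transport \<gamma> g0 f" if "\<gamma> \<in> loops x0" for \<gamma>
        using transport_exists[OF loop(1)[OF that], of g0] loop(2)[OF that] g0 germ_eq_refl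
        unfolding pot_germ_def by metis
      then show ?thesis using that by metis
    qed
    \<comment> \<open>By \<open>transport_homotopic\<close> the class of the result depends on the
      homotopy class of the loop only, so one loop from each class reaches all of
      \<open>J\<close>.\<close>
    have "J \<subseteq> (\<lambda>c. G (e (SOME \<beta>. \<beta> \<in> c))) ` (loops x0 // ?R)"
    proof
      fix j assume "j \<in> J"
      then obtain f \<gamma> where f: "\<gamma> \<in> loops x0" "transport \<gamma> g0 f" "j = G f" unfolding J_def E_def by blast
      let ?c = "?R `` {\<gamma>}"
      have "\<gamma> \<in> ?c" using f(1) by (auto simp: loops_def)
      then have "(SOME \<beta>. \<beta> \<in> ?c) \<in> ?c" by (rule someI[of "\<lambda>\<beta>. \<beta> \<in> ?c"])
      then have *: "(SOME \<beta>. \<beta> \<in> ?c) \<in> loops x0" "homotopic_paths UNIV \<gamma> (SOME \<beta>. \<beta> \<in> ?c)" by auto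
      have "G f = G (e (SOME \<beta>. \<beta> \<in> ?c))"
        unfolding G_eq using transport_homotopic[OF *(2) f(2) e[OF *(1)]] loop(3)[OF f(1)] by simp
      then show "j \<in> (\<lambda>c. G (e (SOME \<beta>. \<beta> \<in> c))) ` (loops x0 // ?R)"
        unfolding f(3) by (rule image_eqI[OF _ quotientI[OF f(1)]])
    qed
    then show ?thesis using fin finite_surj by blast
  qed
  have "(\<lambda>t. x0) \<in> loops x0" by (simp add: loops_def pathstart_def pathfinish_def path_def)
  moreover from transport_const[OF g0(1,3), of "\<lambda>t. x0"] have "transport (\<lambda>t. x0) g0 g0"
    using g0(2) by (auto simp: path_image_def)
  ultimately have "J \<noteq> {}" unfolding J_def E_def by blast
  \<comment> \<open>The mean is formed of functions, so \<open>\<epsilon>\<close> selects a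
    representative of each class.\<close>
  have "\<exists>\<epsilon>. \<forall>j\<in>J. \<epsilon> j \<in> E \<and> j = G (\<epsilon> j)" unfolding J_def by (metis image_iff)
  then obtain \<epsilon> where \<epsilon>: "\<And>j. j \<in> J \<Longrightarrow> \<epsilon> j \<in> E" "\<And>j. j \<in> J \<Longrightarrow> G (\<epsilon> j) = j" by metis
  define c where "c = (\<lambda>j::('m \<Rightarrow> real) set. 1 / real (card J))"
  have c: "sum c J = 1" using \<open>finite J\<close> \<open>J \<noteq> {}\<close> by (simp add: c_def)
  define gs where "gs = (\<lambda>x. \<Sum>j\<in>J. c j * \<epsilon> j x)"
  have germ_\<epsilon>: "pot_germ x0 (\<epsilon> j)" if "j \<in> J" for j
    using \<epsilon>(1)[OF that] transport_pot_germ(2) loop(3) unfolding E_def by auto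
  have fixed: "\<exists>k. transport \<delta> gs k \<and> germ_eq x0 gs k" if \<delta>: "\<delta> \<in> loops x0" for \<delta>
  proof -
    have "\<exists>f. transport \<delta> (\<epsilon> j) f" if "j \<in> J" for j
      using transport_exists[OF loop(1)[OF \<delta>], of "\<epsilon> j"] germ_\<epsilon>[OF that] loop(2)[OF \<delta>] by metis
    then obtain k where k: "\<And>j. j \<in> J \<Longrightarrow> transport \<delta> (\<epsilon> j) (k j)" by metis
    define \<pi> where "\<pi> j = G (k j)" for j
    have \<pi>J: "\<pi> j \<in> J" if "j \<in> J" for j
    proof -
      obtain \<gamma> where \<gamma>: "\<gamma> \<in> loops x0" "transport \<gamma> g0 (\<epsilon> j)" using \<epsilon>(1)[OF \<open>j \<in> J\<close>] unfolding E_def by blast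
      have "transport (\<gamma> +++ \<delta>) g0 (k j)"
        using loop[OF \<delta>] loop[OF \<gamma>(1)] by (intro transport_join[OF _ _ _ \<gamma>(2) k[OF that]]) auto
      then show ?thesis unfolding \<pi>_def J_def E_def using loop_join[OF \<gamma>(1) \<delta>] by blast
    qed
    have "inj_on \<pi> J"
    proof (rule inj_onI)
      fix i j assume ij: "i \<in> J" "j \<in> J" "\<pi> i = \<pi> j"
      then have "germ_eq x0 (k i) (k j)" by (simp add: \<pi>_def G_eq)
      then have "germ_eq x0 (\<epsilon> i) (\<epsilon> j)"
        using transport_injective[OF loop(1)[OF \<delta>] k[OF ij(1)] k[OF ij(2)]] loop[OF \<delta>] by simp
      then show "i = j" using \<epsilon>(2) ij G_eq by metis
    qed
    moreover have "\<pi> ` J \<subseteq> J" using \<pi>J by blast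
    ultimately have "bij_betw \<pi> J J" using \<open>finite J\<close> by (simp add: bij_betw_def endo_inj_surj)
    \<comment> \<open>Equal weights make the mean insensitive to reindexing by the permutation
      \<open>\<pi>\<close>.\<close>
    then have gs: "gs = (\<lambda>x. \<Sum>j\<in>J. c j * \<epsilon> (\<pi> j) x)"
      unfolding gs_def c_def by (intro ext) (rule sum.reindex_bij_betw[symmetric])
    have k\<pi>: "germ_eq x0 (k j) (\<epsilon> (\<pi> j))" if "j \<in> J" for j
      using \<epsilon>(2)[OF \<pi>J[OF that]] by (simp add: \<pi>_def G_eq[symmetric])
    have "transport \<delta> (\<epsilon> j) (\<epsilon> (\<pi> j))" if "j \<in> J" for j
      using transport_cong[OF k[OF that]] k\<pi>[OF that] loop[OF \<delta>] by simp
    then have "transport \<delta> gs gs"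
      using transport_affine[OF \<open>finite J\<close> c, of \<delta> \<epsilon> "\<lambda>j. \<epsilon> (\<pi> j)"] gs gs_def by metis
    then show ?thesis by auto
  qed
  show ?thesis
  proof
    obtain k where "transport (\<lambda>t. x0) gs k" using fixed \<open>(\<lambda>t. x0) \<in> loops x0\<close> by blast
    then show "pot_germ x0 gs" by (rule transport_pot_germ(1))
    fix \<delta> g' assume \<delta>: "\<delta> \<in> loops x0" "transport \<delta> gs g'"
    from fixed[OF \<delta>(1)] obtain k where "transport \<delta> gs k" "germ_eq x0 gs k" by blast
    with transport_unique[OF loop(1)[OF \<delta>(1)] this(1) \<delta>(2)] loop[OF \<delta>(1)]
    show "germ_eq x0 gs g'" by (auto intro: germ_eq_trans)
  qed
qed

text \<open>Transport the invariant germ to every point along some path and take at each point the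
  value there of the germ that arrives. Two paths to the same point differ by a loop, which fixes
  the germ at \<open>x0\<close>.\<close>

theorem global_potential:
  assumes "connected (UNIV :: 'm set)" "finite (carrier (fundamental_group (x0 :: 'm)))"
  shows "Pot UNIV \<noteq> {}"
proof -
  obtain g where g: "pot_germ x0 g"
    "\<And>\<delta> g'. \<delta> \<in> loops x0 \<Longrightarrow> transport \<delta> g g' \<Longrightarrow> germ_eq x0 g g'"
    using invariant_germ_exists[OF assms(2)] by blast
  have "\<exists>\<gamma> e. path \<gamma> \<and> \<gamma> 0 = x0 \<and> \<gamma> 1 = x \<and> transport \<gamma> g e" for x
    using path_between[OF assms(1), of x0 x] transport_exists g(1) by metis
  then obtain \<gamma> e where \<gamma>: "\<And>x. path (\<gamma> x)" "\<And>x. \<gamma> x 0 = x0" "\<And>x. \<gamma> x 1 = x" "\<And>x. transport (\<gamma> x) g (e x)"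
    by metis
  \<comment> \<open>Going out along \<open>\<beta>\<close> and back along the chosen path is a loop
    and restores \<open>g\<close>; going out again along the chosen path then gives
    \<open>f\<close>.\<close>
  have indep: "germ_eq x f (e x)" if "path \<beta>" "\<beta> 0 = x0" "\<beta> 1 = x" "transport \<beta> g f" for \<beta> f x
  proof -
    have "pot_germ (reversepath (\<gamma> x) 0) f"
      using transport_pot_germ(2)[OF that(4)] that(3) by (simp add: reversepath_def \<gamma>)
    then obtain k where k: "transport (reversepath (\<gamma> x)) f k"
      using transport_exists[of "reversepath (\<gamma> x)" f] \<gamma>(1) by auto
    have rev: "path (reversepath (\<gamma> x))" "\<beta> 1 = reversepath (\<gamma> x) 0"
      using \<gamma> that by (simp, simp add: reversepath_def)
    have "transport (\<beta> +++ reversepath (\<gamma> x)) g k"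
      by (rule transport_join[OF that(1) rev that(4) k])
    moreover have "path (\<beta> +++ reversepath (\<gamma> x))"
      using that(1) rev by (intro path_join_imp) (simp_all add: pathstart_def pathfinish_def)
    then have "\<beta> +++ reversepath (\<gamma> x) \<in> loops x0"
      using that(2) \<gamma>(2)[of x]
      by (simp add: loops_def pathstart_def pathfinish_def joinpaths_def reversepath_def)
    ultimately have "germ_eq x0 g k" by (rule g(2)[rotated])
    moreover have "transport (\<gamma> x) k f" using transport_reverse[OF k] by simp
    ultimately have "germ_eq (\<gamma> x 1) (e x) f"
      using transport_unique[OF \<gamma>(1) \<gamma>(4)] \<gamma>(2) by simp
    then show ?thesis using \<gamma>(3) germ_eq_sym by simp
  qed
  have "(\<lambda>x. e x x) \<in> Pot UNIV"
  proof (rule glue[OF _ open_UNIV])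
    fix p :: 'm
    obtain U where U: "open U" "p \<in> U" "path_connected U"
      "\<And>q W g. q \<in> U \<Longrightarrow> open W \<Longrightarrow> q \<in> W \<Longrightarrow> g \<in> Pot W \<Longrightarrow> \<exists>F\<in>Pot U. germ_eq q F g"
      by (rule trivializing_nhd[of p]) blast
    obtain W F' where "open W" "p \<in> W" "F' \<in> Pot W" "germ_eq p (e p) F'"
      using transport_pot_germ(2)[OF \<gamma>(4), of p] \<gamma>(3) unfolding pot_germ_def by auto
    with U(4)[OF U(2)] obtain F where F: "F \<in> Pot U" "germ_eq p F F'" "germ_eq p (e p) F'" by blast
    have F2: "germ_eq p (e p) F" by (rule germ_eq_trans[OF F(3) germ_eq_sym[OF F(2)]])
    have tF: "transport (\<gamma> p) g F" using transport_cong[OF \<gamma>(4)] F2 \<gamma>(3) by simp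
    \<comment> \<open>Inside the trivializing set, \<open>F\<close> is its own continuation along
      any path from \<open>p\<close> to \<open>q\<close>.\<close>
    have "e q q = F q" if q: "q \<in> U" for q
    proof -
      obtain \<delta> where \<delta>: "path \<delta>" "path_image \<delta> \<subseteq> U" "\<delta> 0 = p" "\<delta> 1 = q"
        using path_connected_def[THEN iffD1, OF U(3), rule_format, OF U(2) q]
        by (auto simp: pathstart_def pathfinish_def)
      have "transport (\<gamma> p +++ \<delta>) g F"
        using \<gamma> \<delta> by (intro transport_join[OF _ _ _ tF transport_const[OF U(1) F(1)]]) auto
      then have "germ_eq q F (e q)"
      proof (rule indep[rotated 3])
        show "path (\<gamma> p +++ \<delta>)"
          using \<gamma>(1,3) \<delta> by (intro path_join_imp) (simp_all add: pathstart_def pathfinish_def)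
      qed (use \<gamma>(2) \<delta> in \<open>simp_all add: joinpaths_def\<close>)
      then show ?thesis by (metis germ_eq_value)
    qed
    then show "\<exists>W' F. open W' \<and> p \<in> W' \<and> F \<in> Pot W' \<and> (\<forall>q\<in>W'. e q q = F q)"
      using U(1,2) F(1) by blast
  qed
  then show ?thesis by blast
qed

end

section \<open>Functions and tangent vectors in a chart\<close>

locale manifold_basis = smooth_manifold A + finite_basis B
  for A :: "('m::{t2_space, second_countable_topology}, 'e::real_inner) chart set" and B :: "'e set"
begin

lemma chart_exists: obtains V \<phi> where "(V, \<phi>) \<in> A" "p \<in> V"
proof -
  have "p \<in> (\<Union>(U, \<phi>)\<in>A. U)" using covering by simp
  then show ?thesis using that by auto
qed

lemma chart_facts:
  assumes "(V, \<phi>) \<in> A"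
  shows "open V" "open (\<phi> ` V)" "continuous_on V \<phi>" "continuous_on (\<phi> ` V) (inv_into V \<phi>)"
    "inj_on \<phi> V" "\<And>x. x \<in> V \<Longrightarrow> inv_into V \<phi> (\<phi> x) = x"
proof -
  have *: "open V" "open (\<phi> ` V)" "homeomorphism V (\<phi> ` V) \<phi> (inv_into V \<phi>)"
    using charts[OF assms] by (auto simp: is_chart_def)
  then show "open V" "open (\<phi> ` V)" "continuous_on V \<phi>" "continuous_on (\<phi> ` V) (inv_into V \<phi>)"
    "\<And>x. x \<in> V \<Longrightarrow> inv_into V \<phi> (\<phi> x) = x"
    by (auto simp: homeomorphism_def)
  then show "inj_on \<phi> V" by (metis inj_on_def)
qed

lemma chart_image:
  assumes "(V, \<phi>) \<in> A" "U \<subseteq> V"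
  shows "x \<in> \<phi> ` U \<longleftrightarrow> x \<in> \<phi> ` V \<and> inv_into V \<phi> x \<in> U"
  using chart_facts(6)[OF assms(1)] assms(2) by force

lemma open_chart_image:
  assumes "(V, \<phi>) \<in> A" "open U"
  shows "open (\<phi> ` (U \<inter> V))"
proof -
  have "\<phi> ` (U \<inter> V) = \<phi> ` V \<inter> inv_into V \<phi> -` U"
    using chart_image[OF assms(1), of "U \<inter> V"] chart_facts(6)[OF assms(1)] by auto
  then show ?thesis
    using continuous_open_preimage chart_facts(2,4)[OF assms(1)] assms(2) by metis
qed

lemma open_chart_preimage:
  assumes "(V, \<phi>) \<in> A" "open S"
  shows "open {p \<in> V. \<phi> p \<in> S}"
proof -
  have "{p \<in> V. \<phi> p \<in> S} = V \<inter> \<phi> -` S" by auto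
  then show ?thesis using continuous_open_preimage chart_facts(1,3)[OF assms(1)] assms(2) by metis
qed

lemma C_infinity_chart_smooth:
  "f \<in> C_infinity A U \<Longrightarrow> (V, \<phi>) \<in> A \<Longrightarrow> smooth_on (\<phi> ` (U \<inter> V)) (\<lambda>x. f (inv_into V \<phi> x))"
  by (auto simp: C_infinity_def o_def)

lemma C_infinity_subset: "f \<in> C_infinity A U \<Longrightarrow> W \<subseteq> U \<Longrightarrow> f \<in> C_infinity A W"
  unfolding C_infinity_def by (fastforce intro: smooth_on_subset)

lemma C_infinity_local:
  assumes "\<And>p. p \<in> U \<Longrightarrow> \<exists>W. open W \<and> p \<in> W \<and> f \<in> C_infinity A W"
  shows "f \<in> C_infinity A U"
  unfolding C_infinity_def
proof clarify
  fix V \<phi> assume c: "(V, \<phi>) \<in> A"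
  show "smooth_on (\<phi> ` (U \<inter> V)) (f \<circ> inv_into V \<phi>)"
  proof (rule smooth_on_local)
    fix x assume "x \<in> \<phi> ` (U \<inter> V)"
    then obtain p where p: "p \<in> U" "p \<in> V" "x = \<phi> p" by blast
    obtain W where W: "open W" "p \<in> W" "f \<in> C_infinity A W" using assms[OF p(1)] by blast
    show "\<exists>T. open T \<and> x \<in> T \<and> smooth_on T (f \<circ> inv_into V \<phi>)"
      using open_chart_image[OF c W(1)] C_infinity_chart_smooth[OF W(3) c] p W(2)
      by (intro exI[of _ "\<phi> ` (W \<inter> V)"]) (auto simp: o_def)
  qed
qed

lemma C_infinity_cong:
  assumes "open U" "f \<in> C_infinity A U" "\<And>p. p \<in> U \<Longrightarrow> f p = g p"
  shows "g \<in> C_infinity A U"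
  unfolding C_infinity_def
proof clarify
  fix V \<phi> assume c: "(V, \<phi>) \<in> A"
  show "smooth_on (\<phi> ` (U \<inter> V)) (g \<circ> inv_into V \<phi>)"
    by (rule smooth_on_cong[OF open_chart_image[OF c assms(1)] C_infinity_chart_smooth[OF assms(2) c]])
      (use assms(3) chart_facts(6)[OF c] in auto)
qed

lemma C_infinity_const: "open U \<Longrightarrow> (\<lambda>p. c) \<in> C_infinity A U"
  by (auto simp: C_infinity_def o_def intro!: smooth_on_const open_chart_image)

lemma C_infinity_add:
  "open U \<Longrightarrow> f \<in> C_infinity A U \<Longrightarrow> g \<in> C_infinity A U \<Longrightarrow> (\<lambda>p. f p + g p) \<in> C_infinity A U"
  by (auto simp: C_infinity_def o_def intro!: smooth_on_add open_chart_image)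

lemma C_infinity_mult:
  "open U \<Longrightarrow> f \<in> C_infinity A U \<Longrightarrow> g \<in> C_infinity A U \<Longrightarrow> (\<lambda>p. f p * g p) \<in> C_infinity A U"
  by (auto simp: C_infinity_def o_def intro!: smooth_on_mult open_chart_image)

lemma C_infinity_sum:
  "open U \<Longrightarrow> (\<And>i. i \<in> I \<Longrightarrow> f i \<in> C_infinity A U) \<Longrightarrow> (\<lambda>p. \<Sum>i\<in>I. f i p) \<in> C_infinity A U"
  by (induction I rule: infinite_finite_induct) (auto intro: C_infinity_add C_infinity_const)

text \<open>Smoothness has to be tested in all charts; the transition maps transfer it from the
  single chart \<open>\<phi>\<close>.\<close>

lemma C_infinity_chart:
  assumes c: "(V, \<phi>) \<in> A" and U: "open U" "U \<subseteq> V" and g: "smooth_on (\<phi> ` U) g"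
  shows "(\<lambda>p. g (\<phi> p)) \<in> C_infinity A U"
  unfolding C_infinity_def
proof clarify
  fix V' \<phi>' assume c': "(V', \<phi>') \<in> A"
  have "open (\<phi> ` U)" using open_chart_image[OF c U(1)] U(2) by (simp add: Int_absorb2)
  moreover have "smooth_on (\<phi>' ` (U \<inter> V')) (\<lambda>x. \<phi> (inv_into V' \<phi>' x))"
    using compatible[OF c' c] U(2) by (auto simp: o_def elim!: smooth_on_subset)
  moreover have "(\<lambda>x. \<phi> (inv_into V' \<phi>' x)) ` (\<phi>' ` (U \<inter> V')) \<subseteq> \<phi> ` U"
    using chart_facts(6)[OF c'] by auto
  ultimately show "smooth_on (\<phi>' ` (U \<inter> V')) ((\<lambda>p. g (\<phi> p)) \<circ> inv_into V' \<phi>')"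
    unfolding o_def using smooth_on_compose[OF open_chart_image[OF c' U(1)] _ _ _ g] by blast
qed

lemma C_infinity_coordinate:
  assumes "(V, \<phi>) \<in> A"
  shows "(\<lambda>p. \<phi> p \<bullet> b) \<in> C_infinity A V"
  using chart_facts[OF assms] by (intro C_infinity_chart[OF assms] smooth_on_linear bounded_linear_inner_left) auto

lemma smooth_nearI: "open U \<Longrightarrow> p \<in> U \<Longrightarrow> f \<in> C_infinity A U \<Longrightarrow> smooth_near A p f"
  unfolding smooth_near_def by blast

lemma smooth_near_common:
  assumes "smooth_near A p f" "smooth_near A p g"
  obtains U where "open U" "p \<in> U" "f \<in> C_infinity A U" "g \<in> C_infinity A U"
proof -
  obtain U W where *: "open U" "p \<in> U" "f \<in> C_infinity A U" "open W" "p \<in> W" "g \<in> C_infinity A W"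
    using assms unfolding smooth_near_def by blast
  show ?thesis
    by (rule that[of "U \<inter> W"]) (use * in \<open>auto intro: C_infinity_subset\<close>)
qed

lemma smooth_near_const: "smooth_near A p (\<lambda>q. c)"
  by (rule smooth_nearI[of UNIV]) (auto intro: C_infinity_const)

lemma smooth_near_add: "smooth_near A p f \<Longrightarrow> smooth_near A p g \<Longrightarrow> smooth_near A p (\<lambda>q. f q + g q)"
  by (erule (1) smooth_near_common) (blast intro: smooth_nearI C_infinity_add)

lemma smooth_near_mult: "smooth_near A p f \<Longrightarrow> smooth_near A p g \<Longrightarrow> smooth_near A p (\<lambda>q. f q * g q)"
  by (erule (1) smooth_near_common) (blast intro: smooth_nearI C_infinity_mult)

lemma smooth_near_sum:
  "(\<And>i. i \<in> I \<Longrightarrow> smooth_near A p (f i)) \<Longrightarrow> smooth_near A p (\<lambda>q. \<Sum>i\<in>I. f i q)"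
  by (induction I rule: infinite_finite_induct) (auto intro: smooth_near_add smooth_near_const)

lemma smooth_near_germ:
  assumes "smooth_near A p f" "germ_eq p f g"
  shows "smooth_near A p g"
proof -
  obtain U where U: "open U" "p \<in> U" "f \<in> C_infinity A U" using assms(1) unfolding smooth_near_def by blast
  obtain W where W: "open W" "p \<in> W" "\<And>x. x \<in> W \<Longrightarrow> f x = g x" using assms(2) by (metis germ_eqE)
  show ?thesis
    by (rule smooth_nearI[of "U \<inter> W"])
      (use U W in \<open>auto intro: C_infinity_cong[OF _ C_infinity_subset]\<close>)
qed

section \<open>Tangent vectors as derivations\<close>

context
  fixes v :: "'m tangent_vector" and p :: 'm
  assumes v: "v \<in> tangent_space A p"
begin

lemma tv_add_fun: "smooth_near A p f \<Longrightarrow> smooth_near A p g \<Longrightarrow> v (\<lambda>q. f q + g q) = v f + v g"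
  using v by (simp add: tangent_space_def)

lemma tv_cmult: "smooth_near A p f \<Longrightarrow> v (\<lambda>q. a * f q) = a * v f"
  using v by (simp add: tangent_space_def)

lemma tv_mult: "smooth_near A p f \<Longrightarrow> smooth_near A p g \<Longrightarrow> v (\<lambda>q. f q * g q) = f p * v g + v f * g p"
  using v by (simp add: tangent_space_def)

lemma tv_germ: "smooth_near A p f \<Longrightarrow> germ_eq p f g \<Longrightarrow> v f = v g"
  using v unfolding tangent_space_def germ_eq_def by blast

lemma tv_not_smooth: "\<not> smooth_near A p f \<Longrightarrow> v f = 0"
  using v by (simp add: tangent_space_def)

lemma tv_const: "v (\<lambda>q. c) = 0"
proof -
  have "v (\<lambda>q. 1 * 1) = 1 * v (\<lambda>q. 1) + v (\<lambda>q. 1) * 1"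
    by (rule tv_mult) (rule smooth_near_const)+
  then have "v (\<lambda>q. 1) = 0" by simp
  with tv_cmult[OF smooth_near_const, of c 1] show ?thesis by simp
qed

lemma tv_sum:
  "finite I \<Longrightarrow> (\<And>i. i \<in> I \<Longrightarrow> smooth_near A p (f i)) \<Longrightarrow> v (\<lambda>q. \<Sum>i\<in>I. f i q) = (\<Sum>i\<in>I. v (f i))"
proof (induction I rule: finite_induct)
  case (insert i I)
  then have "v (\<lambda>q. f i q + (\<Sum>i\<in>I. f i q)) = v (f i) + v (\<lambda>q. \<Sum>i\<in>I. f i q)"
    by (intro tv_add_fun smooth_near_sum) auto
  then show ?case using insert by simp
qed (simp add: tv_const)

end

lemma tangent_space_scale:
  assumes v: "v \<in> tangent_space A p"
  shows "tv_scale a v \<in> tangent_space A p"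
  unfolding tangent_space_def tv_scale_def mem_Collect_eq
  using tv_add_fun[OF v] tv_cmult[OF v] tv_mult[OF v] tv_germ[OF v, unfolded germ_eq_def] tv_not_smooth[OF v]
  by (auto simp: algebra_simps)

lemma tangent_space_add:
  assumes v: "v \<in> tangent_space A p" and w: "w \<in> tangent_space A p"
  shows "tv_add v w \<in> tangent_space A p"
  unfolding tangent_space_def tv_add_def mem_Collect_eq
  using tv_add_fun[OF v] tv_cmult[OF v] tv_mult[OF v] tv_germ[OF v, unfolded germ_eq_def] tv_not_smooth[OF v]
    tv_add_fun[OF w] tv_cmult[OF w] tv_mult[OF w] tv_germ[OF w, unfolded germ_eq_def] tv_not_smooth[OF w]
  by (auto simp: algebra_simps)

lemma tangent_space_zero: "(\<lambda>f. 0) \<in> tangent_space A p"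
  by (simp add: tangent_space_def)

text \<open>The value 0 on functions that are not smooth near \<open>p\<close> follows the
  convention of \<open>tangent_space\<close>.\<close>

definition partial :: "'m set \<Rightarrow> ('m \<Rightarrow> 'e) \<Rightarrow> 'e \<Rightarrow> 'm vector_field" where
  "partial V \<phi> b p f =
     (if smooth_near A p f then dir_deriv b (\<lambda>x. f (inv_into V \<phi> x)) (\<phi> p) else 0)"

lemma chart_expr_derivative:
  assumes c: "(V, \<phi>) \<in> A" "p \<in> V" and f: "smooth_near A p f"
  shows "((\<lambda>x. f (inv_into V \<phi> x)) has_derivative (\<lambda>v. dir_deriv v (\<lambda>x. f (inv_into V \<phi> x)) (\<phi> p)))
    (at (\<phi> p))"
proof -
  obtain U where "open U" "p \<in> U" "f \<in> C_infinity A U" using f unfolding smooth_near_def by blast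
  then show ?thesis
    using smooth_on_has_derivative[OF C_infinity_chart_smooth[OF _ c(1)]] c(2) by blast
qed

lemma dir_deriv_germ:
  assumes c: "(V, \<phi>) \<in> A" "p \<in> V" and f: "smooth_near A p f" and g: "germ_eq p f g"
  shows "dir_deriv b (\<lambda>x. f (inv_into V \<phi> x)) (\<phi> p) = dir_deriv b (\<lambda>x. g (inv_into V \<phi> x)) (\<phi> p)"
proof -
  obtain W where W: "open W" "p \<in> W" "\<And>x. x \<in> W \<Longrightarrow> f x = g x" using g by (metis germ_eqE)
  have "((\<lambda>x. g (inv_into V \<phi> x)) has_derivative (\<lambda>v. dir_deriv v (\<lambda>x. f (inv_into V \<phi> x)) (\<phi> p)))
      (at (\<phi> p))"
    by (rule has_derivative_transform_within_open[OF chart_expr_derivative[OF c f] open_chart_image[OF c(1) W(1)]])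
      (use W c chart_facts(6)[OF c(1)] in auto)
  from dir_derivI[OF this] show ?thesis by simp
qed

lemma partial_tangent:
  assumes c: "(V, \<phi>) \<in> A" "p \<in> V"
  shows "partial V \<phi> b p \<in> tangent_space A p"
proof -
  note d = chart_expr_derivative[OF c]
  note inv = chart_facts(6)[OF c(1) c(2)]
  show ?thesis
    unfolding tangent_space_def mem_Collect_eq
  proof (intro conjI allI impI)
    fix f g :: "'m \<Rightarrow> real" and a :: real
    assume f: "smooth_near A p f"
    show "partial V \<phi> b p (\<lambda>q. a * f q) = a * partial V \<phi> b p f"
      using f dir_derivI[OF has_derivative_mult_right[OF d[OF f], of a], of b] smooth_near_mult[OF smooth_near_const f]
      by (simp add: partial_def)
    show "partial V \<phi> b p f = partial V \<phi> b p g" if "\<forall>\<^sub>F q in nhds p. f q = g q"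
    proof -
      have "germ_eq p f g" using that by (simp add: germ_eq_def)
      then show ?thesis using f smooth_near_germ dir_deriv_germ[OF c f] by (simp add: partial_def)
    qed
    assume g: "smooth_near A p g"
    show "partial V \<phi> b p (\<lambda>q. f q + g q) = partial V \<phi> b p f + partial V \<phi> b p g"
      using f g dir_derivI[OF has_derivative_add[OF d[OF f] d[OF g]], of b] smooth_near_add
      by (simp add: partial_def)
    show "partial V \<phi> b p (\<lambda>q. f q * g q) = f p * partial V \<phi> b p g + partial V \<phi> b p f * g p"
      using f g dir_derivI[OF has_derivative_mult[OF d[OF f] d[OF g]], of b] smooth_near_mult inv
      by (simp add: partial_def)
  qed (simp add: partial_def)
qed

text \<open>Hadamard's lemma writes \<open>f\<close> near \<open>p\<close> as a constant plus
  products of coordinate differences with smooth functions \<open>g b\<close>. The differences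
  vanish at \<open>p\<close>, so the product rule keeps only the values of \<open>g b\<close>
  there.\<close>

lemma tangent_vector_expand:
  assumes c: "(V, \<phi>) \<in> A" "p \<in> V" and v: "v \<in> tangent_space A p" and f: "smooth_near A p f"
  shows "v f = (\<Sum>b\<in>B. v (\<lambda>q. \<phi> q \<bullet> b) * partial V \<phi> b p f)"
proof -
  obtain U where U: "open U" "p \<in> U" "f \<in> C_infinity A U" using f unfolding smooth_near_def by blast
  obtain r where r: "r > 0" "ball (\<phi> p) r \<subseteq> \<phi> ` (U \<inter> V)"
    using open_chart_image[OF c(1) U(1)] U(2) c(2) by (meson IntI image_eqI openE)
  define S where "S = ball (\<phi> p) r"
  have S: "open S" "convex S" "\<phi> p \<in> S" using r by (auto simp: S_def)
  let ?F = "\<lambda>x. f (inv_into V \<phi> x)"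
  have F: "smooth_on S ?F"
    using C_infinity_chart_smooth[OF U(3) c(1)] r(2) unfolding S_def by (rule smooth_on_subset)
  define W where "W = {q \<in> V. \<phi> q \<in> S}"
  have W: "open W" "p \<in> W" "W \<subseteq> V" "\<phi> ` W \<subseteq> S"
    using open_chart_preimage[OF c(1) S(1)] c(2) S(3) by (auto simp: W_def)
  define g where "g b = ray_integral 0 (\<phi> p) (dir_deriv b ?F)" for b
  have g: "smooth_on S (g b)" for b
    unfolding g_def by (intro smooth_on_ray_integral S smooth_on_dir_deriv F)
  have g\<phi>: "smooth_near A p (\<lambda>q. g b (\<phi> q))" for b
    using smooth_on_subset[OF g W(4)] by (intro smooth_nearI[OF W(1,2)] C_infinity_chart[OF c(1) W(1,3)])
  have x: "smooth_near A p (\<lambda>q. \<phi> q \<bullet> b)" for b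
    using smooth_nearI[OF chart_facts(1)[OF c(1)] c(2) C_infinity_coordinate[OF c(1)]] .
  have x': "smooth_near A p (\<lambda>q. \<phi> q \<bullet> b + - (\<phi> p \<bullet> b))" for b
    by (intro smooth_near_add x smooth_near_const)
  have "germ_eq p f (\<lambda>q. f p + (\<Sum>b\<in>B. (\<phi> q \<bullet> b + - (\<phi> p \<bullet> b)) * g b (\<phi> q)))"
  proof (rule germ_eq_open[OF W(1,2)])
    fix q assume "q \<in> W"
    then have q: "q \<in> V" "\<phi> q \<in> S" by (auto simp: W_def)
    from hadamard[OF S F q(2)] show "f q = f p + (\<Sum>b\<in>B. (\<phi> q \<bullet> b + - (\<phi> p \<bullet> b)) * g b (\<phi> q))"
      using q c(2) chart_facts(6)[OF c(1)] by (simp add: g_def inner_diff_left)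
  qed
  from tv_germ[OF v f this]
  have "v f = v (\<lambda>q. f p + (\<Sum>b\<in>B. (\<phi> q \<bullet> b + - (\<phi> p \<bullet> b)) * g b (\<phi> q)))" .
  also have "\<dots> = v (\<lambda>q. f p) + v (\<lambda>q. \<Sum>b\<in>B. (\<phi> q \<bullet> b + - (\<phi> p \<bullet> b)) * g b (\<phi> q))"
    by (intro tv_add_fun[OF v] smooth_near_const smooth_near_sum smooth_near_mult x' g\<phi>)
  also have "\<dots> = (\<Sum>b\<in>B. v (\<lambda>q. (\<phi> q \<bullet> b + - (\<phi> p \<bullet> b)) * g b (\<phi> q)))"
    by (simp only: tv_const[OF v] tv_sum[OF v finite_B smooth_near_mult[OF x' g\<phi>]] add_0)
  also have "\<dots> = (\<Sum>b\<in>B. v (\<lambda>q. \<phi> q \<bullet> b) * partial V \<phi> b p f)"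
  proof (rule sum.cong[OF refl])
    fix b
    have "v (\<lambda>q. (\<phi> q \<bullet> b + - (\<phi> p \<bullet> b)) * g b (\<phi> q)) =
        v (\<lambda>q. \<phi> q \<bullet> b + - (\<phi> p \<bullet> b)) * g b (\<phi> p)"
      using tv_mult[OF v x' g\<phi>] by simp
    also have "v (\<lambda>q. \<phi> q \<bullet> b + - (\<phi> p \<bullet> b)) = v (\<lambda>q. \<phi> q \<bullet> b)"
      by (simp only: tv_add_fun[OF v x smooth_near_const] tv_const[OF v] add_0_right)
    \<comment> \<open>At the centre of the rays the integrand is constant, so the integral is the
      partial derivative itself.\<close>
    also have "g b (\<phi> p) = partial V \<phi> b p f"
      using f by (simp add: g_def ray_integral_def partial_def)
    finally show "v (\<lambda>q. (\<phi> q \<bullet> b + - (\<phi> p \<bullet> b)) * g b (\<phi> q)) = v (\<lambda>q. \<phi> q \<bullet> b) * partial V \<phi> b p f" .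
  qed
  finally show ?thesis .
qed

section \<open>Smooth vector fields and their finite combinations\<close>

lemma vector_field_tangent: "X \<in> smooth_vector_fields A \<Longrightarrow> X p \<in> tangent_space A p"
  by (simp add: smooth_vector_fields_def)

lemma vector_field_smooth:
  "X \<in> smooth_vector_fields A \<Longrightarrow> open U \<Longrightarrow> f \<in> C_infinity A U \<Longrightarrow> (\<lambda>p. X p f) \<in> C_infinity A U"
  by (simp add: smooth_vector_fields_def)

lemma vector_field_smooth_near:
  "X \<in> smooth_vector_fields A \<Longrightarrow> smooth_near A p f \<Longrightarrow> smooth_near A p (\<lambda>q. X q f)"
  unfolding smooth_near_def using vector_field_smooth by blast

lemma vf_zero: "(\<lambda>p f. 0) \<in> smooth_vector_fields A"
  by (simp add: smooth_vector_fields_def tangent_space_zero C_infinity_const)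

lemma vf_add_smooth:
  "X \<in> smooth_vector_fields A \<Longrightarrow> Y \<in> smooth_vector_fields A \<Longrightarrow> vf_add X Y \<in> smooth_vector_fields A"
  unfolding smooth_vector_fields_def vf_add_def
  by (auto intro: tangent_space_add) (auto simp: tv_add_def intro: C_infinity_add)

lemma vf_scale_smooth:
  "u \<in> C_infinity A UNIV \<Longrightarrow> X \<in> smooth_vector_fields A \<Longrightarrow> vf_scale u X \<in> smooth_vector_fields A"
  unfolding smooth_vector_fields_def vf_scale_def
  by (auto intro: tangent_space_scale)
    (auto simp: tv_scale_def intro!: C_infinity_mult elim: C_infinity_subset)

text \<open>The recursion in \<open>vf_comb_insert\<close> carries the connection axioms, stated for
  two fields, over to finite sums.\<close>

definition vf_comb :: "'e set \<Rightarrow> ('e \<Rightarrow> 'm \<Rightarrow> real) \<Rightarrow> ('e \<Rightarrow> 'm vector_field) \<Rightarrow> 'm vector_field" where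
  "vf_comb F c Z = (\<lambda>p f. \<Sum>b\<in>F. c b p * Z b p f)"

lemma vf_comb_empty: "vf_comb {} c Z = (\<lambda>p f. 0)"
  by (simp add: vf_comb_def)

lemma vf_comb_insert:
  "finite F \<Longrightarrow> b \<notin> F \<Longrightarrow> vf_comb (insert b F) c Z = vf_add (vf_scale (c b) (Z b)) (vf_comb F c Z)"
  by (simp add: vf_comb_def vf_add_def vf_scale_def tv_add_def tv_scale_def)

lemma vf_comb_smooth:
  "finite F \<Longrightarrow> (\<And>b. b \<in> F \<Longrightarrow> c b \<in> C_infinity A UNIV) \<Longrightarrow> (\<And>b. b \<in> F \<Longrightarrow> Z b \<in> smooth_vector_fields A) \<Longrightarrow>
    vf_comb F c Z \<in> smooth_vector_fields A"
  by (induction F rule: finite_induct)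
    (auto simp: vf_comb_empty vf_comb_insert vf_zero intro: vf_add_smooth vf_scale_smooth)

end

section \<open>The Hessian\<close>

locale affine_manifold_basis = affine_manifold A D + manifold_basis A B
  for A :: "('m::{t2_space, second_countable_topology}, 'e::real_inner) chart set"
    and D :: "'m connection" and B :: "'e set"
begin

abbreviation "VF \<equiv> smooth_vector_fields A"

text \<open>The covariant derivative of \<open>du\<close> with the one-form eliminated, so that it
  can be treated as an operator on \<open>u\<close>.\<close>

definition hess :: "('m \<Rightarrow> real) \<Rightarrow> 'm vector_field \<Rightarrow> 'm vector_field \<Rightarrow> 'm \<Rightarrow> real" where
  "hess u X Y p = X p (\<lambda>q. Y q u) - D X Y p u"

lemma equals_hessian_on_iff:
  "equals_hessian_on A D h U f \<longleftrightarrow> (\<forall>X\<in>VF. \<forall>Y\<in>VF. \<forall>p\<in>U. h p (X p) (Y p) = hess f X Y p)"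
  by (simp add: equals_hessian_on_def covariant_derivative_def differential_def hess_def)

lemma D_smooth: "X \<in> VF \<Longrightarrow> Y \<in> VF \<Longrightarrow> D X Y \<in> VF"
  using connection by (simp add: is_connection_def)

lemma D_add_left: "X \<in> VF \<Longrightarrow> Y \<in> VF \<Longrightarrow> Z \<in> VF \<Longrightarrow> D (vf_add X Y) Z p f = D X Z p f + D Y Z p f"
  using connection by (simp add: is_connection_def vf_add_def tv_add_def)

lemma D_add_right: "X \<in> VF \<Longrightarrow> Y \<in> VF \<Longrightarrow> Z \<in> VF \<Longrightarrow> D X (vf_add Y Z) p f = D X Y p f + D X Z p f"
  using connection by (simp add: is_connection_def vf_add_def tv_add_def)

lemma D_scale_left:
  "u \<in> C_infinity A UNIV \<Longrightarrow> X \<in> VF \<Longrightarrow> Y \<in> VF \<Longrightarrow> D (vf_scale u X) Y p f = u p * D X Y p f"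
  using connection by (simp add: is_connection_def vf_scale_def tv_scale_def)

lemma D_scale_right:
  "u \<in> C_infinity A UNIV \<Longrightarrow> X \<in> VF \<Longrightarrow> Y \<in> VF \<Longrightarrow>
    D X (vf_scale u Y) p f = u p * D X Y p f + X p u * Y p f"
  using connection by (simp add: is_connection_def vf_scale_def tv_scale_def vf_add_def tv_add_def)

lemma vf_scale_zero: "vf_scale (\<lambda>p. 0) (\<lambda>p f. 0) = (\<lambda>p f. 0)"
  by (simp add: vf_scale_def tv_scale_def)

lemma D_zero_left: "Y \<in> VF \<Longrightarrow> D (\<lambda>p f. 0) Y p f = 0"
  using D_scale_left[OF C_infinity_const[OF open_UNIV] vf_zero, of Y 0 p f] by (simp add: vf_scale_zero)

lemma D_zero_right: "X \<in> VF \<Longrightarrow> D X (\<lambda>p f. 0) p f = 0"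
  using D_scale_right[OF C_infinity_const[OF open_UNIV] _ vf_zero, of X 0 p f] by (simp add: vf_scale_zero)

lemma D_comb_left:
  assumes "finite F" "\<And>b. b \<in> F \<Longrightarrow> c b \<in> C_infinity A UNIV" "\<And>b. b \<in> F \<Longrightarrow> Z b \<in> VF" "Y \<in> VF"
  shows "D (vf_comb F c Z) Y p f = (\<Sum>b\<in>F. c b p * D (Z b) Y p f)"
  using assms
  by (induction F rule: finite_induct)
    (simp_all add: vf_comb_empty D_zero_left vf_comb_insert D_add_left D_scale_left vf_scale_smooth vf_comb_smooth)

lemma D_comb_right:
  assumes "finite F" "\<And>b. b \<in> F \<Longrightarrow> c b \<in> C_infinity A UNIV" "\<And>b. b \<in> F \<Longrightarrow> Z b \<in> VF" "X \<in> VF"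
  shows "D X (vf_comb F c Z) p f = (\<Sum>b\<in>F. c b p * D X (Z b) p f + X p (c b) * Z b p f)"
  using assms
  by (induction F rule: finite_induct)
    (simp_all add: vf_comb_empty D_zero_right vf_comb_insert D_add_right D_scale_right vf_scale_smooth vf_comb_smooth)

text \<open>Torsion-freeness makes the bracket a difference of covariant derivatives, whose
  smoothness is an axiom.\<close>

lemma lie_bracket_smooth:
  assumes "X \<in> VF" "Y \<in> VF"
  shows "lie_bracket A X Y \<in> VF"
proof -
  have "lie_bracket A X Y = vf_diff (D X Y) (D Y X)"
    using torsion_free assms unfolding torsion_free_def by simp
  also have "\<dots> = vf_add (D X Y) (vf_scale (\<lambda>p. - 1) (D Y X))"
    by (simp add: vf_diff_def vf_add_def vf_scale_def)
  also have "\<dots> \<in> VF"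
    by (intro vf_add_smooth vf_scale_smooth D_smooth C_infinity_const assms open_UNIV)
  finally show ?thesis .
qed

lemma hess_scale_left:
  "c \<in> C_infinity A UNIV \<Longrightarrow> X \<in> VF \<Longrightarrow> Y \<in> VF \<Longrightarrow> hess u (vf_scale c X) Y p = c p * hess u X Y p"
  by (simp add: hess_def D_scale_left right_diff_distrib) (simp add: vf_scale_def tv_scale_def)

text \<open>The terms \<open>X p c * Y p u\<close> from the product rule and from the connection
  axiom cancel, so the Hessian is tensorial in its second slot. Smoothness of \<open>u\<close> near
  \<open>p\<close> enters through the product rule.\<close>

lemma hess_scale_right:
  assumes "c \<in> C_infinity A UNIV" "X \<in> VF" "Y \<in> VF" "smooth_near A p u"
  shows "hess u X (vf_scale c Y) p = c p * hess u X Y p"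
proof -
  have "X p (\<lambda>q. vf_scale c Y q u) = c p * X p (\<lambda>q. Y q u) + X p c * Y p u"
    unfolding vf_scale_def tv_scale_def
    by (rule tv_mult[OF vector_field_tangent[OF assms(2)] smooth_nearI[OF open_UNIV UNIV_I assms(1)]
          vector_field_smooth_near[OF assms(3,4)]])
  then show ?thesis using assms by (simp add: hess_def D_scale_right algebra_simps)
qed

lemma hess_comb_left:
  assumes "finite F" "\<And>b. b \<in> F \<Longrightarrow> c b \<in> C_infinity A UNIV" "\<And>b. b \<in> F \<Longrightarrow> Z b \<in> VF" "Y \<in> VF"
  shows "hess u (vf_comb F c Z) Y p = (\<Sum>b\<in>F. c b p * hess u (Z b) Y p)"
proof -
  have "D (vf_comb F c Z) Y p u = (\<Sum>b\<in>F. c b p * D (Z b) Y p u)"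
    by (rule D_comb_left) (use assms in auto)
  then show ?thesis
    unfolding hess_def by (simp add: right_diff_distrib sum_subtractf) (simp add: vf_comb_def)
qed

lemma hess_comb_right:
  assumes "finite F" "\<And>b. b \<in> F \<Longrightarrow> c b \<in> C_infinity A UNIV" "\<And>b. b \<in> F \<Longrightarrow> Z b \<in> VF" "X \<in> VF"
    and u: "smooth_near A p u"
  shows "hess u X (vf_comb F c Z) p = (\<Sum>b\<in>F. c b p * hess u X (Z b) p)"
proof -
  note tX = vector_field_tangent[OF assms(4), of p]
  have c: "smooth_near A p (c b)" if "b \<in> F" for b
    using assms(2)[OF that] by (intro smooth_nearI[of UNIV]) auto
  have Z: "smooth_near A p (\<lambda>q. Z b q u)" if "b \<in> F" for b
    using vector_field_smooth_near[OF assms(3)[OF that] u] .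
  have "X p (\<lambda>q. vf_comb F c Z q u) = (\<Sum>b\<in>F. c b p * X p (\<lambda>q. Z b q u) + X p (c b) * Z b p u)"
    unfolding vf_comb_def
    by (subst tv_sum[OF tX assms(1)]) (auto intro!: smooth_near_mult c Z sum.cong tv_mult[OF tX])
  moreover have "D X (vf_comb F c Z) p u = (\<Sum>b\<in>F. c b p * D X (Z b) p u + X p (c b) * Z b p u)"
    by (rule D_comb_right) (use assms in auto)
  ultimately show ?thesis
    unfolding hess_def by (simp add: right_diff_distrib sum_subtractf sum.distrib)
qed

lemma hess_germ:
  assumes X: "X \<in> VF" and Y: "Y \<in> VF" and f: "smooth_near A p f" and fg: "germ_eq p f g"
  shows "hess f X Y p = hess g X Y p"
proof -
  obtain U where U: "open U" "p \<in> U" "f \<in> C_infinity A U" using f unfolding smooth_near_def by blast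
  obtain W where W: "open W" "p \<in> W" "\<And>x. x \<in> W \<Longrightarrow> f x = g x" using fg by (metis germ_eqE)
  have "germ_eq p (\<lambda>q. Y q f) (\<lambda>q. Y q g)"
  proof (rule germ_eq_open[of "U \<inter> W"])
    fix q assume "q \<in> U \<inter> W"
    then show "Y q f = Y q g"
      using U W by (intro tv_germ[OF vector_field_tangent[OF Y]] smooth_nearI[of U] germ_eq_open[of W]) auto
  qed (use U W in auto)
  then have "X p (\<lambda>q. Y q f) = X p (\<lambda>q. Y q g)"
    by (intro tv_germ[OF vector_field_tangent[OF X]] vector_field_smooth_near[OF Y f])
  moreover have "D X Y p f = D X Y p g"
    by (rule tv_germ[OF vector_field_tangent[OF D_smooth[OF X Y]] f fg])
  ultimately show ?thesis by (simp add: hess_def)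
qed

lemma hess_sum:
  assumes X: "X \<in> VF" and Y: "Y \<in> VF" and I: "finite I" and W: "open W" "p \<in> W"
    and u: "\<And>i. i \<in> I \<Longrightarrow> u i \<in> C_infinity A W"
  shows "hess (\<lambda>x. \<Sum>i\<in>I. c i * u i x) X Y p = (\<Sum>i\<in>I. c i * hess (u i) X Y p)"
proof -
  have lin: "v (\<lambda>x. \<Sum>i\<in>I. c i * w i x) = (\<Sum>i\<in>I. c i * v (w i))"
    if v: "v \<in> tangent_space A q" and w: "\<And>i. i \<in> I \<Longrightarrow> smooth_near A q (w i)" for v q w
    by (subst tv_sum[OF v I]) (auto intro!: smooth_near_mult smooth_near_const w sum.cong tv_cmult[OF v])
  have u': "smooth_near A q (u i)" if "i \<in> I" "q \<in> W" for i q
    using smooth_nearI[OF W(1) that(2) u[OF that(1)]] .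
  note v = vector_field_tangent
  have germ: "germ_eq p (\<lambda>q. \<Sum>i\<in>I. c i * Y q (u i)) (\<lambda>q. Y q (\<lambda>x. \<Sum>i\<in>I. c i * u i x))"
    by (rule germ_eq_open[OF W]) (simp add: lin[OF v[OF Y]] u')
  have smooth: "smooth_near A p (\<lambda>q. \<Sum>i\<in>I. c i * Y q (u i))"
    by (intro smooth_near_sum smooth_near_mult smooth_near_const vector_field_smooth_near[OF Y] u' W)
  have "X p (\<lambda>q. Y q (\<lambda>x. \<Sum>i\<in>I. c i * u i x)) = X p (\<lambda>q. \<Sum>i\<in>I. c i * Y q (u i))"
    by (rule tv_germ[OF v[OF X] smooth germ, symmetric])
  also have "\<dots> = (\<Sum>i\<in>I. c i * X p (\<lambda>q. Y q (u i)))"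
    by (rule lin[OF v[OF X]]) (intro vector_field_smooth_near[OF Y] u' W)
  finally show ?thesis
    unfolding hess_def
    by (simp add: lin[OF v[OF D_smooth[OF X Y]] u'[OF _ W(2)]] right_diff_distrib sum_subtractf)
qed

lemma hess_add:
  assumes "X \<in> VF" "Y \<in> VF" "open W" "p \<in> W" "f \<in> C_infinity A W" "g \<in> C_infinity A W"
  shows "hess (\<lambda>x. f x + c * g x) X Y p = hess f X Y p + c * hess g X Y p"
proof -
  \<comment> \<open>The two summands are indexed by \<open>bool\<close>, so that
    \<open>hess_sum\<close> applies.\<close>
  have "(if i then f else g) \<in> C_infinity A W" for i using assms(5,6) by simp
  from hess_sum[where I = UNIV and c = "\<lambda>i. if i then 1 else c" and u = "\<lambda>i. if i then f else g",
      OF assms(1,2) finite assms(3,4) this]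
  show ?thesis by (simp add: UNIV_bool add.commute)
qed

definition affine_on :: "'m set \<Rightarrow> ('m \<Rightarrow> real) \<Rightarrow> bool" where
  "affine_on W u \<longleftrightarrow> u \<in> C_infinity A W \<and> (\<forall>X\<in>VF. \<forall>Y\<in>VF. \<forall>p\<in>W. hess u X Y p = 0)"

lemma affine_on_subset: "affine_on W u \<Longrightarrow> W' \<subseteq> W \<Longrightarrow> affine_on W' u"
  unfolding affine_on_def using C_infinity_subset by blast

lemma affine_on_add:
  assumes "open W" "affine_on W f" "affine_on W g"
  shows "affine_on W (\<lambda>x. f x + c * g x)"
  using assms unfolding affine_on_def
  by (auto simp: hess_add intro!: C_infinity_add C_infinity_mult C_infinity_const)

end

section \<open>Affine functions in a coordinate patch\<close>

text \<open>The bump function turns coordinate fields into global ones. Computations take place over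
  the ball of radius \<open>r\<close>, where the cut-off is invisible.\<close>

locale coordinate_patch = affine_manifold_basis A D B
  for A :: "('m::{t2_space, second_countable_topology}, 'e::real_inner) chart set"
    and D :: "'m connection" and B :: "'e set" +
  fixes V :: "'m set" and \<phi> :: "'m \<Rightarrow> 'e" and a :: 'e and r R :: real and \<rho> :: "'e \<Rightarrow> real"
  assumes chart: "(V, \<phi>) \<in> A"
    and r: "0 < r" and patch: "cball a R \<subseteq> \<phi> ` V" and rR: "r < R"
    and \<rho>: "smooth_on UNIV \<rho>" "\<And>x. dist x a \<le> r \<Longrightarrow> \<rho> x = 1" "\<And>x. dist x a \<ge> R \<Longrightarrow> \<rho> x = 0"
begin

abbreviation "\<psi> \<equiv> inv_into V \<phi>"

abbreviation coord :: "'e \<Rightarrow> 'm \<Rightarrow> real" where "coord b \<equiv> \<lambda>q. \<phi> q \<bullet> b"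

definition core :: "'m set" where "core = {q \<in> V. \<phi> q \<in> ball a r}"

definition cut :: "('m \<Rightarrow> real) \<Rightarrow> 'm \<Rightarrow> real" where
  "cut g = (\<lambda>q. if q \<in> V then \<rho> (\<phi> q) * g q else 0)"

lemmas open_V = chart_facts(1)[OF chart] and \<psi>\<phi> = chart_facts(6)[OF chart]

lemma core: "open core" "core \<subseteq> V"
  using open_chart_preimage[OF chart, of "ball a r"] by (auto simp: core_def)

lemma image_core: "\<phi> ` core = ball a r"
  using patch rR r unfolding core_def by (auto simp: subset_iff image_iff) (metis less_eq_real_def less_trans mem_cball)

lemma core_\<rho>: "q \<in> core \<Longrightarrow> \<rho> (\<phi> q) = 1"
  by (intro \<rho>) (simp add: core_def dist_commute less_imp_le)

lemma cut_core: "q \<in> core \<Longrightarrow> cut g q = g q"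
  using core_\<rho> core(2) by (auto simp: cut_def)

text \<open>The delicate points lie outside the chart domain. The preimage \<open>K\<close> of the
  closed ball is compact, hence closed since the manifold is Hausdorff, and \<open>f\<close>
  vanishes off \<open>K\<close>; so such points have a neighbourhood on which \<open>f\<close> is
  0.\<close>

lemma C_infinity_extend_zero:
  assumes g: "g \<in> C_infinity A (U \<inter> V)" and U: "open U"
    and f: "\<And>q. q \<in> U \<inter> V \<Longrightarrow> f q = \<rho> (\<phi> q) * g q" "\<And>q. q \<in> U \<Longrightarrow> q \<notin> V \<Longrightarrow> f q = 0"
  shows "f \<in> C_infinity A U"
proof (rule C_infinity_local)
  fix p assume p: "p \<in> U"
  define K where "K = \<psi> ` cball a R"
  have "compact K" unfolding K_def
    by (intro compact_continuous_image continuous_on_subset[OF chart_facts(4)[OF chart] patch] compact_cball)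
  then have K: "open (U \<inter> - K)" using compact_imp_closed U by blast
  have outside: "f q = 0" if "q \<in> U" "q \<notin> K" for q
  proof (cases "q \<in> V")
    case True
    then have "\<phi> q \<notin> cball a R" using that(2) \<psi>\<phi>[OF True] unfolding K_def by (metis image_eqI)
    then have "\<rho> (\<phi> q) = 0" by (intro \<rho>) (auto simp: dist_commute)
    then show ?thesis using f(1) True that(1) by simp
  qed (use f(2) that in simp)
  show "\<exists>W. open W \<and> p \<in> W \<and> f \<in> C_infinity A W"
  proof (cases "p \<in> V")
    case True
    have UV: "open (U \<inter> V)" using U open_V by blast
    have "(\<lambda>q. \<rho> (\<phi> q)) \<in> C_infinity A (U \<inter> V)"
      by (intro C_infinity_chart[OF chart UV] smooth_on_subset[OF \<rho>(1)]) auto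
    then have "(\<lambda>q. \<rho> (\<phi> q) * g q) \<in> C_infinity A (U \<inter> V)" using g by (intro C_infinity_mult[OF UV])
    then have "f \<in> C_infinity A (U \<inter> V)" by (rule C_infinity_cong[OF UV]) (simp add: f(1))
    then show ?thesis using UV p True by blast
  next
    case False
    have "K \<subseteq> V" unfolding K_def using patch by (auto intro: inv_into_into)
    then have "p \<in> U \<inter> - K" using False p by blast
    moreover have "f \<in> C_infinity A (U \<inter> - K)"
      by (rule C_infinity_cong[OF K C_infinity_const[OF K, of 0]]) (use outside in auto)
    ultimately show ?thesis using K by blast
  qed
qed

lemma cut_smooth: "g \<in> C_infinity A V \<Longrightarrow> cut g \<in> C_infinity A UNIV"
  by (rule C_infinity_extend_zero[of g]) (auto simp: cut_def)

text \<open>Over \<open>core\<close> these are the coordinate fields; the cut-off makes them global,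
  as the arguments of \<open>D\<close> must be.\<close>

definition frame :: "'e \<Rightarrow> 'm vector_field" where
  "frame b = (\<lambda>p. if p \<in> V then tv_scale (\<rho> (\<phi> p)) (partial V \<phi> b p) else (\<lambda>f. 0))"

lemma partial_smooth:
  assumes U: "open U" and f: "f \<in> C_infinity A U"
  shows "(\<lambda>q. partial V \<phi> b q f) \<in> C_infinity A (U \<inter> V)"
proof -
  have UV: "open (U \<inter> V)" using U open_V by blast
  have "(\<lambda>q. dir_deriv b (\<lambda>x. f (\<psi> x)) (\<phi> q)) \<in> C_infinity A (U \<inter> V)"
    by (intro C_infinity_chart[OF chart UV] smooth_on_dir_deriv C_infinity_chart_smooth[OF f chart]) auto
  then show ?thesis
    by (rule C_infinity_cong[OF UV]) (use smooth_nearI[OF U _ f] in \<open>auto simp: partial_def\<close>)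
qed

lemma frame_smooth: "frame b \<in> VF"
  unfolding smooth_vector_fields_def mem_Collect_eq
proof (intro conjI allI impI)
  show "frame b p \<in> tangent_space A p" for p
    by (auto simp: frame_def tangent_space_zero intro: tangent_space_scale partial_tangent[OF chart])
  fix U f assume U: "open U" and f: "f \<in> C_infinity A U"
  show "(\<lambda>p. frame b p f) \<in> C_infinity A U"
    by (rule C_infinity_extend_zero[OF partial_smooth[OF U f] U]) (auto simp: frame_def tv_scale_def)
qed

lemma frame_core:
  assumes "q \<in> core"
  shows "frame b q f = partial V \<phi> b q f"
  using assms core(2) core_\<rho> by (auto simp: frame_def tv_scale_def)

lemma frame_core_deriv:
  assumes "q \<in> core" "smooth_near A q f"
  shows "frame b q f = dir_deriv b (\<lambda>x. f (\<psi> x)) (\<phi> q)"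
  using assms frame_core by (simp add: partial_def)

lemma coord_smooth_near: "q \<in> V \<Longrightarrow> smooth_near A q (coord b)"
  using smooth_nearI[OF open_V _ C_infinity_coordinate[OF chart]] by blast

lemma frame_coord:
  assumes "q \<in> core" "b \<in> B" "c \<in> B"
  shows "frame b q (coord c) = (if b = c then 1 else 0)"
proof -
  have "((\<lambda>x. \<phi> (\<psi> x) \<bullet> c) has_derivative (\<lambda>v. v \<bullet> c)) (at (\<phi> q))"
  proof (rule has_derivative_transform_within_open[of "\<lambda>x. x \<bullet> c"])
    show "((\<lambda>x. x \<bullet> c) has_derivative (\<lambda>v. v \<bullet> c)) (at (\<phi> q))"
      by (rule bounded_linear_imp_has_derivative[OF bounded_linear_inner_left])
    show "open (\<phi> ` V)" "\<phi> q \<in> \<phi> ` V" using chart_facts(2)[OF chart] assms(1) core(2) by auto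
  qed (auto simp: \<psi>\<phi>)
  from dir_derivI[OF this, of b] show ?thesis
    using frame_core_deriv[OF assms(1) coord_smooth_near] assms core(2) inner_B by auto
qed

section \<open>Components and Christoffel symbols in the cut-off frame\<close>

definition comp :: "'m vector_field \<Rightarrow> 'e \<Rightarrow> 'm \<Rightarrow> real" where
  "comp Y b q = Y q (coord b)"

lemma comp_smooth: "Y \<in> VF \<Longrightarrow> comp Y b \<in> C_infinity A V"
  unfolding comp_def using vector_field_smooth[OF _ open_V C_infinity_coordinate[OF chart]] .

lemma cut_comp_smooth: "Y \<in> VF \<Longrightarrow> cut (comp Y b) \<in> C_infinity A UNIV"
  by (intro cut_smooth comp_smooth)

definition cutoff :: "'m \<Rightarrow> real" where "cutoff p = cut (\<lambda>q. 1) p * cut (\<lambda>q. 1) p"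

lemma cutoff: "cutoff \<in> C_infinity A UNIV" "p \<in> core \<Longrightarrow> cutoff p = 1"
  unfolding cutoff_def[abs_def]
  by (intro C_infinity_mult cut_smooth C_infinity_const open_UNIV open_V) (simp add: cut_core)

text \<open>Cutting off twice turns the local expansion of a field in the coordinate frame into an
  equation between global fields, to which the axioms of a connection apply.\<close>

lemma field_expand: "Y \<in> VF \<Longrightarrow> vf_scale cutoff Y = vf_comb B (\<lambda>b. cut (comp Y b)) frame"
proof (intro ext)
  fix p f assume Y: "Y \<in> VF"
  show "vf_scale cutoff Y p f = vf_comb B (\<lambda>b. cut (comp Y b)) frame p f"
  proof (cases "p \<in> V")
    case True
    have "Y p f = (\<Sum>b\<in>B. comp Y b p * partial V \<phi> b p f)"
    proof (cases "smooth_near A p f")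
      case True
      from tangent_vector_expand[OF chart \<open>p \<in> V\<close> vector_field_tangent[OF Y] this]
      show ?thesis by (simp add: comp_def)
    next
      case False
      then show ?thesis using tv_not_smooth[OF vector_field_tangent[OF Y]] by (simp add: partial_def)
    qed
    then show ?thesis using True
      by (simp add: vf_scale_def tv_scale_def vf_comb_def frame_def cut_def cutoff_def sum_distrib_left mult_ac)
  qed (simp add: vf_scale_def tv_scale_def vf_comb_def frame_def cutoff_def cut_def)
qed

text \<open>The Hessian is linear over functions in both slots and \<open>cutoff\<close> is 1 at
  \<open>p\<close>, so each field may be replaced by its cut-off multiple, a combination of frame
  fields.\<close>

lemma hess_expand:
  assumes X: "X \<in> VF" and Y: "Y \<in> VF" and p: "p \<in> core" and u: "smooth_near A p u"
  shows "hess u X Y p = (\<Sum>b\<in>B. \<Sum>c\<in>B. comp X b p * comp Y c p * hess u (frame b) (frame c) p)"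
proof -
  have "hess u X Y p = hess u (vf_scale cutoff X) Y p"
    using hess_scale_left[OF cutoff(1) X Y] cutoff(2)[OF p] by simp
  also have "\<dots> = (\<Sum>b\<in>B. comp X b p * hess u (frame b) Y p)"
    unfolding field_expand[OF X]
    using hess_comb_left[OF finite_B cut_comp_smooth[OF X] frame_smooth Y] cut_core[OF p] by simp
  also have "\<dots> = (\<Sum>b\<in>B. comp X b p * hess u (frame b) (vf_scale cutoff Y) p)"
    using hess_scale_right[OF cutoff(1) frame_smooth Y u] cutoff(2)[OF p] by simp
  also have "\<dots> = (\<Sum>b\<in>B. comp X b p * (\<Sum>c\<in>B. comp Y c p * hess u (frame b) (frame c) p))"
    unfolding field_expand[OF Y]
    using hess_comb_right[OF finite_B cut_comp_smooth[OF Y] frame_smooth frame_smooth u] cut_core[OF p] by simp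
  finally show ?thesis by (simp add: sum_distrib_left mult.assoc)
qed

lemma D_expand_left:
  assumes X: "X \<in> VF" and Y: "Y \<in> VF" and p: "p \<in> core"
  shows "D X Y p f = (\<Sum>b\<in>B. comp X b p * D (frame b) Y p f)"
proof -
  have "D X Y p f = D (vf_scale cutoff X) Y p f" using D_scale_left[OF cutoff(1) X Y] cutoff(2)[OF p] by simp
  then show ?thesis
    unfolding field_expand[OF X]
    using D_comb_left[OF finite_B cut_comp_smooth[OF X] frame_smooth Y] cut_core[OF p] by simp
qed

lemma core_germ: "p \<in> core \<Longrightarrow> germ_eq p (cut g) g"
  by (rule germ_eq_open[OF core(1)]) (auto simp: cut_core)

lemma D_expand_right:
  assumes X: "X \<in> VF" and Y: "Y \<in> VF" and p: "p \<in> core"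
  shows "D X Y p f = (\<Sum>b\<in>B. comp Y b p * D X (frame b) p f + X p (comp Y b) * frame b p f)"
proof -
  have sm: "smooth_near A p g" if "g \<in> C_infinity A UNIV" for g using smooth_nearI[OF _ _ that] by simp
  \<comment> \<open>The connection also differentiates the factor \<open>cutoff\<close>; that term
    vanishes because \<open>cutoff\<close> is 1 on a whole neighbourhood of
    \<open>p\<close>.\<close>
  have "germ_eq p cutoff (\<lambda>q. 1)" using p by (intro germ_eq_open[OF core(1)]) (auto simp: cutoff)
  then have "X p cutoff = 0"
    using tv_germ[OF vector_field_tangent[OF X] sm[OF cutoff(1)]] tv_const[OF vector_field_tangent[OF X]] by metis
  then have "D X Y p f = D X (vf_scale cutoff Y) p f"
    using D_scale_right[OF cutoff(1) X Y] cutoff(2)[OF p] by simp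
  moreover have "X p (cut (comp Y b)) = X p (comp Y b)" for b
    using tv_germ[OF vector_field_tangent[OF X] sm[OF cut_comp_smooth[OF Y]] core_germ[OF p]] .
  ultimately show ?thesis
    unfolding field_expand[OF Y]
    using D_comb_right[OF finite_B cut_comp_smooth[OF Y] frame_smooth X] cut_core[OF p] by simp
qed

text \<open>The symbol \<open>\<Gamma>\<^sub>b\<^sub>c\<^sup>k\<close>, read off by applying the
  field to the coordinate function \<open>coord k\<close>. The classical meaning holds over
  \<open>core\<close>, where the frame is the coordinate frame.\<close>

definition christoffel :: "'e \<Rightarrow> 'e \<Rightarrow> 'e \<Rightarrow> 'e \<Rightarrow> real" where
  "christoffel b c k x = comp (D (frame b) (frame c)) k (\<psi> x)"

lemma comp_frame:
  "p \<in> V \<Longrightarrow> comp (D (frame b) (frame c)) k p = christoffel b c k (\<phi> p)"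
  by (simp add: christoffel_def \<psi>\<phi>)

lemma christoffel_smooth: "smooth_on (\<phi> ` V) (christoffel b c k)"
  unfolding christoffel_def[abs_def]
  using C_infinity_chart_smooth[OF comp_smooth[OF D_smooth[OF frame_smooth frame_smooth]] chart] by simp

lemma frame_second:
  assumes W: "open W" "p \<in> W" "W \<subseteq> core" and u: "u \<in> C_infinity A W"
  shows "frame b p (\<lambda>q. frame c q u) = dir_deriv b (dir_deriv c (\<lambda>x. u (\<psi> x))) (\<phi> p)"
proof -
  have p: "p \<in> core" "p \<in> V" using W core(2) by auto
  have sm: "smooth_near A p (\<lambda>q. frame c q u)"
    by (rule vector_field_smooth_near[OF frame_smooth smooth_nearI[OF W(1,2) u]])
  have "frame b p (\<lambda>q. frame c q u) = dir_deriv b (\<lambda>x. frame c (\<psi> x) u) (\<phi> p)"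
    using frame_core_deriv[OF p(1) sm] .
  also have "\<dots> = dir_deriv b (dir_deriv c (\<lambda>x. u (\<psi> x))) (\<phi> p)"
  proof -
    have *: "((\<lambda>x. frame c (\<psi> x) u) has_derivative (\<lambda>v. dir_deriv v (\<lambda>x. frame c (\<psi> x) u) (\<phi> p))) (at (\<phi> p))"
      by (rule chart_expr_derivative[OF chart p(2) sm])
    have "(dir_deriv c (\<lambda>x. u (\<psi> x)) has_derivative (\<lambda>v. dir_deriv v (\<lambda>x. frame c (\<psi> x) u) (\<phi> p))) (at (\<phi> p))"
    proof (rule has_derivative_transform_within_open[OF * open_chart_image[OF chart W(1)]])
      show "\<phi> p \<in> \<phi> ` (W \<inter> V)" using W p by blast
      fix x assume "x \<in> \<phi> ` (W \<inter> V)"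
      then obtain q where q: "q \<in> W" "q \<in> V" "x = \<phi> q" by blast
      show "frame c (\<psi> x) u = dir_deriv c (\<lambda>x. u (\<psi> x)) x"
        using frame_core_deriv[of q u c] smooth_nearI[OF W(1) q(1) u] q W(3) \<psi>\<phi>[OF q(2)] by auto
    qed
    from dir_derivI[OF this] show ?thesis by simp
  qed
  finally show ?thesis .
qed

lemma frame_frame_coord:
  assumes p: "p \<in> core" and bck: "b \<in> B" "c \<in> B" "k \<in> B"
  shows "frame b p (\<lambda>q. frame c q (coord k)) = 0"
proof -
  have "germ_eq p (\<lambda>q. frame c q (coord k)) (\<lambda>q. if c = k then 1 else 0)"
    by (rule germ_eq_open[OF core(1) p]) (simp add: frame_coord bck)
  moreover have "smooth_near A p (\<lambda>q. frame c q (coord k))"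
    using p core(2) by (intro vector_field_smooth_near[OF frame_smooth coord_smooth_near]) auto
  ultimately have "frame b p (\<lambda>q. frame c q (coord k)) = frame b p (\<lambda>q. if c = k then 1 else 0)"
    by (intro tv_germ[OF vector_field_tangent[OF frame_smooth]])
  then show ?thesis by (simp only: tv_const[OF vector_field_tangent[OF frame_smooth]])
qed

text \<open>A component is the bracket applied to a coordinate function, and the first derivatives
  of coordinates are constant on \<open>core\<close>.\<close>

lemma bracket_frame:
  assumes "p \<in> core" "b \<in> B" "c \<in> B" "k \<in> B"
  shows "comp (lie_bracket A (frame b) (frame c)) k p = 0"
  using assms frame_frame_coord by (simp add: comp_def lie_bracket_def)

lemma christoffel_sym:
  assumes "p \<in> core" "b \<in> B" "c \<in> B" "k \<in> B"
  shows "christoffel b c k (\<phi> p) = christoffel c b k (\<phi> p)"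
proof -
  have "vf_diff (D (frame b) (frame c)) (D (frame c) (frame b)) p (coord k) =
      lie_bracket A (frame b) (frame c) p (coord k)"
    using torsion_free frame_smooth unfolding torsion_free_def by simp
  also have "\<dots> = 0" using bracket_frame[OF assms] by (simp add: comp_def)
  finally have eq: "D (frame b) (frame c) p (coord k) = D (frame c) (frame b) p (coord k)"
    by (simp add: vf_diff_def tv_add_def tv_scale_def)
  have "p \<in> V" using assms(1) core(2) by blast
  from comp_frame[OF this, of b c k] comp_frame[OF this, of c b k] eq
  show ?thesis by (simp only: comp_def)
qed

text \<open>Vanishing curvature in coordinates. The product rule for \<open>D\<close> gives the
  derivative and the quadratic terms; the bracket term drops out because the bracket of frame fields
  has zero components on \<open>core\<close>.\<close>

lemma christoffel_flat:
  assumes p: "p \<in> core" and b: "b1 \<in> B" "b2 \<in> B" "c \<in> B" "l \<in> B"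
  shows "dir_deriv b1 (christoffel b2 c l) (\<phi> p) + (\<Sum>k\<in>B. christoffel b2 c k (\<phi> p) * christoffel b1 k l (\<phi> p)) =
    dir_deriv b2 (christoffel b1 c l) (\<phi> p) + (\<Sum>k\<in>B. christoffel b1 c k (\<phi> p) * christoffel b2 k l (\<phi> p))"
proof -
  have pV: "p \<in> V" using p core(2) by blast
  note [simp] = frame_smooth D_smooth
  have second: "D (frame b1) (D (frame b2) (frame c)) p (coord l) =
      dir_deriv b1 (christoffel b2 c l) (\<phi> p) +
      (\<Sum>k\<in>B. christoffel b2 c k (\<phi> p) * christoffel b1 k l (\<phi> p))"
    if "b1 \<in> B" "b2 \<in> B" for b1 b2
  proof -
    have 1: "frame b1 p (comp (D (frame b2) (frame c)) l) = dir_deriv b1 (christoffel b2 c l) (\<phi> p)"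
      using frame_core_deriv[OF p smooth_nearI[OF open_V pV comp_smooth]]
      by (simp add: christoffel_def[abs_def])
    have "D (frame b1) (D (frame b2) (frame c)) p (coord l) =
      (\<Sum>k\<in>B. christoffel b2 c k (\<phi> p) * christoffel b1 k l (\<phi> p) +
        frame b1 p (comp (D (frame b2) (frame c)) k) * (if k = l then 1 else 0))"
      unfolding D_expand_right[OF frame_smooth D_smooth[OF frame_smooth frame_smooth] p]
      by (intro sum.cong refl) (simp add: frame_coord[OF p _ b(4)] comp_frame[OF pV, symmetric] comp_def)
    then show ?thesis
      using b(4) by (simp add: sum.distrib 1 if_distrib[of "\<lambda>x. _ * x"] cong: if_cong)
  qed
  have "vf_diff (D (frame b1) (D (frame b2) (frame c))) (D (frame b2) (D (frame b1) (frame c))) =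
      D (lie_bracket A (frame b1) (frame b2)) (frame c)"
    using flat unfolding flat_def by simp
  then have "D (frame b1) (D (frame b2) (frame c)) p (coord l) - D (frame b2) (D (frame b1) (frame c)) p (coord l) =
      D (lie_bracket A (frame b1) (frame b2)) (frame c) p (coord l)"
    by (simp add: vf_diff_def tv_add_def tv_scale_def fun_eq_iff)
  also have "\<dots> = 0"
    using D_expand_left[OF lie_bracket_smooth[OF frame_smooth frame_smooth] frame_smooth p] bracket_frame[OF p b(1,2)]
    by simp
  finally show ?thesis using second b by simp
qed

lemma hess_frame:
  assumes W: "open W" "p \<in> W" "W \<subseteq> core" and u: "u \<in> C_infinity A W"
  shows "hess u (frame b) (frame c) p = dir_deriv b (dir_deriv c (\<lambda>x. u (\<psi> x))) (\<phi> p) -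
    (\<Sum>k\<in>B. christoffel b c k (\<phi> p) * dir_deriv k (\<lambda>x. u (\<psi> x)) (\<phi> p))"
proof -
  have p: "p \<in> V" using W core(2) by blast
  have sm: "smooth_near A p u" by (rule smooth_nearI[OF W(1,2) u])
  have "D (frame b) (frame c) p u =
      (\<Sum>k\<in>B. christoffel b c k (\<phi> p) * dir_deriv k (\<lambda>x. u (\<psi> x)) (\<phi> p))"
    using tangent_vector_expand[OF chart p vector_field_tangent[OF D_smooth[OF frame_smooth frame_smooth]] sm]
    by (simp add: comp_frame[OF p, symmetric] comp_def partial_def sm)
  then show ?thesis by (simp add: hess_def frame_second[OF assms])
qed

text \<open>By \<open>hess_expand\<close> it suffices to test the Hessian on the frame, which gives
  the classical second-order system for affine functions.\<close>

lemma affine_on_iff: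
  assumes W: "open W" "W \<subseteq> core" and u: "u \<in> C_infinity A W"
  shows "affine_on W u \<longleftrightarrow> (\<forall>p\<in>W. \<forall>b\<in>B. \<forall>c\<in>B. dir_deriv b (dir_deriv c (\<lambda>x. u (\<psi> x))) (\<phi> p) =
    (\<Sum>k\<in>B. christoffel b c k (\<phi> p) * dir_deriv k (\<lambda>x. u (\<psi> x)) (\<phi> p)))"
    (is "?L \<longleftrightarrow> ?R")
proof
  assume ?L
  then show ?R
    using hess_frame[OF W(1) _ W(2) u] frame_smooth unfolding affine_on_def by fastforce
next
  assume R: ?R
  have "hess u X Y p = 0" if "X \<in> VF" "Y \<in> VF" "p \<in> W" for X Y p
    using hess_expand[OF that(1,2) _ smooth_nearI[OF W(1) that(3) u]] hess_frame[OF W(1) that(3) W(2) u] R W(2) that(3)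
    by (simp add: subset_iff)
  then show ?L using u by (simp add: affine_on_def)
qed

end

section \<open>The first-order system for 1-jets\<close>

context coordinate_patch
begin

definition jet_index :: "'e option set" where "jet_index = insert None (Some ` B)"

text \<open>The equations \<open>\<partial>\<^sub>b u = u\<^sub>b\<close> and \<open>\<partial>\<^sub>b u\<^sub>c = \<Sum>\<^sub>k \<Gamma>\<^sub>b\<^sub>c\<^sup>k u\<^sub>k\<close> for the 1-jet of an affine function \<open>u\<close>;
  the index \<open>None\<close> stands for the value of \<open>u\<close> and \<open>Some c\<close> for \<open>u\<^sub>c\<close>.\<close>

definition jet_coeff :: "'e \<Rightarrow> 'e option \<Rightarrow> 'e option \<Rightarrow> 'e \<Rightarrow> real" where
  "jet_coeff b i j = (case j of None \<Rightarrow> (\<lambda>x. 0) | Some k \<Rightarrow>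
     (case i of None \<Rightarrow> (\<lambda>x. if k = b then 1 else 0) | Some c \<Rightarrow> christoffel b c k))"

definition jet :: "('m \<Rightarrow> real) \<Rightarrow> 'e option \<Rightarrow> 'e \<Rightarrow> real" where
  "jet u i = (case i of None \<Rightarrow> (\<lambda>x. u (\<psi> x)) | Some c \<Rightarrow> dir_deriv c (\<lambda>x. u (\<psi> x)))"

lemma sum_jet_index: "(\<Sum>j\<in>jet_index. f j) = f None + (\<Sum>k\<in>B. f (Some k))"
  unfolding jet_index_def by (subst sum.insert) (auto simp: sum.reindex)

lemma jet_index_cases:
  assumes "i \<in> jet_index"
  obtains "i = None" | c where "c \<in> B" "i = Some c"
  using assms by (auto simp: jet_index_def)

lemma sum_delta_B: "b \<in> B \<Longrightarrow> (\<Sum>k\<in>B. (if k = b then 1 else 0) * f k) = (f b :: real)"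
  by (simp add: if_distrib[of "\<lambda>x. x * _"] cong: if_cong)

lemma jet_coeff_sum:
  "b \<in> B \<Longrightarrow> (\<Sum>j\<in>jet_index. jet_coeff b None j x * f j) = f (Some b)"
  "(\<Sum>j\<in>jet_index. jet_coeff b (Some c) j x * f j) = (\<Sum>k\<in>B. christoffel b c k x * f (Some k))"
  by (simp_all add: sum_jet_index jet_coeff_def sum_delta_B)

lemma dir_deriv_const: "dir_deriv v (\<lambda>x. c) x = 0"
  by (rule dir_derivI[where f' = "\<lambda>v. 0"]) simp

text \<open>The column \<open>None\<close> is zero. In a column \<open>Some l\<close>, the row
  \<open>None\<close> is the symmetry of the Christoffel symbols, that is, torsion-freeness, and the
  rows \<open>Some c\<close> are flatness.\<close>

lemma jet_coeff_integrable:
  assumes "b1 \<in> B" "b2 \<in> B" "i \<in> jet_index" "j \<in> jet_index" "x \<in> ball a r"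
  shows "dir_deriv b1 (jet_coeff b2 i j) x + (\<Sum>k\<in>jet_index. jet_coeff b2 i k x * jet_coeff b1 k j x) =
    dir_deriv b2 (jet_coeff b1 i j) x + (\<Sum>k\<in>jet_index. jet_coeff b1 i k x * jet_coeff b2 k j x)"
proof -
  obtain p where p: "p \<in> core" "x = \<phi> p" using assms(5) image_core by blast
  from assms(4) show ?thesis
  proof (cases rule: jet_index_cases)
    case 1
    then show ?thesis by (simp add: jet_coeff_def dir_deriv_const)
  next
    case j: (2 l)
    from assms(3) show ?thesis
    proof (cases rule: jet_index_cases)
      case 1
      then show ?thesis
        using christoffel_sym[OF p(1) assms(1,2) j(1)] p(2) j assms(1,2)
        unfolding 1 jet_coeff_sum(1)[OF assms(1)] jet_coeff_sum(1)[OF assms(2)]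
        by (simp add: jet_coeff_def dir_deriv_const)
    next
      case (2 c)
      then show ?thesis
        using christoffel_flat[OF p(1) assms(1,2) 2(1) j(1)] p(2) j
        unfolding 2 jet_coeff_sum(2) by (simp add: jet_coeff_def)
    qed
  qed
qed

lemma jet_coeff_bounded:
  obtains C where "0 \<le> C"
    "\<And>b i j x. b \<in> B \<Longrightarrow> i \<in> jet_index \<Longrightarrow> j \<in> jet_index \<Longrightarrow> x \<in> ball a r \<Longrightarrow> \<bar>jet_coeff b i j x\<bar> \<le> C"
proof -
  have sub: "cball a r \<subseteq> \<phi> ` V" using patch rR by (meson subset_cball less_imp_le order_trans)
  have "bounded (\<Union>(b, c, k)\<in>B \<times> B \<times> B. christoffel b c k ` cball a r)"
    by (intro bounded_UN finite_cartesian_product finite_B ballI)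
      (auto intro!: compact_imp_bounded compact_continuous_image
        continuous_on_subset[OF smooth_on_imp_continuous_on[OF christoffel_smooth] sub])
  then obtain K where K: "\<And>b c k x. b \<in> B \<Longrightarrow> c \<in> B \<Longrightarrow> k \<in> B \<Longrightarrow> x \<in> cball a r \<Longrightarrow> \<bar>christoffel b c k x\<bar> \<le> K"
    unfolding bounded_iff by fastforce
  \<comment> \<open>The 1 covers the constant coefficients of the equations
    \<open>\<partial>\<^sub>b u = u\<^sub>b\<close>.\<close>
  show ?thesis
  proof (rule that[of "max 1 K"])
    fix b i j x assume "b \<in> B" "i \<in> jet_index" "j \<in> jet_index" "x \<in> ball a r"
    then show "\<bar>jet_coeff b i j x\<bar> \<le> max 1 K"
      using K[of b] by (auto simp: jet_coeff_def jet_index_def le_max_iff_disj)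
  qed simp
qed

lemma chart_image_core: "W \<subseteq> core \<Longrightarrow> W \<inter> V = W"
  using core(2) by blast

text \<open>Affine functions on \<open>U\<close> correspond to solutions of the jet system on a
  small ball \<open>S\<close>. Uniqueness and existence there, with initial values at an arbitrary
  point of \<open>S\<close>, become the last two properties of \<open>U\<close>.\<close>

lemma affine_nhd:
  assumes U0: "open U0" and a: "a \<in> \<phi> ` (U0 \<inter> V)"
  obtains U where "open U" "U \<subseteq> U0" "\<psi> a \<in> U" "path_connected U"
    "\<And>u q x. affine_on U u \<Longrightarrow> q \<in> U \<Longrightarrow> germ_eq q u (\<lambda>x. 0) \<Longrightarrow> x \<in> U \<Longrightarrow> u x = 0"
    "\<And>W g q. open W \<Longrightarrow> q \<in> W \<Longrightarrow> W \<subseteq> U \<Longrightarrow> affine_on W g \<Longrightarrow> \<exists>u. affine_on U u \<and> germ_eq q u g"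
proof -
  obtain C where C: "0 \<le> C"
    "\<And>b i j x. b \<in> B \<Longrightarrow> i \<in> jet_index \<Longrightarrow> j \<in> jet_index \<Longrightarrow> x \<in> ball a r \<Longrightarrow> \<bar>jet_coeff b i j x\<bar> \<le> C"
    using jet_coeff_bounded by blast
  obtain e where e: "e > 0" "ball a e \<subseteq> \<phi> ` (U0 \<inter> V)"
    using open_chart_image[OF chart U0] a by (meson openE)
  define N where "N = card B * (card jet_index * C)"
  have N: "0 \<le> N" using C(1) by (simp add: N_def)
  \<comment> \<open>\<open>2 * s\<close> bounds the diameter of the ball; the factor 16 yields
    \<open>2 * s * N \<le> 1 / 8\<close>, and \<open>N + 1\<close> avoids division by 0.\<close>
  define s where "s = min r (min e (1 / (16 * (N + 1))))"
  have s: "s > 0" "s \<le> r" "s \<le> e" "s \<le> 1 / (16 * (N + 1))" using r e(1) N by (auto simp: s_def)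
  have "2 * s * N \<le> 2 * (1 / (16 * (N + 1))) * N" using s(4) N by (intro mult_right_mono) auto
  also have "\<dots> \<le> 1 / 8" using N by (simp add: field_simps)
  finally have small: "2 * s * card B * (card jet_index * C) \<le> 1 / 8" by (simp add: N_def mult.assoc)
  define S where "S = ball a s"
  have S: "open S" "convex S" "a \<in> S" "S \<subseteq> ball a r" "S \<subseteq> ball a e" using s by (auto simp: S_def)
  have SV: "S \<subseteq> \<phi> ` V" using S(4) image_core core(2) by blast
  interpret linear_system B S jet_index jet_coeff C "2 * s"
  proof
    show "finite jet_index" by (simp add: jet_index_def)
    show "smooth_on S (jet_coeff b i j)" for b i j
      unfolding jet_coeff_def
      by (auto split: option.split intro: smooth_on_const[OF S(1)] smooth_on_subset[OF christoffel_smooth SV])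
    show "\<bar>jet_coeff b i j x\<bar> \<le> C" if "b \<in> B" "i \<in> jet_index" "j \<in> jet_index" "x \<in> S" for b i j x
      using C(2) that S(4) by blast
    show "norm (x - y) \<le> 2 * s" if "x \<in> S" "y \<in> S" for x y
    proof -
      have "dist x y \<le> dist a x + dist a y" by (rule dist_triangle3)
      then show ?thesis using that by (simp add: S_def dist_norm)
    qed
  qed (use S C(1) small in auto)
  define U where "U = {p \<in> V. \<phi> p \<in> S}"
  have U: "open U" "U \<subseteq> V" using open_chart_preimage[OF chart S(1)] by (auto simp: U_def)
  have image_U: "\<phi> ` U = S" using SV unfolding U_def by auto
  have U_core: "U \<subseteq> core" using S(4) by (auto simp: U_def core_def)
  have \<phi>\<psi>: "\<phi> (\<psi> x) = x" if "x \<in> S" for x using that SV by (meson f_inv_into_f subsetD)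
  have form_None: "form w b None x = w (Some b) x" if "b \<in> B" for w b x
    using that by (simp add: form_def jet_coeff_sum)
  have form_Some: "form w b (Some c) x = (\<Sum>k\<in>B. christoffel b c k x * w (Some k) x)" for w b c x
    by (simp add: form_def jet_coeff_sum)
  have jet_solution: "solution (\<phi> ` W) (jet u)" if W: "open W" "W \<subseteq> U" and u: "affine_on W u" for W u
    unfolding solution_def
  proof (intro ballI)
    fix i x assume i: "i \<in> jet_index" and "x \<in> \<phi> ` W"
    then obtain p where p: "p \<in> W" "x = \<phi> p" by blast
    have Wc: "W \<subseteq> core" using W U_core by blast
    have uC: "u \<in> C_infinity A W" using u by (simp add: affine_on_def)
    have sm: "smooth_on (\<phi> ` W) (\<lambda>x. u (\<psi> x))"
      using C_infinity_chart_smooth[OF uC chart] chart_image_core[OF Wc] by simp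
    have x: "x \<in> \<phi> ` W" using p by blast
    from i show "(jet u i has_derivative (\<lambda>v. \<Sum>b\<in>B. (v \<bullet> b) * form (jet u) b i x)) (at x)"
    proof (cases rule: jet_index_cases)
      case 1
      from smooth_on_partials[OF sm x] show ?thesis
        unfolding 1 by (simp add: form_None jet_def cong: sum.cong)
    next
      case (2 c)
      have "form (jet u) b (Some c) x = dir_deriv b (dir_deriv c (\<lambda>x. u (\<psi> x))) x" if "b \<in> B" for b
        using affine_on_iff[OF W(1) Wc uC] u p that 2(1) by (simp add: form_Some jet_def)
      with smooth_on_partials[OF smooth_on_dir_deriv[OF sm] x, of c] show ?thesis
        unfolding 2(2) by (simp add: jet_def[of u "Some c"] cong: sum.cong)
    qed
  qed
  \<comment> \<open>Conversely, every solution is the jet of its component \<open>None\<close>: the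
    first equations say that the components \<open>Some c\<close> are its partial derivatives, the
    others that it is affine.\<close>
  have solution_affine: "affine_on U (\<lambda>p. w None (\<phi> p))"
    and solution_jet: "\<And>i x. i \<in> jet_index \<Longrightarrow> x \<in> S \<Longrightarrow> jet (\<lambda>p. w None (\<phi> p)) i x = w i x"
    if w: "solution S w" for w
  proof -
    let ?u = "\<lambda>p. w None (\<phi> p)"
    have N: "None \<in> jet_index" and Some: "Some c \<in> jet_index" if "c \<in> B" for c
      using that by (auto simp: jet_index_def)
    have None: "None \<in> jet_index" by (simp add: jet_index_def)
    have d0: "((\<lambda>x. ?u (\<psi> x)) has_derivative (\<lambda>v. \<Sum>b\<in>B. (v \<bullet> b) * form w b None x)) (at x)"
      if "x \<in> S" for x
      by (rule has_derivative_transform_within_open[OF w[unfolded solution_def, rule_format, OF None that] S(1) that])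
        (simp add: \<phi>\<psi>)
    have d1: "dir_deriv c (\<lambda>x. ?u (\<psi> x)) x = w (Some c) x" if "c \<in> B" "x \<in> S" for c x
    proof -
      have "dir_deriv c (\<lambda>x. ?u (\<psi> x)) x = (\<Sum>b\<in>B. (c \<bullet> b) * form w b None x)"
        by (rule dir_derivI[OF d0[OF that(2)]])
      also have "\<dots> = (\<Sum>b\<in>B. (if b = c then 1 else 0) * form w b None x)"
        using that(1) by (intro sum.cong) (auto simp: inner_B)
      finally show ?thesis using that(1) by (simp add: sum_delta_B form_None)
    qed
    have d2: "dir_deriv b (dir_deriv c (\<lambda>x. ?u (\<psi> x))) x = form w b (Some c) x"
      if "b \<in> B" "c \<in> B" "x \<in> S" for b c x
    proof -
      have "(dir_deriv c (\<lambda>x. ?u (\<psi> x)) has_derivative (\<lambda>v. \<Sum>b\<in>B. (v \<bullet> b) * form w b (Some c) x)) (at x)"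
        by (rule has_derivative_transform_within_open[OF
              w[unfolded solution_def, rule_format, OF Some[OF that(2)] that(3)] S(1) that(3)])
          (simp add: d1 that(2))
      from dir_derivI[OF this, of b]
      have "dir_deriv b (dir_deriv c (\<lambda>x. ?u (\<psi> x))) x = (\<Sum>b'\<in>B. (b \<bullet> b') * form w b' (Some c) x)" .
      also have "\<dots> = (\<Sum>b'\<in>B. (if b' = b then 1 else 0) * form w b' (Some c) x)"
        using that(1) by (intro sum.cong) (auto simp: inner_B)
      finally show ?thesis using that(1) by (simp add: sum_delta_B)
    qed
    have "smooth_on S (w None)" by (rule solution_smooth[OF S(1) order_refl w None])
    then have uC: "?u \<in> C_infinity A U"
      by (intro C_infinity_chart[OF chart U]) (simp add: image_U)
    show "affine_on U ?u"
      unfolding affine_on_iff[OF U(1) U_core uC]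
    proof (intro ballI)
      fix p b c assume "p \<in> U" "b \<in> B" "c \<in> B"
      moreover from this have "\<phi> p \<in> S" by (simp add: U_def)
      ultimately show "dir_deriv b (dir_deriv c (\<lambda>x. ?u (\<psi> x))) (\<phi> p) =
          (\<Sum>k\<in>B. christoffel b c k (\<phi> p) * dir_deriv k (\<lambda>x. ?u (\<psi> x)) (\<phi> p))"
        by (simp add: d2 form_Some d1)
    qed
    show "jet ?u i x = w i x" if "i \<in> jet_index" "x \<in> S" for i x
      using that(1) by (cases rule: jet_index_cases) (simp_all add: jet_def \<phi>\<psi> d1 that(2))
  qed
  show ?thesis
  proof (rule that)
    show "open U" by (fact U)
    show "U \<subseteq> U0"
    proof
      fix p assume "p \<in> U"
      then have "p \<in> V" "\<phi> p \<in> \<phi> ` (U0 \<inter> V)" using S(5) e(2) by (auto simp: U_def)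
      then show "p \<in> U0" using chart_facts(5)[OF chart] by (auto dest: inj_onD)
    qed
    show "\<psi> a \<in> U" using SV S(3) by (auto simp: U_def \<phi>\<psi> inv_into_into)
    have "U = \<psi> ` S" using image_U \<psi>\<phi> U(2) by force
    then show "path_connected U"
      using convex_imp_path_connected[OF S(2)] continuous_on_subset[OF chart_facts(4)[OF chart] SV]
      by (simp add: path_connected_continuous_image)
    fix u q x assume u: "affine_on U u" and q: "q \<in> U" and zero: "germ_eq q u (\<lambda>x. 0)" and x: "x \<in> U"
    have "smooth_near A q u" using u smooth_nearI[OF U(1) q] by (simp add: affine_on_def)
    \<comment> \<open>A zero germ has zero 1-jet at \<open>q\<close>, which is a zero initial value
      for the jet system.\<close>
    from dir_deriv_germ[OF chart _ this zero] have jet0: "jet u i (\<phi> q) = 0" for i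
      using q U(2) \<psi>\<phi>[of q] germ_eq_value[OF zero] dir_deriv_const by (cases i) (auto simp: jet_def)
    have sol: "solution S (jet u)" using jet_solution[OF U(1) order_refl u] image_U by simp
    have qx: "\<phi> q \<in> S" "\<phi> x \<in> S" "None \<in> jet_index" using q x by (auto simp: U_def jet_index_def)
    have "jet u None (\<phi> x) = 0" by (rule solution_unique[OF S(2) order_refl sol qx(1) jet0 qx(2,3)])
    then show "u x = 0" using x \<psi>\<phi>[of x] by (simp add: jet_def U_def)
  next
    fix W g q assume oW: "open W" "q \<in> W" "W \<subseteq> U" and g: "affine_on W g"
    have qU: "q \<in> U" "q \<in> V" "\<phi> q \<in> S" using oW by (auto simp: U_def)
    \<comment> \<open>The base point is \<open>\<phi> q\<close> rather than the centre of the ball;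
      this is why the smallness condition is stated with the diameter.\<close>
    interpret integrable_system B S jet_index jet_coeff C "2 * s" "\<phi> q" "\<lambda>i. jet g i (\<phi> q)"
      by unfold_locales (use qU jet_coeff_integrable S(4) in blast)+
    obtain w where w: "solution S w" "\<And>i. i \<in> jet_index \<Longrightarrow> w i (\<phi> q) = jet g i (\<phi> q)"
      using solution_exists by blast
    define u where "u = (\<lambda>p. w None (\<phi> p))"
    have u: "affine_on U u" "\<And>i. i \<in> jet_index \<Longrightarrow> jet u i (\<phi> q) = jet g i (\<phi> q)"
      unfolding u_def using solution_affine[OF w(1)] solution_jet[OF w(1) _ qU(3)] w(2) by simp_all
    define k where "k = (\<lambda>p. u p + (- 1) * g p)"
    have k: "affine_on W k"
      unfolding k_def by (intro affine_on_add oW(1) g affine_on_subset[OF u(1) oW(3)])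
    have "jet k i (\<phi> q) = jet u i (\<phi> q) - jet g i (\<phi> q)" for i
    proof (cases i)
      case (Some c)
      have "smooth_near A q u" "smooth_near A q g"
        using u(1) g smooth_nearI[OF U(1) qU(1)] smooth_nearI[OF oW(1,2)] by (auto simp: affine_on_def)
      from has_derivative_diff[OF chart_expr_derivative[OF chart qU(2) this(1)]
          chart_expr_derivative[OF chart qU(2) this(2)]]
      show ?thesis unfolding Some jet_def k_def by (simp add: dir_derivI)
    qed (simp add: jet_def k_def)
    then have zero: "jet k i (\<phi> q) = 0" if "i \<in> jet_index" for i using u(2)[OF that] by simp
    \<comment> \<open>The image of \<open>W\<close> need not be convex, so uniqueness is applied to
      \<open>k\<close> on a ball around \<open>\<phi> q\<close> inside it.\<close>
    have open_W: "open (\<phi> ` W)"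
      using open_chart_image[OF chart oW(1)] chart_image_core oW(3) U_core by (metis order_trans)
    then obtain \<epsilon> where \<epsilon>: "\<epsilon> > 0" "ball (\<phi> q) \<epsilon> \<subseteq> \<phi> ` W"
      using oW(2) by (meson image_eqI openE)
    have WS: "\<phi> ` W \<subseteq> S" using oW(3) image_U by blast
    have "u p = g p" if "p \<in> {p \<in> V. \<phi> p \<in> ball (\<phi> q) \<epsilon>}" for p
    proof -
      have "jet k None (\<phi> p) = 0"
        by (rule solution_unique[of "ball (\<phi> q) \<epsilon>" "jet k" "\<phi> q"])
          (use \<epsilon> WS zero that solution_mono[OF jet_solution[OF oW(1,3) k] \<epsilon>(2)] in \<open>auto simp: jet_index_def\<close>)
      then show ?thesis using that \<psi>\<phi>[of p] by (simp add: jet_def k_def)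
    qed
    then have "germ_eq q u g"
      using qU(2) \<epsilon>(1) by (intro germ_eq_open[OF open_chart_preimage[OF chart open_ball]]) auto
    then show "\<exists>u. affine_on U u \<and> germ_eq q u g" using u(1) by blast
  qed
qed

end

section \<open>Global potentials\<close>

locale hessian_manifold_basis = hessian_manifold A D h + affine_manifold_basis A D B
  for A :: "('m::{t2_space, second_countable_topology}, 'e::real_inner) chart set"
    and D :: "'m connection" and h :: "'m two_tensor" and B :: "'e set"
begin

definition potentials :: "'m set \<Rightarrow> ('m \<Rightarrow> real) set" where
  "potentials W = {f \<in> C_infinity A W. equals_hessian_on A D h W f}"

lemma potentialsD:
  assumes "f \<in> potentials W"
  shows "f \<in> C_infinity A W" "X \<in> VF \<Longrightarrow> Y \<in> VF \<Longrightarrow> p \<in> W \<Longrightarrow> hess f X Y p = h p (X p) (Y p)"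
  using assms by (auto simp: potentials_def equals_hessian_on_iff)

lemma potentialsI:
  assumes "f \<in> C_infinity A W" "\<And>X Y p. X \<in> VF \<Longrightarrow> Y \<in> VF \<Longrightarrow> p \<in> W \<Longrightarrow> hess f X Y p = h p (X p) (Y p)"
  shows "f \<in> potentials W"
  using assms by (auto simp: potentials_def equals_hessian_on_iff)

lemma potentials_subset: "f \<in> potentials W \<Longrightarrow> W' \<subseteq> W \<Longrightarrow> f \<in> potentials W'"
  by (auto intro!: potentialsI dest: potentialsD intro: C_infinity_subset)

lemma potentials_diff:
  assumes "open W" "f \<in> potentials W" "g \<in> potentials W"
  shows "affine_on W (\<lambda>x. f x + (- 1) * g x)"
  unfolding affine_on_def
  using assms(1) potentialsD[OF assms(2)] potentialsD[OF assms(3)]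
  by (auto simp: hess_add[where c = "- 1", simplified] intro: C_infinity_add[OF _ _ C_infinity_mult[OF _ C_infinity_const[where c = "- 1"]], simplified])

lemma potentials_add:
  assumes "open W" "f \<in> potentials W" "affine_on W u"
  shows "(\<lambda>x. f x + 1 * u x) \<in> potentials W"
proof (rule potentialsI)
  have u: "u \<in> C_infinity A W" using assms(3) by (simp add: affine_on_def)
  note f = potentialsD[OF assms(2)]
  show "(\<lambda>x. f x + 1 * u x) \<in> C_infinity A W" using C_infinity_add[OF assms(1) f(1) u] by simp
  fix X Y p assume "X \<in> VF" "Y \<in> VF" "p \<in> W"
  then show "hess (\<lambda>x. f x + 1 * u x) X Y p = h p (X p) (Y p)"
    using hess_add[OF _ _ assms(1) _ f(1) u, of X Y p 1] f(2) assms(3) unfolding affine_on_def by simp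
qed

text \<open>Relative to one potential \<open>f0\<close> on \<open>U\<close>, the potentials are
  \<open>f0\<close> plus affine functions, so both properties reduce to those of affine functions in
  \<open>affine_nhd\<close>.\<close>

lemma potentials_trivializing:
  "\<exists>U. open U \<and> p \<in> U \<and> path_connected U \<and> potentials U \<noteq> {} \<and>
    (\<forall>q\<in>U. \<forall>W g. open W \<longrightarrow> q \<in> W \<longrightarrow> g \<in> potentials W \<longrightarrow> (\<exists>F\<in>potentials U. germ_eq q F g)) \<and>
    (\<forall>F\<in>potentials U. \<forall>G\<in>potentials U. \<forall>q\<in>U. germ_eq q F G \<longrightarrow> (\<forall>x\<in>U. F x = G x))"
proof -
  obtain U0 f0 where U0: "open U0" "p \<in> U0" and "f0 \<in> C_infinity A U0" "equals_hessian_on A D h U0 f0"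
    using local_potential by blast
  then have f0: "f0 \<in> potentials U0" by (simp add: potentials_def)
  obtain V \<phi> where c: "(V, \<phi>) \<in> A" "p \<in> V" by (rule chart_exists)
  obtain R where R: "R > 0" "cball (\<phi> p) R \<subseteq> \<phi> ` V"
    using chart_facts(2)[OF c(1)] c(2) by (meson image_eqI open_contains_cball)
  have "0 \<le> R / 2" "R / 2 < R" using R(1) by auto
  then obtain \<rho> :: "'e \<Rightarrow> real" where "smooth_on UNIV \<rho>" "\<And>x. dist x (\<phi> p) \<le> R / 2 \<Longrightarrow> \<rho> x = 1"
    "\<And>x. dist x (\<phi> p) \<ge> R \<Longrightarrow> \<rho> x = 0"
    using smooth_bump_exists[of "R / 2" R "\<phi> p"] by blast
  then interpret coordinate_patch A D B V \<phi> "\<phi> p" "R / 2" R \<rho>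
    by unfold_locales (use c R in auto)
  have "\<phi> p \<in> \<phi> ` (U0 \<inter> V)" using U0(2) c(2) by blast
  from affine_nhd[OF U0(1) this]
  obtain U where U: "open U" "U \<subseteq> U0" "p \<in> U" "path_connected U"
    "\<And>u q x. affine_on U u \<Longrightarrow> q \<in> U \<Longrightarrow> germ_eq q u (\<lambda>x. 0) \<Longrightarrow> x \<in> U \<Longrightarrow> u x = 0"
    "\<And>W g q. open W \<Longrightarrow> q \<in> W \<Longrightarrow> W \<subseteq> U \<Longrightarrow> affine_on W g \<Longrightarrow> \<exists>u. affine_on U u \<and> germ_eq q u g"
    unfolding \<psi>\<phi>[OF c(2)] by blast
  have f0U: "f0 \<in> potentials U" by (rule potentials_subset[OF f0 U(2)])
  show ?thesis
  proof (intro exI conjI ballI allI impI)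
    show "potentials U \<noteq> {}" using f0U by blast
    fix q W g assume q: "q \<in> U" "q \<in> W" and W: "open W" and g: "g \<in> potentials W"
    \<comment> \<open>\<open>affine_nhd\<close> extends affine functions given on subsets of
      \<open>U\<close>, hence the intersection.\<close>
    have o: "open (W \<inter> U)" using W U(1) by blast
    have "affine_on (W \<inter> U) (\<lambda>x. g x + (- 1) * f0 x)"
      by (intro potentials_diff o potentials_subset[OF g] potentials_subset[OF f0U]) auto
    then obtain u where u: "affine_on U u" "germ_eq q u (\<lambda>x. g x + (- 1) * f0 x)"
      using U(6)[OF o, of q] q by blast
    have "germ_eq q (\<lambda>x. f0 x + 1 * u x) g"
      using u(2) unfolding germ_eq_def by eventually_elim simp
    then show "\<exists>F\<in>potentials U. germ_eq q F g" using potentials_add[OF U(1) f0U u(1)] by blast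
  next
    fix F G q x assume F: "F \<in> potentials U" and G: "G \<in> potentials U" and q: "q \<in> U" and x: "x \<in> U"
      and "germ_eq q F G"
    then have "germ_eq q (\<lambda>x. F x + (- 1) * G x) (\<lambda>x. 0)"
      unfolding germ_eq_def by (auto elim: eventually_mono)
    from U(5)[OF potentials_diff[OF U(1) F G] q this x] show "F x = G x" by simp
  qed fact+
qed

sublocale potentials: affine_local_system potentials
proof
  show "F \<in> potentials W'" if "F \<in> potentials W" "W' \<subseteq> W" for F W W'
    using that by (rule potentials_subset)
  show "f \<in> potentials W"
    if *: "\<And>p. p \<in> W \<Longrightarrow> \<exists>W' F. open W' \<and> p \<in> W' \<and> F \<in> potentials W' \<and> (\<forall>q\<in>W'. f q = F q)" for f W
  proof (rule potentialsI)
    show "f \<in> C_infinity A W"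
    proof (rule C_infinity_local)
      fix p assume "p \<in> W"
      from *[OF this] obtain W' F where "open W'" "p \<in> W'" "F \<in> potentials W'" "\<And>q. q \<in> W' \<Longrightarrow> F q = f q"
        by auto
      then show "\<exists>W. open W \<and> p \<in> W \<and> f \<in> C_infinity A W"
        using C_infinity_cong[of W' F f] potentialsD(1) by blast
    qed
    fix X Y p assume XY: "X \<in> VF" "Y \<in> VF" and "p \<in> W"
    from *[OF this(3)] obtain W' F where W': "open W'" "p \<in> W'" "F \<in> potentials W'" "\<And>q. q \<in> W' \<Longrightarrow> F q = f q"
      by auto
    have "hess F X Y p = hess f X Y p"
      by (rule hess_germ[OF XY smooth_nearI[OF W'(1,2) potentialsD(1)[OF W'(3)]] germ_eq_open[OF W'(1,2,4)]])
    then show "hess f X Y p = h p (X p) (Y p)" using potentialsD(2)[OF W'(3) XY W'(2)] by simp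
  qed
  show "(\<lambda>x. \<Sum>i\<in>C. c i * G i x) \<in> potentials W"
    if W: "open W" and C: "finite C" "sum c C = 1" and G: "\<And>i. i \<in> C \<Longrightarrow> G i \<in> potentials W"
    for W c G and C :: "('m \<Rightarrow> real) set set"
  proof (rule potentialsI)
    have GC: "G i \<in> C_infinity A W" if "i \<in> C" for i using potentialsD(1)[OF G[OF that]] .
    then show "(\<lambda>x. \<Sum>i\<in>C. c i * G i x) \<in> C_infinity A W"
      by (intro C_infinity_sum[OF W] C_infinity_mult[OF W] C_infinity_const[OF W])
    fix X Y p assume XY: "X \<in> VF" "Y \<in> VF" and p: "p \<in> W"
    have "hess (\<lambda>x. \<Sum>i\<in>C. c i * G i x) X Y p = (\<Sum>i\<in>C. c i * hess (G i) X Y p)"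
      by (rule hess_sum[OF XY C(1) W p GC])
    also have "\<dots> = (\<Sum>i\<in>C. c i * h p (X p) (Y p))"
      by (intro sum.cong refl) (simp add: potentialsD(2)[OF G XY p])
    \<comment> \<open>Here the normalisation of the coefficients enters: an affine combination of
      copies of \<open>h\<close> is \<open>h\<close>.\<close>
    also have "\<dots> = h p (X p) (Y p)" using C(2) by (simp add: sum_distrib_right[symmetric])
    finally show "hess (\<lambda>x. \<Sum>i\<in>C. c i * G i x) X Y p = h p (X p) (Y p)" .
  qed
qed (rule potentials_trivializing)

end

theorem theorem2p4:
  fixes A :: "('m::{t2_space, second_countable_topology}, 'e::real_inner) chart set"
    and D :: "'m connection"
    and h :: "'m two_tensor"
    and x0 :: 'm
  assumes "hessian_manifold A D h"
    and "finite (carrier (fundamental_group x0))"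
  shows "\<exists>f \<in> C_infinity A UNIV. equals_hessian_on A D h UNIV f"
proof -
  interpret hessian_manifold A D h by (rule assms)
  obtain B :: "'e set" where "orthonormal_basis B"
    using finite_dimensional orthonormal_basis_exists by blast
  then interpret hessian_manifold_basis A D h B
    by unfold_locales
  have "potentials UNIV \<noteq> {}"
    by (rule potentials.global_potential[OF connected_manifold assms(2)])
  then show ?thesis by (auto simp: potentials_def)
qed

end
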